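(* Let $R$ be a ring and $(\mathfrak m_\alpha)_{\alpha\in E}$ a family of pairwise coprime supramaximal ideals of $R$. For an $E$-flat $R$-algebra $A$, let $W^{\mathrm{fl}}_{R,E}(A)\subseteq A^{\mathbf N^{(E)}}$ be the $R$-algebra of $E$-typical Witt vectors. Then: (a) $W^{\mathrm{fl}}_{R,E}(A)$ is a sub-$\Psi_{R,E}$-ring of $A^{\mathbf N^{(E)}}$. (b) This $\Psi_{R,E}$-ring structure on $W^{\mathrm{fl}}_{R,E}(A)$ is a $\Lambda_{R,E}$-ring structure. (c) The induced functor $A\mapsto W^{\mathrm{fl}}_{R,E}(A)$ from $E$-flat $R$-algebras to $E$-flat $\Lambda_{R,E}$-rings is the right adjoint of the forgetful functor.
   Context: All rings are commutative with 1; $\mathbf N=\{0,1,2,\dots\}$. An ideal $\mathfrak m$ of a ring $R$ is supramaximal if either (i) $R/\mathfrak m$ is a finite field, $R_{\mathfrak m}$ is a discrete valuation ring and $\mathfrak m$ is finitely presented as an $R$-module, or (ii) $\mathfrak m=R$. Given a family $(\mathfrak m_\alpha)_{\alpha\in E}$ of pairwise coprime supramaximal ideals (the unit ideal may be repeated), put $q_\alpha=|R/\mathfrak m_\alpha|$ and $\mathbf N^{(E)}=\bigoplus_E\mathbf N$. An $R$-module (or $R$-algebra) $M$ is $E$-flat if for every maximal ideal $\mathfrak m$ in the family the map $\mathfrak m\otimes_RM\to M$ is injective. A $\Psi_{R,E}$-ring is an $R$-algebra with a commuting family $(\psi_\alpha)_{\alpha\in E}$ of $R$-algebra endomorphisms,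 i.e. an action of the monoid $\mathbf N^{(E)}$; morphisms are equivariant $R$-algebra maps. For an $E$-flat $R$-algebra, a $\Lambda_{R,E}$-ring structure is a $\Psi_{R,E}$-ring structure such that for every $\alpha\in E$ the endomorphism of $R/\mathfrak m_\alpha\otimes_RA$ induced by $\psi_\alpha$ is $x\mapsto x^{q_\alpha}$; morphisms of $E$-flat $\Lambda_{R,E}$-rings are morphisms of $\Psi_{R,E}$-rings. The forgetful functor sends an $E$-flat $\Lambda_{R,E}$-ring to its underlying $R$-algebra. For an $R$-algebra $A$, the product ring $A^{\mathbf N^{(E)}}$ is a $\Psi_{R,E}$-ring: for $m\in\mathbf N^{(E)}$ the $k$-th component of $\psi_m(a)$ is the $(k+m)$-th component of $a$. For $A$ $E$-flat, put $U_0(A)=A^{\mathbf N^{(E)}}$, $U_{i+1}(A)=\{b\in U_i(A):\psi_\alpha(b)-b^{q_\alpha}\in\mathfrak m_\alpha U_i(A)\text{ for all }\alpha\in E\}$, and $W^{\mathrm{fl}}_{R,E}(A)=\bigcap_{i\ge0}U_i(A)$, a sub-$R$-algebra of $A^{\mathbf N^{(E)}}$. The counit of the adjunction is the projection to the component of index $0$. *)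

theory Defs
  imports
    "HOL-Algebra.Module"
    "HOL-Algebra.QuotRing"
    "HOL-Algebra.Subrings"
    "HOL-Algebra.Ring_Divisibility"
    "HOL-Algebra.Generated_Groups"
    "HOL-Library.Poly_Mapping"
begin

section \<open>Localization and discrete valuation rings\<close>

definition frac_rel :: "('a, 'm) ring_scheme \<Rightarrow> 'a set \<Rightarrow> (('a \<times> 'a) \<times> ('a \<times> 'a)) set" where
  "frac_rel R S =
     {((a, s), (b, t)). a \<in> carrier R \<and> b \<in> carrier R \<and> s \<in> S \<and> t \<in> S \<and>
        (\<exists>u \<in> S. u \<otimes>\<^bsub>R\<^esub> ((a \<otimes>\<^bsub>R\<^esub> t) \<ominus>\<^bsub>R\<^esub> (b \<otimes>\<^bsub>R\<^esub> s)) = \<zero>\<^bsub>R\<^esub>)}"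

text \<open>The ring of fractions at a multiplicative set \<open>S\<close>; fractions are equivalence classes of
  pairs (numerator, denominator), and the operations are computed on representatives.\<close>

definition localization :: "('a, 'm) ring_scheme \<Rightarrow> 'a set \<Rightarrow> (('a \<times> 'a) set) ring" where
  "localization R S =
     \<lparr>carrier = (carrier R \<times> S) // frac_rel R S,
      monoid.mult = (\<lambda>X Y. \<Union>(a, s) \<in> X. \<Union>(b, t) \<in> Y. frac_rel R S `` {(a \<otimes>\<^bsub>R\<^esub> b, s \<otimes>\<^bsub>R\<^esub> t)}),
      one = frac_rel R S `` {(\<one>\<^bsub>R\<^esub>, \<one>\<^bsub>R\<^esub>)},
      zero = frac_rel R S `` {(\<zero>\<^bsub>R\<^esub>, \<one>\<^bsub>R\<^esub>)},
      add = (\<lambda>X Y. \<Union>(a, s) \<in> X. \<Union>(b, t) \<in> Y.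
               frac_rel R S `` {((a \<otimes>\<^bsub>R\<^esub> t) \<oplus>\<^bsub>R\<^esub> (b \<otimes>\<^bsub>R\<^esub> s), s \<otimes>\<^bsub>R\<^esub> t)})\<rparr>"

abbreviation localization_at :: "('a, 'm) ring_scheme \<Rightarrow> 'a set \<Rightarrow> (('a \<times> 'a) set) ring" where
  "localization_at R P \<equiv> localization R (carrier R - P)"

definition discrete_valuation_ring :: "('a, 'm) ring_scheme \<Rightarrow> bool" where
  "discrete_valuation_ring R \<longleftrightarrow>
     principal_domain R \<and> (\<exists>!P. primeideal P R \<and> P \<noteq> {\<zero>\<^bsub>R\<^esub>})"


section \<open>Modules\<close>

text \<open>In a \<open>module\<close> record used merely as a module, the fields \<open>mult\<close> and \<open>one\<close> are irrelevant.\<close>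

definition module_hom ::
  "('r, 'k) ring_scheme \<Rightarrow> ('r, 'a, 'm) module_scheme \<Rightarrow> ('r, 'b, 'n) module_scheme \<Rightarrow> ('a \<Rightarrow> 'b) set"
where
  "module_hom R M N =
     {h \<in> carrier M \<rightarrow> carrier N.
        (\<forall>x \<in> carrier M. \<forall>y \<in> carrier M. h (x \<oplus>\<^bsub>M\<^esub> y) = h x \<oplus>\<^bsub>N\<^esub> h y) \<and>
        (\<forall>r \<in> carrier R. \<forall>x \<in> carrier M. h (r \<odot>\<^bsub>M\<^esub> x) = r \<odot>\<^bsub>N\<^esub> h x)}"

definition free_module :: "('r, 'k) ring_scheme \<Rightarrow> nat \<Rightarrow> ('r, nat \<Rightarrow> 'r) module" where
  "free_module R n =
     \<lparr>carrier = {..<n} \<rightarrow>\<^sub>E carrier R,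
      monoid.mult = (\<lambda>x y. \<lambda>i\<in>{..<n}. x i \<otimes>\<^bsub>R\<^esub> y i),
      one = (\<lambda>i\<in>{..<n}. \<one>\<^bsub>R\<^esub>),
      zero = (\<lambda>i\<in>{..<n}. \<zero>\<^bsub>R\<^esub>),
      add = (\<lambda>x y. \<lambda>i\<in>{..<n}. x i \<oplus>\<^bsub>R\<^esub> y i),
      smult = (\<lambda>r x. \<lambda>i\<in>{..<n}. r \<otimes>\<^bsub>R\<^esub> x i)\<rparr>"

text \<open>Existence of an exact sequence \<open>R\<^sup>p \<rightarrow> R\<^sup>n \<rightarrow> M \<rightarrow> 0\<close>.\<close>

definition finitely_presented :: "('r, 'k) ring_scheme \<Rightarrow> ('r, 'a, 'm) module_scheme \<Rightarrow> bool" where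
  "finitely_presented R M \<longleftrightarrow>
     (\<exists>p n. \<exists>g \<in> module_hom R (free_module R p) (free_module R n).
            \<exists>f \<in> module_hom R (free_module R n) M.
        f ` carrier (free_module R n) = carrier M \<and>
        g ` carrier (free_module R p) = {x \<in> carrier (free_module R n). f x = \<zero>\<^bsub>M\<^esub>})"

definition ideal_module :: "('r, 'k) ring_scheme \<Rightarrow> 'r set \<Rightarrow> ('r, 'r) module" where
  "ideal_module R I =
     \<lparr>carrier = I, monoid.mult = monoid.mult R, one = \<one>\<^bsub>R\<^esub>,
      zero = \<zero>\<^bsub>R\<^esub>, add = add R, smult = monoid.mult R\<rparr>"

definition quot_algebra :: "('r, 'k) ring_scheme \<Rightarrow> 'r set \<Rightarrow> ('r, 'r set) module" where
  "quot_algebra R I =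
     ring.extend (R Quot I) (module.fields (\<lambda>r X. (I +>\<^bsub>R\<^esub> r) \<otimes>\<^bsub>R Quot I\<^esub> X))"


section \<open>Tensor products\<close>

text \<open>The free abelian group on \<open>carrier M \<times> carrier N\<close>, with the bilinear multiplication
  determined by \<open>(x, y) \<cdot> (x', y') = (x x', y y')\<close>. The latter is only meaningful when \<open>M\<close> and
  \<open>N\<close> are algebras.\<close>

definition pretensor ::
  "('r, 'a, 'm) module_scheme \<Rightarrow> ('r, 'b, 'n) module_scheme \<Rightarrow> (('a \<times> 'b) \<Rightarrow>\<^sub>0 int) ring"
where
  "pretensor M N =
     \<lparr>carrier = {c. Poly_Mapping.keys c \<subseteq> carrier M \<times> carrier N},
      monoid.mult = (\<lambda>c d. frag_extend (\<lambda>(x, y). frag_extend (\<lambda>(x', y').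
                      frag_of (x \<otimes>\<^bsub>M\<^esub> x', y \<otimes>\<^bsub>N\<^esub> y')) d) c),
      one = frag_of (\<one>\<^bsub>M\<^esub>, \<one>\<^bsub>N\<^esub>),
      zero = 0,
      add = (+)\<rparr>"

definition tensor_relations ::
  "('r, 'k) ring_scheme \<Rightarrow> ('r, 'a, 'm) module_scheme \<Rightarrow> ('r, 'b, 'n) module_scheme \<Rightarrow>
     (('a \<times> 'b) \<Rightarrow>\<^sub>0 int) set"
where
  "tensor_relations R M N = generate (add_monoid (pretensor M N))
     ({frag_of (x \<oplus>\<^bsub>M\<^esub> x', y) - frag_of (x, y) - frag_of (x', y) | x x' y.
          x \<in> carrier M \<and> x' \<in> carrier M \<and> y \<in> carrier N} \<union>
      {frag_of (x, y \<oplus>\<^bsub>N\<^esub> y') - frag_of (x, y) - frag_of (x, y') | x y y'.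
          x \<in> carrier M \<and> y \<in> carrier N \<and> y' \<in> carrier N} \<union>
      {frag_of (r \<odot>\<^bsub>M\<^esub> x, y) - frag_of (x, r \<odot>\<^bsub>N\<^esub> y) | r x y.
          r \<in> carrier R \<and> x \<in> carrier M \<and> y \<in> carrier N})"

text \<open>The tensor product as an abelian group for modules, and as a ring for algebras (there the
  subgroup of relations is an ideal).\<close>

definition tensor ::
  "('r, 'k) ring_scheme \<Rightarrow> ('r, 'a, 'm) module_scheme \<Rightarrow> ('r, 'b, 'n) module_scheme \<Rightarrow>
     ((('a \<times> 'b) \<Rightarrow>\<^sub>0 int) set) ring"
where
  "tensor R M N = pretensor M N Quot tensor_relations R M N"

text \<open>The endomorphism of the tensor product of \<open>M\<close> and \<open>N\<close> given by \<open>x \<otimes> y \<mapsto> x \<otimes> f y\<close>, for a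
  linear endomorphism \<open>f\<close> of \<open>N\<close>.\<close>

definition tensor_induced ::
  "('r, 'k) ring_scheme \<Rightarrow> ('r, 'a, 'm) module_scheme \<Rightarrow> ('r, 'b, 'n) module_scheme \<Rightarrow> ('b \<Rightarrow> 'b) \<Rightarrow>
     (('a \<times> 'b) \<Rightarrow>\<^sub>0 int) set \<Rightarrow> (('a \<times> 'b) \<Rightarrow>\<^sub>0 int) set"
where
  "tensor_induced R M N f X =
     (\<Union>c \<in> X. tensor_relations R M N +>\<^bsub>pretensor M N\<^esub> frag_extend (\<lambda>(x, y). frag_of (x, f y)) c)"

text \<open>The map \<open>r \<otimes> x \<mapsto> r x\<close> from the tensor product of an ideal with \<open>M\<close> to \<open>M\<close>; the additive
  extension of \<open>(r, x) \<mapsto> r x\<close> to formal sums is constant on every coset \<open>X\<close>.\<close>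

definition ideal_tensor_map ::
  "('r, 'a, 'm) module_scheme \<Rightarrow> (('r \<times> 'a) \<Rightarrow>\<^sub>0 int) set \<Rightarrow> 'a"
where
  "ideal_tensor_map M X = the_elem
     ((\<lambda>c. \<Oplus>\<^bsub>M\<^esub>p \<in> Poly_Mapping.keys c. [Poly_Mapping.lookup c p] \<cdot>\<^bsub>M\<^esub> (fst p \<odot>\<^bsub>M\<^esub> snd p)) ` X)"


section \<open>Supramaximal ideals and flatness\<close>

definition supramaximal :: "('r, 'k) ring_scheme \<Rightarrow> 'r set \<Rightarrow> bool" where
  "supramaximal R I \<longleftrightarrow> ideal I R \<and>
     (field (R Quot I) \<and> finite (carrier (R Quot I)) \<and>
        discrete_valuation_ring (localization_at R I) \<and>
        finitely_presented R (ideal_module R I)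
      \<or> I = carrier R)"

definition pairwise_coprime_ideals :: "('r, 'k) ring_scheme \<Rightarrow> 'e set \<Rightarrow> ('e \<Rightarrow> 'r set) \<Rightarrow> bool" where
  "pairwise_coprime_ideals R E \<mm> \<longleftrightarrow>
     (\<forall>\<alpha> \<in> E. \<forall>\<beta> \<in> E. \<alpha> \<noteq> \<beta> \<longrightarrow> \<mm> \<alpha> <+>\<^bsub>R\<^esub> \<mm> \<beta> = carrier R)"

definition residue_card :: "('r, 'k) ring_scheme \<Rightarrow> ('e \<Rightarrow> 'r set) \<Rightarrow> 'e \<Rightarrow> nat" where
  "residue_card R \<mm> \<alpha> = card (carrier (R Quot \<mm> \<alpha>))"

definition E_flat ::
  "('r, 'k) ring_scheme \<Rightarrow> 'e set \<Rightarrow> ('e \<Rightarrow> 'r set) \<Rightarrow> ('r, 'a, 'm) module_scheme \<Rightarrow> bool"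
where
  "E_flat R E \<mm> M \<longleftrightarrow>
     (\<forall>\<alpha> \<in> E. maximalideal (\<mm> \<alpha>) R \<longrightarrow>
        inj_on (ideal_tensor_map M) (carrier (tensor R (ideal_module R (\<mm> \<alpha>)) M)))"

definition E_flat_algebra ::
  "('r, 'k) ring_scheme \<Rightarrow> 'e set \<Rightarrow> ('e \<Rightarrow> 'r set) \<Rightarrow> ('r, 'a, 'm) module_scheme \<Rightarrow> bool"
where
  "E_flat_algebra R E \<mm> A \<longleftrightarrow> algebra R A \<and> E_flat R E \<mm> A"


section \<open>The categories of algebras, \<open>\<Psi>\<close>-rings and \<open>\<Lambda>\<close>-rings\<close>

definition alg_hom ::
  "('r, 'k) ring_scheme \<Rightarrow> ('r, 'a, 'm) module_scheme \<Rightarrow> ('r, 'b, 'n) module_scheme \<Rightarrow> ('a \<Rightarrow> 'b) set"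
where
  "alg_hom R A B =
     {h \<in> ring_hom A B. \<forall>r \<in> carrier R. \<forall>x \<in> carrier A. h (r \<odot>\<^bsub>A\<^esub> x) = r \<odot>\<^bsub>B\<^esub> h x}"

text \<open>The monoid \<open>\<nat>\<^bsup>(E)\<^esup>\<close>.\<close>

definition NE :: "'e set \<Rightarrow> ('e \<Rightarrow>\<^sub>0 nat) set" where
  "NE E = {k. Poly_Mapping.keys k \<subseteq> E}"

text \<open>A commuting family of endomorphisms indexed by \<open>E\<close> is encoded as the corresponding action
  \<open>psi\<close> of \<open>\<nat>\<^bsup>(E)\<^esup>\<close>; the member of the family at \<open>\<alpha>\<close> is the action of the basis vector at \<open>\<alpha>\<close>.\<close>

record ('r, 'a, 'e) psi_ring = "('r, 'a) module" +
  psi :: "('e \<Rightarrow>\<^sub>0 nat) \<Rightarrow> 'a \<Rightarrow> 'a"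

abbreviation psi_at :: "('r, 'a, 'e, 'm) psi_ring_scheme \<Rightarrow> 'e \<Rightarrow> 'a \<Rightarrow> 'a" where
  "psi_at B \<alpha> \<equiv> psi B (Poly_Mapping.single \<alpha> 1)"

definition is_psi_ring :: "('r, 'k) ring_scheme \<Rightarrow> 'e set \<Rightarrow> ('r, 'a, 'e, 'm) psi_ring_scheme \<Rightarrow> bool"
where
  "is_psi_ring R E B \<longleftrightarrow> algebra R B \<and>
     (\<forall>k \<in> NE E. psi B k \<in> alg_hom R B B) \<and>
     (\<forall>x \<in> carrier B. psi B 0 x = x) \<and>
     (\<forall>k \<in> NE E. \<forall>l \<in> NE E. \<forall>x \<in> carrier B. psi B (k + l) x = psi B k (psi B l x))"

definition is_lambda_ring ::
  "('r, 'k) ring_scheme \<Rightarrow> 'e set \<Rightarrow> ('e \<Rightarrow> 'r set) \<Rightarrow> ('r, 'a, 'e, 'm) psi_ring_scheme \<Rightarrow> bool"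
where
  "is_lambda_ring R E \<mm> B \<longleftrightarrow> is_psi_ring R E B \<and>
     (\<forall>\<alpha> \<in> E. \<forall>x \<in> carrier (tensor R (quot_algebra R (\<mm> \<alpha>)) B).
        tensor_induced R (quot_algebra R (\<mm> \<alpha>)) B (psi_at B \<alpha>) x
          = x [^]\<^bsub>tensor R (quot_algebra R (\<mm> \<alpha>)) B\<^esub> residue_card R \<mm> \<alpha>)"

definition E_flat_lambda_ring ::
  "('r, 'k) ring_scheme \<Rightarrow> 'e set \<Rightarrow> ('e \<Rightarrow> 'r set) \<Rightarrow> ('r, 'a, 'e, 'm) psi_ring_scheme \<Rightarrow> bool"
where
  "E_flat_lambda_ring R E \<mm> B \<longleftrightarrow> E_flat R E \<mm> B \<and> is_lambda_ring R E \<mm> B"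

text \<open>In the hom-sets below, maps are \<open>extensional\<close>, so that equality of morphisms is equality on
  the carrier; composition is \<^const>\<open>compose\<close>.\<close>

definition Hom_alg ::
  "('r, 'k) ring_scheme \<Rightarrow> ('r, 'a, 'm) module_scheme \<Rightarrow> ('r, 'b, 'n) module_scheme \<Rightarrow> ('a \<Rightarrow> 'b) set"
where
  "Hom_alg R A B = alg_hom R A B \<inter> extensional (carrier A)"

definition Hom_psi ::
  "('r, 'k) ring_scheme \<Rightarrow> 'e set \<Rightarrow> ('r, 'a, 'e, 'm) psi_ring_scheme \<Rightarrow>
     ('r, 'b, 'e, 'n) psi_ring_scheme \<Rightarrow> ('a \<Rightarrow> 'b) set"
where
  "Hom_psi R E B C =
     {h \<in> Hom_alg R B C. \<forall>k \<in> NE E. \<forall>x \<in> carrier B. h (psi B k x) = psi C k (h x)}"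

definition underlying_algebra :: "('r, 'a, 'e, 'm) psi_ring_scheme \<Rightarrow> ('r, 'a) module" where
  "underlying_algebra B = module.truncate B"

definition is_sub_psi_ring ::
  "('r, 'k) ring_scheme \<Rightarrow> 'e set \<Rightarrow> 'a set \<Rightarrow> ('r, 'a, 'e, 'm) psi_ring_scheme \<Rightarrow> bool"
where
  "is_sub_psi_ring R E S B \<longleftrightarrow> is_psi_ring R E B \<and> subring S B \<and>
     (\<forall>r \<in> carrier R. \<forall>x \<in> S. r \<odot>\<^bsub>B\<^esub> x \<in> S) \<and>
     (\<forall>k \<in> NE E. \<forall>x \<in> S. psi B k x \<in> S)"


section \<open>Witt vectors\<close>

definition ghost_ring ::
  "'e set \<Rightarrow> ('r, 'a, 'm) module_scheme \<Rightarrow> ('r, ('e \<Rightarrow>\<^sub>0 nat) \<Rightarrow> 'a, 'e) psi_ring"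
where
  "ghost_ring E A =
     \<lparr>carrier = NE E \<rightarrow>\<^sub>E carrier A,
      monoid.mult = (\<lambda>a b. \<lambda>k\<in>NE E. a k \<otimes>\<^bsub>A\<^esub> b k),
      one = (\<lambda>k\<in>NE E. \<one>\<^bsub>A\<^esub>),
      zero = (\<lambda>k\<in>NE E. \<zero>\<^bsub>A\<^esub>),
      add = (\<lambda>a b. \<lambda>k\<in>NE E. a k \<oplus>\<^bsub>A\<^esub> b k),
      smult = (\<lambda>r a. \<lambda>k\<in>NE E. r \<odot>\<^bsub>A\<^esub> a k),
      psi = (\<lambda>m a. \<lambda>k\<in>NE E. a (k + m))\<rparr>"

text \<open>The additive subgroup \<open>I S\<close> of \<open>M\<close> generated by the products \<open>r x\<close> with \<open>r \<in> I\<close>, \<open>x \<in> S\<close>.\<close>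

definition ideal_smult :: "'r set \<Rightarrow> 'a set \<Rightarrow> ('r, 'a, 'm) module_scheme \<Rightarrow> 'a set" where
  "ideal_smult I S M = generate (add_monoid M) {r \<odot>\<^bsub>M\<^esub> x | r x. r \<in> I \<and> x \<in> S}"

primrec witt_approx ::
  "('r, 'k) ring_scheme \<Rightarrow> 'e set \<Rightarrow> ('e \<Rightarrow> 'r set) \<Rightarrow> ('r, 'a, 'm) module_scheme \<Rightarrow> nat \<Rightarrow>
     (('e \<Rightarrow>\<^sub>0 nat) \<Rightarrow> 'a) set"
where
  "witt_approx R E \<mm> A 0 = carrier (ghost_ring E A)"
| "witt_approx R E \<mm> A (Suc i) =
     {b \<in> witt_approx R E \<mm> A i. \<forall>\<alpha> \<in> E.
        psi_at (ghost_ring E A) \<alpha> b \<ominus>\<^bsub>ghost_ring E A\<^esub> (b [^]\<^bsub>ghost_ring E A\<^esub> residue_card R \<mm> \<alpha>)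
          \<in> ideal_smult (\<mm> \<alpha>) (witt_approx R E \<mm> A i) (ghost_ring E A)}"

definition witt_vectors ::
  "('r, 'k) ring_scheme \<Rightarrow> 'e set \<Rightarrow> ('e \<Rightarrow> 'r set) \<Rightarrow> ('r, 'a, 'm) module_scheme \<Rightarrow>
     (('e \<Rightarrow>\<^sub>0 nat) \<Rightarrow> 'a) set"
where
  "witt_vectors R E \<mm> A = (\<Inter>i. witt_approx R E \<mm> A i)"

definition witt_ring ::
  "('r, 'k) ring_scheme \<Rightarrow> 'e set \<Rightarrow> ('e \<Rightarrow> 'r set) \<Rightarrow> ('r, 'a, 'm) module_scheme \<Rightarrow>
     ('r, ('e \<Rightarrow>\<^sub>0 nat) \<Rightarrow> 'a, 'e) psi_ring"
where
  "witt_ring R E \<mm> A = (ghost_ring E A)\<lparr>carrier := witt_vectors R E \<mm> A\<rparr>"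

definition witt_map ::
  "('r, 'k) ring_scheme \<Rightarrow> 'e set \<Rightarrow> ('e \<Rightarrow> 'r set) \<Rightarrow> ('r, 'a, 'm) module_scheme \<Rightarrow> ('a \<Rightarrow> 'b) \<Rightarrow>
     (('e \<Rightarrow>\<^sub>0 nat) \<Rightarrow> 'a) \<Rightarrow> (('e \<Rightarrow>\<^sub>0 nat) \<Rightarrow> 'b)"
where
  "witt_map R E \<mm> A g = (\<lambda>a\<in>witt_vectors R E \<mm> A. \<lambda>k\<in>NE E. g (a k))"

definition witt_counit ::
  "('r, 'k) ring_scheme \<Rightarrow> 'e set \<Rightarrow> ('e \<Rightarrow> 'r set) \<Rightarrow> ('r, 'a, 'm) module_scheme \<Rightarrow>
     (('e \<Rightarrow>\<^sub>0 nat) \<Rightarrow> 'a) \<Rightarrow> 'a"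
where
  "witt_counit R E \<mm> A = (\<lambda>a\<in>witt_vectors R E \<mm> A. a 0)"

end

theory Submission
  imports Defs "HOL-Algebra.Free_Abelian_Groups" "HOL-Algebra.Sylow"
begin

text \<open>A supramaximal maximal ideal \<open>m\<close> is an invertible module. Concretely there are \<open>e, t \<in> m\<close> and a
  linear form \<open>\<phi>\<close> on \<open>m\<close> with \<open>x = e x + t \<phi>(x)\<close> for all \<open>x \<in> m\<close>. Hence \<open>M\<close> is flat at \<open>m\<close> if and only
  if \<open>e y + t z = 0\<close> implies \<open>\<phi>(e) y + \<phi>(t) z = 0\<close> in \<open>M\<close>. This passes to products and to submodules,
  so the Witt vectors are flat. For flat modules it also yields that \<open>m\<close> times an intersection is the
  intersection of the multiples by \<open>m\<close>, so \<open>\<psi>(b) - b\<^sup>q \<in> m U\<^sub>i\<close> for all \<open>i\<close> gives \<open>\<psi>(b) - b\<^sup>q \<in> m W\<close>.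
  As \<open>R/m \<otimes> W\<close> is \<open>W/mW\<close>, this is the \<open>\<Lambda>\<close>-ring condition. An algebra map \<open>g : B \<rightarrow> A\<close> from a
  \<open>\<Lambda>\<close>-ring extends uniquely to the equivariant map \<open>b \<mapsto> (g (\<psi>\<^sub>k b))\<^sub>k\<close>, and this map lands in every
  \<open>U\<^sub>i\<close> by induction, since equivariant maps preserve the condition that defines \<open>U\<^sub>i\<^sub>+\<^sub>1\<close>.\<close>

section \<open>Supramaximal ideals are invertible\<close>

text \<open>The linear form \<open>\<phi>\<close> comes from a local statement. The valuation ring
  yields an element \<open>t\<close> of \<open>m\<close> that generates \<open>m\<close> after
  localization and is regular there. Finite presentation yields one \<open>s\<close> outside
  \<open>m\<close> that achieves both before localization: \<open>s m\<close> lies in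
  \<open>t R\<close>, and \<open>s\<close> kills the annihilator of \<open>t\<close>. So
  \<open>s x\<close> can be divided by \<open>t\<close>, the quotient becomes unique after one more
  factor \<open>s\<close>, and this is \<open>\<phi>\<close>. Since \<open>s\<close> squared is
  invertible modulo \<open>m\<close>, an element \<open>e\<close> of \<open>m\<close> fills the gap
  to 1.

  That every \<open>U\<^sub>i\<close> is a subalgebra rests on the residue field: \<open>q\<close>
  is a power of its characteristic \<open>p\<close>, so the \<open>q\<close>-th power is additive up
  to \<open>p U\<^sub>i\<close>, and \<open>r^q - r\<close> lies in \<open>m\<close> for every
  scalar \<open>r\<close>.

  The obstacle in the limit is coherence. For each \<open>i\<close> the element
  \<open>\<psi>(b) - b^q\<close> is a combination of \<open>e\<close> and \<open>t\<close> with
  coefficients in \<open>U\<^sub>i\<close>, but these may change with \<open>i\<close>. Flatness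
  permits coefficients that are the same for all \<open>i\<close>.\<close>

lemma (in cring) frac_rel_equiv:
  assumes "S \<subseteq> carrier R" "\<one> \<in> S" "\<And>x y. x \<in> S \<Longrightarrow> y \<in> S \<Longrightarrow> x \<otimes> y \<in> S"
  shows "equiv (carrier R \<times> S) (frac_rel R S)"
proof (rule equivI)
  show "frac_rel R S \<subseteq> (carrier R \<times> S) \<times> (carrier R \<times> S)"
    by (auto simp: frac_rel_def)
  show "refl_on (carrier R \<times> S) (frac_rel R S)"
    using assms(1,2) by (auto simp: refl_on_def frac_rel_def a_minus_def r_neg intro!: bexI[of _ \<one>] dest: subsetD)
  show "sym (frac_rel R S)"
  proof (rule symI, clarsimp simp: frac_rel_def)
    fix a s b t u
    assume *: "a \<in> carrier R" "b \<in> carrier R" "s \<in> S" "t \<in> S" "u \<in> S" "u \<otimes> (a \<otimes> t \<ominus> b \<otimes> s) = \<zero>"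
    then have c: "s \<in> carrier R" "t \<in> carrier R" "u \<in> carrier R" using assms(1) by auto
    have "u \<otimes> (b \<otimes> s \<ominus> a \<otimes> t) = \<ominus> (u \<otimes> (a \<otimes> t \<ominus> b \<otimes> s))"
      using *(1-2) c by algebra
    then show "\<exists>u\<in>S. u \<otimes> (b \<otimes> s \<ominus> a \<otimes> t) = \<zero>" using * by auto
  qed
  show "trans (frac_rel R S)"
  proof (rule transI, clarsimp simp: frac_rel_def)
    fix a s b t c w u v
    assume *: "a \<in> carrier R" "b \<in> carrier R" "c \<in> carrier R" "s \<in> S" "t \<in> S" "w \<in> S" "u \<in> S" "v \<in> S"
      and 1: "u \<otimes> (a \<otimes> t \<ominus> b \<otimes> s) = \<zero>" and 2: "v \<otimes> (b \<otimes> w \<ominus> c \<otimes> t) = \<zero>"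
    then have c: "s \<in> carrier R" "t \<in> carrier R" "u \<in> carrier R" "w \<in> carrier R" "v \<in> carrier R"
      using assms(1) by auto
    \<comment> \<open>Eliminating the middle fraction multiplies by its denominator
      \<open>t\<close>, which cannot be cancelled again; it joins \<open>u\<close> and
      \<open>v\<close> in the witness.\<close>
    have "u \<otimes> v \<otimes> t \<otimes> (a \<otimes> w \<ominus> c \<otimes> s) =
      v \<otimes> w \<otimes> (u \<otimes> (a \<otimes> t \<ominus> b \<otimes> s)) \<oplus> u \<otimes> s \<otimes> (v \<otimes> (b \<otimes> w \<ominus> c \<otimes> t))"
      using *(1-3) c by algebra
    also have "\<dots> = \<zero>" unfolding 1 2 using c by simp
    finally show "\<exists>u\<in>S. u \<otimes> (a \<otimes> w \<ominus> c \<otimes> s) = \<zero>" using * assms(3) by blast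
  qed
qed

text \<open>That the fractions form a ring is assumed here. In the application it is part of the
  hypothesis of a discrete valuation ring, and it takes the place of a check that the operations are
  independent of representatives.\<close>

locale frac_ring = cring R for R (structure) +
  fixes S
  assumes S_sub: "S \<subseteq> carrier R" and S_one: "\<one> \<in> S"
    and S_mult: "\<And>x y. x \<in> S \<Longrightarrow> y \<in> S \<Longrightarrow> x \<otimes> y \<in> S"
    and D_cring: "cring (localization R S)"
begin

abbreviation "fr a s \<equiv> frac_rel R S `` {(a, s)}"

sublocale D: cring "localization R S" by (rule D_cring)

lemma equiv_frac: "equiv (carrier R \<times> S) (frac_rel R S)"
  using frac_rel_equiv S_sub S_one S_mult by blast

lemma carrier_loc: "carrier (localization R S) = {fr a s | a s. a \<in> carrier R \<and> s \<in> S}"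
  by (auto simp: localization_def quotient_def)

lemma frac_in [simp, intro]: "a \<in> carrier R \<Longrightarrow> s \<in> S \<Longrightarrow> fr a s \<in> carrier (localization R S)"
  by (auto simp: carrier_loc)

lemma frac_self: "a \<in> carrier R \<Longrightarrow> s \<in> S \<Longrightarrow> (a, s) \<in> fr a s"
  using equiv_class_self[OF equiv_frac] by blast

lemma frac_eqI: "X \<in> carrier (localization R S) \<Longrightarrow> (a, s) \<in> X \<Longrightarrow> X = fr a s"
proof -
  assume "X \<in> carrier (localization R S)" "(a, s) \<in> X"
  then obtain b t where "X = fr b t" "((b, t), (a, s)) \<in> frac_rel R S" by (auto simp: carrier_loc)
  then show "X = fr a s" using equiv_class_eq[OF equiv_frac] by simp
qed

text \<open>The product is defined as a union of classes, and closure of the carrier makes it a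
  single class. One of its elements therefore determines it.\<close>

lemma frac_mult:
  assumes "a \<in> carrier R" "s \<in> S" "b \<in> carrier R" "t \<in> S"
  shows "fr a s \<otimes>\<^bsub>localization R S\<^esub> fr b t = fr (a \<otimes> b) (s \<otimes> t)"
proof (rule frac_eqI)
  have "(a \<otimes> b, s \<otimes> t) \<in> fr (a \<otimes> b) (s \<otimes> t)"
    using assms by (intro frac_self S_mult m_closed)
  then show "(a \<otimes> b, s \<otimes> t) \<in> fr a s \<otimes>\<^bsub>localization R S\<^esub> fr b t"
    using frac_self[OF assms(1,2)] frac_self[OF assms(3,4)] by (force simp: localization_def)
qed (use assms in auto)

lemma frac_add:
  assumes "a \<in> carrier R" "s \<in> S" "b \<in> carrier R" "t \<in> S"
  shows "fr a s \<oplus>\<^bsub>localization R S\<^esub> fr b t = fr (a \<otimes> t \<oplus> b \<otimes> s) (s \<otimes> t)"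
proof (rule frac_eqI)
  have "(a \<otimes> t \<oplus> b \<otimes> s, s \<otimes> t) \<in> fr (a \<otimes> t \<oplus> b \<otimes> s) (s \<otimes> t)"
    using assms S_sub by (intro frac_self S_mult m_closed a_closed) auto
  then show "(a \<otimes> t \<oplus> b \<otimes> s, s \<otimes> t) \<in> fr a s \<oplus>\<^bsub>localization R S\<^esub> fr b t"
    using frac_self[OF assms(1,2)] frac_self[OF assms(3,4)] by (force simp: localization_def)
qed (use assms in auto)

lemma one_loc: "\<one>\<^bsub>localization R S\<^esub> = fr \<one> \<one>" and zero_loc: "\<zero>\<^bsub>localization R S\<^esub> = fr \<zero> \<one>"
  by (simp_all add: localization_def)

lemma frac_eq_iff:
  assumes "a \<in> carrier R" "s \<in> S" "b \<in> carrier R" "t \<in> S"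
  shows "fr a s = fr b t \<longleftrightarrow> (\<exists>u\<in>S. u \<otimes> (a \<otimes> t \<ominus> b \<otimes> s) = \<zero>)"
  using eq_equiv_class_iff[OF equiv_frac, of "(a,s)" "(b,t)"] assms
  by (auto simp: frac_rel_def)

lemma frac_eq_zero_iff:
  assumes "a \<in> carrier R" "s \<in> S"
  shows "fr a s = \<zero>\<^bsub>localization R S\<^esub> \<longleftrightarrow> (\<exists>u\<in>S. u \<otimes> a = \<zero>)"
proof -
  have [simp]: "s \<in> carrier R" using assms S_sub by auto
  have "u \<otimes> (a \<otimes> \<one> \<ominus> \<zero> \<otimes> s) = u \<otimes> a" if "u \<in> S" for u
    using that assms S_sub by (auto simp: a_minus_def)
  then show ?thesis unfolding zero_loc using assms S_one by (subst frac_eq_iff) auto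
qed

end


section \<open>Residue field and local generator of a supramaximal ideal\<close>

lemma (in cring) field_quot_inverse:
  assumes "ideal m R" "field (R Quot m)" "a \<in> carrier R" "a \<notin> m"
  shows "\<exists>b\<in>carrier R. \<exists>e\<in>m. a \<otimes> b \<oplus> e = \<one>"
proof -
  interpret ideal m R by fact
  interpret F: field "R Quot m" by fact
  have "m +> a \<noteq> m" using a_rcos_self[OF assms(3)] assms(4) by auto
  then have "m +> a \<in> Units (R Quot m)"
    using assms(3) by (auto simp: F.field_Units) (auto simp: FactRing_def A_RCOSETS_def')
  then obtain b where b: "b \<in> carrier R" "(m +> a) \<otimes>\<^bsub>R Quot m\<^esub> (m +> b) = \<one>\<^bsub>R Quot m\<^esub>"
    by (auto simp: Units_def) (auto simp: FactRing_def A_RCOSETS_def')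
  then have "m +> a \<otimes> b = m +> \<one>"
    using assms(3) by (simp add: FactRing_def rcoset_mult_add)
  then have "\<one> \<in> m +> a \<otimes> b" using a_rcos_self by auto
  then obtain e where e: "e \<in> m" "\<one> = e \<oplus> a \<otimes> b"
    by (auto simp: a_r_coset_def')
  then have "a \<otimes> b \<oplus> e = \<one>" using assms(3) b(1) a_comm[of e "a \<otimes> b"] a_Hcarr[OF e(1)] by simp
  then show ?thesis using b(1) e(1) by blast
qed

lemma (in cring) field_quot_maximalideal:
  assumes "ideal m R" "field (R Quot m)"
  shows "maximalideal m R"
proof (rule maximalidealI)
  interpret m: ideal m R by fact
  interpret F: field "R Quot m" by fact
  show "ideal m R" by fact
  show "carrier R \<noteq> m"
  proof
    assume "carrier R = m"
    then have "\<one> \<in> m" by (metis one_closed)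
    then have "m +> \<one> = m" by (rule m.a_rcos_const)
    then show False using F.one_not_zero by (simp add: FactRing_def)
  qed
  fix J assume J: "ideal J R" "m \<subseteq> J" "J \<subseteq> carrier R"
  interpret J: ideal J R by (rule J(1))
  show "J = m \<or> J = carrier R"
  proof (cases "J \<subseteq> m")
    case True
    then show ?thesis using J(2) by blast
  next
    case False
    then obtain a where a: "a \<in> J" "a \<notin> m" by blast
    obtain b e where be: "b \<in> carrier R" "e \<in> m" "a \<otimes> b \<oplus> e = \<one>"
      using field_quot_inverse[OF assms J.a_Hcarr[OF a(1)] a(2)] by blast
    have "a \<otimes> b \<oplus> e \<in> J"
      by (intro J.a_closed J.I_r_closed) (use a(1) be J(2) in auto)
    then have "J = carrier R" unfolding be(3) by (rule J.one_imp_carrier)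
    then show ?thesis by blast
  qed
qed

text \<open>The fractions with numerator in \<open>m\<close> form an ideal of a principal domain,
  and \<open>t\<close> is the numerator of a generator. Clearing denominators turns membership in
  this ideal into the divisibility property. The property of annihilators holds because the
  localization has no zero divisors and \<open>t\<close> is nonzero in it.\<close>

lemma (in cring) dvr_localization_generator:
  assumes "primeideal m R" "discrete_valuation_ring (localization_at R m)"
  obtains t where "t \<in> m"
    "\<And>x. x \<in> m \<Longrightarrow> \<exists>s\<in>carrier R - m. \<exists>y\<in>carrier R. s \<otimes> x = t \<otimes> y"
    "\<And>y. y \<in> carrier R \<Longrightarrow> t \<otimes> y = \<zero> \<Longrightarrow> \<exists>s\<in>carrier R - m. s \<otimes> y = \<zero>"
proof -
  interpret m: primeideal m R by fact
  let ?S = "carrier R - m"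
  let ?D = "localization R ?S"
  from assms(2) have PD: "principal_domain ?D" and ex: "\<exists>P. primeideal P ?D \<and> P \<noteq> {\<zero>\<^bsub>?D\<^esub>}"
    by (auto simp: discrete_valuation_ring_def)
  interpret PD: principal_domain ?D by (rule PD)
  have oneS: "\<one> \<in> ?S" using m.I_notcarr m.one_imp_carrier by auto
  interpret F: frac_ring R ?S
    by unfold_locales (use oneS m.I_prime in auto)
  let ?M = "{F.fr a s | a s. a \<in> m \<and> s \<in> ?S}"
  have mult: "X \<otimes>\<^bsub>?D\<^esub> Y \<in> ?M" if "X \<in> ?M" "Y \<in> carrier ?D" for X Y
  proof -
    from that obtain a s b t where *: "a \<in> m" "s \<in> ?S" "X = F.fr a s" "b \<in> carrier R" "t \<in> ?S" "Y = F.fr b t"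
      by (auto simp: F.carrier_loc)
    then have "X \<otimes>\<^bsub>?D\<^esub> Y = F.fr (a \<otimes> b) (s \<otimes> t)" using m.a_Hcarr by (simp add: F.frac_mult)
    moreover have "a \<otimes> b \<in> m" "s \<otimes> t \<in> ?S" using * m.I_r_closed F.S_mult by auto
    ultimately show ?thesis by blast
  qed
  have M_sub: "?M \<subseteq> carrier ?D" using F.frac_in m.a_Hcarr by auto
  have "ideal ?M ?D"
  proof (rule idealI)
    show "ring ?D" by (rule PD.ring_axioms)
    show "subgroup ?M (add_monoid ?D)"
    proof (rule PD.add.subgroupI)
      show "?M \<subseteq> carrier ?D" by fact
      show "?M \<noteq> {}" using m.zero_closed oneS by blast
      fix X assume X: "X \<in> ?M"
      then have "X \<otimes>\<^bsub>?D\<^esub> (\<ominus>\<^bsub>?D\<^esub> \<one>\<^bsub>?D\<^esub>) \<in> ?M" by (intro mult) auto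
      then show "\<ominus>\<^bsub>?D\<^esub> X \<in> ?M" using X M_sub by (simp add: PD.r_minus subset_iff)
      fix Y assume Y: "Y \<in> ?M"
      from X Y obtain a s b t where *: "a \<in> m" "s \<in> ?S" "X = F.fr a s" "b \<in> m" "t \<in> ?S" "Y = F.fr b t"
        by auto
      then have "X \<oplus>\<^bsub>?D\<^esub> Y = F.fr (a \<otimes> t \<oplus> b \<otimes> s) (s \<otimes> t)" using m.a_Hcarr by (simp add: F.frac_add)
      moreover have "a \<otimes> t \<oplus> b \<otimes> s \<in> m" "s \<otimes> t \<in> ?S" using * m.I_r_closed F.S_mult by auto
      ultimately show "X \<oplus>\<^bsub>?D\<^esub> Y \<in> ?M" by blast
    qed
    fix X Y assume "X \<in> ?M" "Y \<in> carrier ?D"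
    then show "X \<otimes>\<^bsub>?D\<^esub> Y \<in> ?M" "Y \<otimes>\<^bsub>?D\<^esub> X \<in> ?M"
      using mult M_sub PD.m_comm by (metis (no_types, lifting) subsetD)+
  qed
  then obtain p where p: "p \<in> carrier ?D" "?M = PIdl\<^bsub>?D\<^esub> p"
    using PD.exists_gen by blast
  have "p \<in> ?M" unfolding p(2) by (rule PD.cgenideal_self[OF p(1)])
  then obtain t s0 where t: "t \<in> m" "s0 \<in> ?S" "p = F.fr t s0" by auto
  have tc [simp]: "t \<in> carrier R" using t m.a_Hcarr by auto
  have gen: "\<exists>s\<in>?S. \<exists>y\<in>carrier R. s \<otimes> x = t \<otimes> y" if x: "x \<in> m" for x
  proof -
    have xc: "x \<in> carrier R" using x m.a_Hcarr by auto
    have "F.fr x \<one> \<in> PIdl\<^bsub>?D\<^esub> p" unfolding p(2)[symmetric] using x oneS by blast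
    then obtain b w where b: "b \<in> carrier R" "w \<in> ?S" "F.fr x \<one> = F.fr b w \<otimes>\<^bsub>?D\<^esub> F.fr t s0"
      unfolding cgenideal_def t(3) by (auto simp: F.carrier_loc)
    then have "F.fr x \<one> = F.fr (b \<otimes> t) (w \<otimes> s0)" using t(2) by (simp add: F.frac_mult)
    then obtain u where u: "u \<in> ?S" "u \<otimes> (x \<otimes> (w \<otimes> s0) \<ominus> b \<otimes> t \<otimes> \<one>) = \<zero>"
      using F.frac_eq_iff[of x \<one> "b \<otimes> t" "w \<otimes> s0"] b t oneS xc F.S_mult by auto
    have c: "u \<in> carrier R" "w \<in> carrier R" "s0 \<in> carrier R" using u(1) b t by auto
    have "(u \<otimes> w \<otimes> s0) \<otimes> x = u \<otimes> (x \<otimes> (w \<otimes> s0) \<ominus> b \<otimes> t \<otimes> \<one>) \<oplus> t \<otimes> (u \<otimes> b)"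
      using c xc tc b(1) by algebra
    also have "\<dots> = t \<otimes> (u \<otimes> b)" unfolding u(2) using c b(1) by simp
    finally show ?thesis using F.S_mult u(1) b(1,2) t(2) c by (meson m_closed)
  qed
  \<comment> \<open>If \<open>t\<close> vanished in the localization, so would every fraction with
    numerator in \<open>m\<close>, while all other fractions are units. This contradicts the nonzero
    prime ideal that belongs to the definition of the valuation ring.\<close>
  have nz: "F.fr t \<one> \<noteq> \<zero>\<^bsub>?D\<^esub>"
  proof
    assume "F.fr t \<one> = \<zero>\<^bsub>?D\<^esub>"
    then obtain u where u: "u \<in> ?S" "u \<otimes> t = \<zero>" using F.frac_eq_zero_iff oneS by auto
    obtain P where P: "primeideal P ?D" "P \<noteq> {\<zero>\<^bsub>?D\<^esub>}" using ex by blast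
    interpret P: primeideal P ?D by fact
    obtain X where X: "X \<in> P" "X \<noteq> \<zero>\<^bsub>?D\<^esub>" using P(2) P.zero_closed by auto
    then obtain a s where a: "a \<in> carrier R" "s \<in> ?S" "X = F.fr a s"
      using P.a_Hcarr[OF X(1)] by (auto simp: F.carrier_loc)
    show False
    proof (cases "a \<in> m")
      case True
      then obtain s' y where s': "s' \<in> ?S" "y \<in> carrier R" "s' \<otimes> a = t \<otimes> y" using gen by blast
      have c: "u \<in> carrier R" "s' \<in> carrier R" using u s' by auto
      have "(u \<otimes> s') \<otimes> a = (u \<otimes> t) \<otimes> y" using s' c a(1) by (simp add: m_assoc)
      also have "\<dots> = \<zero>" using u s' by simp
      finally have "\<exists>u\<in>?S. u \<otimes> a = \<zero>" using F.S_mult[OF u(1) s'(1)] by blast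
      then have "X = \<zero>\<^bsub>?D\<^esub>" using F.frac_eq_zero_iff[OF a(1,2)] a(3) by simp
      then show False using X by simp
    next
      case False
      then have aS: "a \<in> ?S" using a by auto
      have "X \<otimes>\<^bsub>?D\<^esub> F.fr s a = F.fr (a \<otimes> s) (s \<otimes> a)" using a aS by (simp add: F.frac_mult)
      also have "\<dots> = F.fr \<one> \<one>"
        using a aS F.S_mult F.S_one
        by (subst F.frac_eq_iff) (auto intro!: bexI[of _ \<one>] simp: a_minus_def r_neg m_comm)
      finally have "\<one>\<^bsub>?D\<^esub> \<in> P" using P.I_r_closed[OF X(1), of "F.fr s a"] a aS by (simp add: F.one_loc)
      then show False using P.one_imp_carrier P.I_notcarr by auto
    qed
  qed
  have reg: "\<exists>s\<in>?S. s \<otimes> y = \<zero>" if y: "y \<in> carrier R" "t \<otimes> y = \<zero>" for y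
  proof -
    have "F.fr t \<one> \<otimes>\<^bsub>?D\<^esub> F.fr y \<one> = F.fr \<zero> (\<one> \<otimes> \<one>)" using y oneS by (simp add: F.frac_mult)
    also have "\<dots> = \<zero>\<^bsub>?D\<^esub>" by (simp add: F.zero_loc)
    finally have "F.fr y \<one> = \<zero>\<^bsub>?D\<^esub>" using PD.integral[OF _ F.frac_in F.frac_in] nz y(1) oneS tc by blast
    then show ?thesis using F.frac_eq_zero_iff y oneS by auto
  qed
  show ?thesis by (rule that[OF t(1)]) (use gen reg in auto)
qed

section \<open>Linear maps on free modules and the passage from the local ring to R\<close>

definition unit_vec :: "('r, 'k) ring_scheme \<Rightarrow> nat \<Rightarrow> nat \<Rightarrow> nat \<Rightarrow> 'r" where
  "unit_vec R n i = (\<lambda>j\<in>{..<n}. if j = i then \<one>\<^bsub>R\<^esub> else \<zero>\<^bsub>R\<^esub>)"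

lemma module_homD:
  assumes "h \<in> module_hom R M N"
  shows "x \<in> carrier M \<Longrightarrow> h x \<in> carrier N"
    and "x \<in> carrier M \<Longrightarrow> y \<in> carrier M \<Longrightarrow> h (x \<oplus>\<^bsub>M\<^esub> y) = h x \<oplus>\<^bsub>N\<^esub> h y"
    and "r \<in> carrier R \<Longrightarrow> x \<in> carrier M \<Longrightarrow> h (r \<odot>\<^bsub>M\<^esub> x) = r \<odot>\<^bsub>N\<^esub> h x"
  using assms by (auto simp: module_hom_def)

lemma ideal_module_simps [simp]:
  "carrier (ideal_module R I) = I" "add (ideal_module R I) = add R"
  "\<zero>\<^bsub>ideal_module R I\<^esub> = \<zero>\<^bsub>R\<^esub>" "smult (ideal_module R I) = monoid.mult R"
  by (simp_all add: ideal_module_def)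

lemma (in cring) unit_vec_closed: "unit_vec R n i \<in> carrier (free_module R n)"
  by (auto simp: unit_vec_def free_module_def)

text \<open>Induction over the truncations of \<open>z\<close> that keep the first \<open>k\<close>
  coordinates. With an ideal as target the rule serves both the presentation of \<open>m\<close>
  and, for \<open>I = carrier R\<close>, linear forms.\<close>

lemma (in cring) free_module_hom_expand:
  assumes h: "h \<in> module_hom R (free_module R n) (ideal_module R I)" and "I \<subseteq> carrier R"
    and z: "z \<in> carrier (free_module R n)"
  shows "h z = (\<Oplus>i\<in>{..<n}. z i \<otimes> h (unit_vec R n i))"
proof -
  let ?t = "\<lambda>k. \<lambda>j\<in>{..<n}. if j < k then z j else \<zero>"
  have zc: "z i \<in> carrier R" if "i < n" for i using z that by (auto simp: free_module_def)
  have hc: "h x \<in> carrier R" if "x \<in> carrier (free_module R n)" for x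
    using module_homD(1)[OF h that] assms(2) by auto
  have tc: "?t k \<in> carrier (free_module R n)" for k using zc by (auto simp: free_module_def)
  have "k \<le> n \<Longrightarrow> h (?t k) = (\<Oplus>i\<in>{..<k}. z i \<otimes> h (unit_vec R n i))" for k
  proof (induction k)
    case 0
    \<comment> \<open>The definition of \<open>module_hom\<close> does not list the value at zero,
      so the zero vector is written as 0 times itself.\<close>
    have "?t 0 = \<zero> \<odot>\<^bsub>free_module R n\<^esub> ?t 0" by (auto simp: free_module_def fun_eq_iff)
    then have "h (?t 0) = h (\<zero> \<odot>\<^bsub>free_module R n\<^esub> ?t 0)" by (rule arg_cong)
    also have "\<dots> = \<zero> \<otimes> h (?t 0)" using module_homD(3)[OF h zero_closed tc[of 0]] by simp
    finally show ?case unfolding lessThan_0 finsum_empty l_null[OF hc[OF tc[of 0]]] .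
  next
    case (Suc k)
    then have k: "k < n" by simp
    have "?t (Suc k) = ?t k \<oplus>\<^bsub>free_module R n\<^esub> (z k \<odot>\<^bsub>free_module R n\<^esub> unit_vec R n k)"
      using zc k by (auto simp: free_module_def unit_vec_def fun_eq_iff less_Suc_eq)
    moreover have "z k \<odot>\<^bsub>free_module R n\<^esub> unit_vec R n k \<in> carrier (free_module R n)"
      using zc[OF k] unit_vec_closed[of n k] by (auto simp: free_module_def)
    ultimately have "h (?t (Suc k)) = h (?t k) \<oplus> z k \<otimes> h (unit_vec R n k)"
      using module_homD[OF h] tc zc[OF k] unit_vec_closed by simp
    also have "\<dots> = (\<Oplus>i\<in>{..<Suc k}. z i \<otimes> h (unit_vec R n i))"
      unfolding Suc.IH[OF less_imp_le[OF k]]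
      using k zc hc[OF unit_vec_closed] by (simp add: lessThan_Suc finsum_insert Pi_def a_comm)
    finally show ?case .
  qed
  from this[of n] have "h (?t n) = (\<Oplus>i\<in>{..<n}. z i \<otimes> h (unit_vec R n i))" by simp
  moreover have "?t n = z" using z by (auto simp: free_module_def PiE_def extensional_def fun_eq_iff)
  ultimately show ?thesis by simp
qed

text \<open>Each \<open>P j\<close> survives further multiplication by elements of \<open>S\<close>,
  so a product of individual multipliers works for all \<open>j\<close>. In this way a local
  statement about finitely many elements holds after multiplication by a single element.\<close>

lemma (in cring) common_multiplier:
  assumes "finite J" "\<one> \<in> S" "\<And>x y. x \<in> S \<Longrightarrow> y \<in> S \<Longrightarrow> x \<otimes> y \<in> S" "S \<subseteq> carrier R"
    and "\<And>j s r. j \<in> J \<Longrightarrow> s \<in> S \<Longrightarrow> r \<in> S \<Longrightarrow> P j s \<Longrightarrow> P j (r \<otimes> s)"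
    and "\<And>j. j \<in> J \<Longrightarrow> \<exists>s\<in>S. P j s"
  shows "\<exists>s\<in>S. \<forall>j\<in>J. P j s"
  using assms(1,5,6)
proof (induction J)
  case empty
  then show ?case using assms(2) by auto
next
  case (insert i J)
  then obtain s where s: "s \<in> S" "\<forall>j\<in>J. P j s" by blast
  obtain r where r: "r \<in> S" "P i r" using insert by blast
  have "P i (s \<otimes> r)" using insert.prems(1)[of i r s] r s by simp
  moreover have "P j (s \<otimes> r)" if "j \<in> J" for j
  proof -
    have "P j (r \<otimes> s)" using insert.prems(1)[of j s r] that r s by simp
    moreover have "r \<otimes> s = s \<otimes> r" using r s assms(4) by (auto intro!: m_comm)
    ultimately show ?thesis by simp
  qed
  ultimately show ?case using assms(3) r s by blast
qed

text \<open>Locally at \<open>m\<close> the ideal is free of rank one. Finite generation makes one denominator work for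
  all elements of the ideal, and finite presentation makes one work for all annihilators of \<open>t\<close>.\<close>

lemma (in cring) locally_free_multiplier:
  assumes m: "primeideal m R" and dvr: "discrete_valuation_ring (localization_at R m)"
    and fp: "finitely_presented R (ideal_module R m)"
  obtains s t where "s \<in> carrier R - m" "t \<in> m"
    "\<And>x. x \<in> m \<Longrightarrow> \<exists>y\<in>carrier R. s \<otimes> x = t \<otimes> y"
    "\<And>y. y \<in> carrier R \<Longrightarrow> t \<otimes> y = \<zero> \<Longrightarrow> s \<otimes> y = \<zero>"
proof -
  interpret m: primeideal m R by fact
  let ?S = "carrier R - m"
  obtain t where t: "t \<in> m" "\<And>x. x \<in> m \<Longrightarrow> \<exists>s\<in>?S. \<exists>y\<in>carrier R. s \<otimes> x = t \<otimes> y"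
    and reg: "\<And>y. y \<in> carrier R \<Longrightarrow> t \<otimes> y = \<zero> \<Longrightarrow> \<exists>s\<in>?S. s \<otimes> y = \<zero>"
    using dvr_localization_generator[OF m dvr] by metis
  have tc [simp]: "t \<in> carrier R" using t m.a_Hcarr by auto
  have S1: "\<one> \<in> ?S" using m.I_notcarr m.one_imp_carrier by auto
  have Sm: "x \<otimes> y \<in> ?S" if "x \<in> ?S" "y \<in> ?S" for x y using that m.I_prime by auto
  obtain p n g f where g: "g \<in> module_hom R (free_module R p) (free_module R n)"
    and f: "f \<in> module_hom R (free_module R n) (ideal_module R m)"
    and surj: "f ` carrier (free_module R n) = m"
    and exact: "g ` carrier (free_module R p) = {x \<in> carrier (free_module R n). f x = \<zero>}"
    using fp by (auto simp: finitely_presented_def)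
  let ?F = "free_module R n"
  let ?x = "\<lambda>i. f (unit_vec R n i)"
  have fm: "f z \<in> m" if "z \<in> carrier ?F" for z using module_homD(1)[OF f that] by simp
  have xm: "?x i \<in> m" for i using fm[OF unit_vec_closed] .
  have xc [simp]: "?x i \<in> carrier R" for i using m.a_Hcarr[OF xm] .
  have "\<exists>s\<in>?S. \<forall>i\<in>{..<n}. \<exists>y\<in>carrier R. s \<otimes> ?x i = t \<otimes> y"
  proof (rule common_multiplier)
    fix i s r assume "s \<in> ?S" "r \<in> ?S" "\<exists>y\<in>carrier R. s \<otimes> ?x i = t \<otimes> y"
    then obtain y where y: "s \<in> carrier R" "r \<in> carrier R" "y \<in> carrier R" "s \<otimes> ?x i = t \<otimes> y" by auto
    have "r \<otimes> s \<otimes> ?x i = r \<otimes> (t \<otimes> y)" using y by (simp add: m_assoc)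
    also have "\<dots> = t \<otimes> (r \<otimes> y)" using y by (simp add: m_lcomm)
    finally show "\<exists>y\<in>carrier R. r \<otimes> s \<otimes> ?x i = t \<otimes> y" using y by blast
  qed (use S1 Sm t(2)[OF xm] in auto)
  then obtain s1 where s1: "s1 \<in> ?S" "\<And>i. i < n \<Longrightarrow> \<exists>y\<in>carrier R. s1 \<otimes> ?x i = t \<otimes> y" by auto
  then obtain b where b: "\<And>i. i < n \<Longrightarrow> b i \<in> carrier R" "\<And>i. i < n \<Longrightarrow> s1 \<otimes> ?x i = t \<otimes> b i" by metis
  have s1c [simp]: "s1 \<in> carrier R" using s1 by auto
  \<comment> \<open>\<open>\<beta>\<close> divides \<open>s1 f(z)\<close> by \<open>t\<close>, but
    on the free module instead of \<open>m\<close>: annihilators of \<open>t\<close> may keep it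
    from vanishing on the relations.\<close>
  define \<beta> where "\<beta> z = (\<Oplus>i\<in>{..<n}. z i \<otimes> b i)" for z
  have comp: "z i \<in> carrier R" if "z \<in> carrier ?F" "i < n" for z i using that by (auto simp: free_module_def)
  have \<beta>c [simp]: "\<beta> z \<in> carrier R" if "z \<in> carrier ?F" for z
    unfolding \<beta>_def using comp[OF that] b(1) by (intro finsum_closed) auto
  have \<beta>t: "t \<otimes> \<beta> z = s1 \<otimes> f z" if z: "z \<in> carrier ?F" for z
  proof -
    have "t \<otimes> \<beta> z = (\<Oplus>i\<in>{..<n}. t \<otimes> (z i \<otimes> b i))"
      unfolding \<beta>_def using comp[OF z] b(1) by (intro finsum_rdistr) auto
    also have "\<dots> = (\<Oplus>i\<in>{..<n}. s1 \<otimes> (z i \<otimes> ?x i))"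
    proof (rule finsum_cong')
      fix i assume i: "i \<in> {..<n}"
      have "t \<otimes> (z i \<otimes> b i) = z i \<otimes> (t \<otimes> b i)" using i comp[OF z] b(1) by (simp add: m_lcomm)
      also have "\<dots> = s1 \<otimes> (z i \<otimes> ?x i)" using i comp[OF z] by (simp add: m_lcomm flip: b(2))
      finally show "t \<otimes> (z i \<otimes> b i) = s1 \<otimes> (z i \<otimes> ?x i)" .
    qed (use comp[OF z] in auto)
    also have "\<dots> = s1 \<otimes> (\<Oplus>i\<in>{..<n}. z i \<otimes> ?x i)"
      using comp[OF z] by (intro finsum_rdistr[symmetric]) auto
    also have "\<dots> = s1 \<otimes> f z" using free_module_hom_expand[OF f _ z] m.a_subset by simp
    finally show ?thesis .
  qed
  have \<beta>_add: "\<beta> (z \<oplus>\<^bsub>?F\<^esub> w) = \<beta> z \<oplus> \<beta> w" if "z \<in> carrier ?F" "w \<in> carrier ?F" for z w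
  proof -
    have "\<beta> (z \<oplus>\<^bsub>?F\<^esub> w) = (\<Oplus>i\<in>{..<n}. z i \<otimes> b i \<oplus> w i \<otimes> b i)"
      unfolding \<beta>_def using comp[OF that(1)] comp[OF that(2)] b(1)
      by (intro finsum_cong') (auto simp: free_module_def l_distr)
    also have "\<dots> = \<beta> z \<oplus> \<beta> w"
      unfolding \<beta>_def using comp[OF that(1)] comp[OF that(2)] b(1) by (intro finsum_addf) auto
    finally show ?thesis .
  qed
  have \<beta>_smult: "\<beta> (r \<odot>\<^bsub>?F\<^esub> z) = r \<otimes> \<beta> z" if "r \<in> carrier R" "z \<in> carrier ?F" for r z
  proof -
    have "\<beta> (r \<odot>\<^bsub>?F\<^esub> z) = (\<Oplus>i\<in>{..<n}. r \<otimes> (z i \<otimes> b i))"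
      unfolding \<beta>_def using comp[OF that(2)] that(1) b(1)
      by (intro finsum_cong') (auto simp: free_module_def m_assoc)
    also have "\<dots> = r \<otimes> \<beta> z"
      unfolding \<beta>_def using comp[OF that(2)] that(1) b(1) by (intro finsum_rdistr[symmetric]) auto
    finally show ?thesis .
  qed
  have gc: "g w \<in> carrier ?F" if "w \<in> carrier (free_module R p)" for w using module_homD(1)[OF g that] .
  have g0: "f (g w) = \<zero>" if "w \<in> carrier (free_module R p)" for w using exact that by blast
  have \<beta>g: "(\<lambda>w. \<beta> (g w)) \<in> module_hom R (free_module R p) (ideal_module R (carrier R))"
    using gc module_homD[OF g] by (auto simp: module_hom_def \<beta>_add \<beta>_smult)
  have \<beta>c': "\<beta> (g (unit_vec R p j)) \<in> carrier R" for j by (intro \<beta>c gc unit_vec_closed)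
  \<comment> \<open>On a relation, \<open>t\<close> times \<open>\<beta>\<close> is 0, so by
    \<open>reg\<close> some element outside \<open>m\<close> kills the value of
    \<open>\<beta>\<close>. The relations have finitely many generators, hence one \<open>u\<close>
    serves for all of them.\<close>
  have "\<exists>u\<in>?S. \<forall>j\<in>{..<p}. u \<otimes> \<beta> (g (unit_vec R p j)) = \<zero>"
  proof (rule common_multiplier)
    fix j s r assume "s \<in> ?S" "r \<in> ?S" "s \<otimes> \<beta> (g (unit_vec R p j)) = \<zero>"
    then show "r \<otimes> s \<otimes> \<beta> (g (unit_vec R p j)) = \<zero>" using \<beta>c'[of j] by (simp add: m_assoc)
  next
    fix j
    show "\<exists>s\<in>?S. s \<otimes> \<beta> (g (unit_vec R p j)) = \<zero>"
      using \<beta>t[OF gc[OF unit_vec_closed]] g0[OF unit_vec_closed] by (intro reg \<beta>c') simp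
  qed (use S1 Sm in auto)
  then obtain u where u: "u \<in> ?S" "\<And>j. j < p \<Longrightarrow> u \<otimes> \<beta> (g (unit_vec R p j)) = \<zero>" by auto
  have uc [simp]: "u \<in> carrier R" using u by auto
  have ug: "u \<otimes> \<beta> (g w) = \<zero>" if w: "w \<in> carrier (free_module R p)" for w
  proof -
    have wc: "w i \<in> carrier R" if "i < p" for i using w that by (auto simp: free_module_def)
    have "u \<otimes> \<beta> (g w) = u \<otimes> (\<Oplus>j\<in>{..<p}. w j \<otimes> \<beta> (g (unit_vec R p j)))"
      using free_module_hom_expand[OF \<beta>g _ w] by simp
    also have "\<dots> = (\<Oplus>j\<in>{..<p}. u \<otimes> (w j \<otimes> \<beta> (g (unit_vec R p j))))"
      using wc \<beta>c' by (intro finsum_rdistr) auto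
    also have "\<dots> = (\<Oplus>j\<in>{..<p}. \<zero>)"
      using wc \<beta>c' u(2) by (intro finsum_cong') (auto simp: m_lcomm[of u])
    finally show ?thesis by (simp add: finsum_zero)
  qed
  \<comment> \<open>For a preimage \<open>c\<close> of \<open>t\<close>, the value
    \<open>\<beta> c\<close> is \<open>s1\<close> up to an annihilator of \<open>t\<close>, and
    \<open>v\<close> removes this difference.\<close>
  obtain c where c: "c \<in> carrier ?F" "f c = t" using surj t(1) by auto
  have "t \<otimes> (\<beta> c \<ominus> s1) = \<zero>" using \<beta>t[OF c(1)] c
    by (simp add: a_minus_def r_distr r_minus m_comm r_neg)
  then obtain v where v: "v \<in> ?S" "v \<otimes> (\<beta> c \<ominus> s1) = \<zero>"
    using reg[OF minus_closed[OF \<beta>c[OF c(1)] s1c]] by blast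
  have vc [simp]: "v \<in> carrier R" using v by auto
  have vs: "v \<otimes> s1 = v \<otimes> \<beta> c"
  proof -
    have "v \<otimes> \<beta> c = v \<otimes> (\<beta> c \<ominus> s1) \<oplus> v \<otimes> s1" using \<beta>c[OF c(1)] vc s1c by algebra
    then show ?thesis using v(2) by simp
  qed
  \<comment> \<open>The factor \<open>s1\<close> makes the elements of \<open>m\<close> divisible by
    \<open>t\<close>. If \<open>t y = 0\<close>, then \<open>y c\<close> is a relation, whence
    \<open>u y \<beta>(c) = 0\<close>; the factor \<open>v\<close> allows \<open>\<beta>(c)\<close>
    to be replaced by \<open>s1\<close>.\<close>
  show ?thesis
  proof (rule that[of "u \<otimes> v \<otimes> s1" t])
    show "u \<otimes> v \<otimes> s1 \<in> ?S" using u v s1 Sm by blast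
    show "t \<in> m" by fact
    fix x assume "x \<in> m"
    then obtain z where z: "z \<in> carrier ?F" "x = f z" using surj by auto
    then have "u \<otimes> v \<otimes> s1 \<otimes> x = u \<otimes> v \<otimes> (t \<otimes> \<beta> z)"
      using m.a_Hcarr[OF fm[OF z(1)]] \<beta>t[OF z(1)] by (simp add: m_assoc)
    also have "\<dots> = t \<otimes> (u \<otimes> v \<otimes> \<beta> z)" using \<beta>c[OF z(1)] by (intro m_lcomm) auto
    finally show "\<exists>y\<in>carrier R. u \<otimes> v \<otimes> s1 \<otimes> x = t \<otimes> y"
      by (rule bexI) (use \<beta>c[OF z(1)] in simp)
  next
    fix y assume y: "y \<in> carrier R" "t \<otimes> y = \<zero>"
    have yc: "y \<odot>\<^bsub>?F\<^esub> c \<in> carrier ?F" using y(1) comp[OF c(1)] by (auto simp: free_module_def)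
    have "f (y \<odot>\<^bsub>?F\<^esub> c) = \<zero>" using module_homD(3)[OF f y(1) c(1)] c y by (simp add: m_comm)
    then obtain w where w: "w \<in> carrier (free_module R p)" "y \<odot>\<^bsub>?F\<^esub> c = g w"
      using exact yc by blast
    have *: "u \<otimes> (y \<otimes> \<beta> c) = \<zero>" using ug[OF w(1)] \<beta>_smult[OF y(1) c(1)] w(2) by simp
    have "u \<otimes> v \<otimes> s1 \<otimes> y = u \<otimes> y \<otimes> (v \<otimes> s1)" using y(1) uc vc s1c by algebra
    also have "\<dots> = v \<otimes> (u \<otimes> (y \<otimes> \<beta> c))" unfolding vs using y(1) uc vc \<beta>c[OF c(1)] by algebra
    finally show "u \<otimes> v \<otimes> s1 \<otimes> y = \<zero>" using * by simp
  qed
qed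

section \<open>The dual basis of a supramaximal ideal\<close>

text \<open>The dual basis criterion for the module \<open>m\<close> with generators
  \<open>e\<close> and \<open>t\<close>. The linear form paired with \<open>e\<close> is the
  inclusion of \<open>m\<close> into \<open>R\<close>, so only \<open>\<phi>\<close> is
  recorded.\<close>

definition dual_basis :: "('r, 'k) ring_scheme \<Rightarrow> 'r set \<Rightarrow> 'r \<Rightarrow> 'r \<Rightarrow> ('r \<Rightarrow> 'r) \<Rightarrow> bool" where
  "dual_basis R m e t \<phi> \<longleftrightarrow> e \<in> m \<and> t \<in> m \<and> \<phi> \<in> module_hom R (ideal_module R m) (ideal_module R (carrier R)) \<and>
     (\<forall>x\<in>m. x = e \<otimes>\<^bsub>R\<^esub> x \<oplus>\<^bsub>R\<^esub> t \<otimes>\<^bsub>R\<^esub> \<phi> x)"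

text \<open>Write \<open>s x = t y\<close>. Here \<open>y\<close> is determined only up to
  annihilators of \<open>t\<close>, but \<open>s y\<close> is unique, so
  \<open>\<phi>(x) = s y\<close> is linear. With \<open>s s c + e = 1\<close> the dual basis
  consists of \<open>e\<close> and \<open>c t\<close>, because
  \<open>c t s y = c s (t y) = s s c x\<close>.\<close>

lemma (in cring) supramaximal_dual_basis:
  assumes "ideal m R" and F: "field (R Quot m)" and dvr: "discrete_valuation_ring (localization_at R m)"
    and fp: "finitely_presented R (ideal_module R m)"
  obtains e t \<phi> where "dual_basis R m e t \<phi>"
proof -
  interpret ideal m R by fact
  have prime: "primeideal m R" using maximalideal_prime field_quot_maximalideal assms by blast
  obtain s t where s: "s \<in> carrier R - m" and t: "t \<in> m"
    and div: "\<And>x. x \<in> m \<Longrightarrow> \<exists>y\<in>carrier R. s \<otimes> x = t \<otimes> y"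
    and ann: "\<And>y. y \<in> carrier R \<Longrightarrow> t \<otimes> y = \<zero> \<Longrightarrow> s \<otimes> y = \<zero>"
    using locally_free_multiplier[OF prime dvr fp] by metis
  have sc [simp]: "s \<in> carrier R" and tc [simp]: "t \<in> carrier R" using s t a_Hcarr by auto
  \<comment> \<open>One factor \<open>s\<close> is spent on the definition of \<open>\<phi>\<close>,
    the other on the equation \<open>s x = t y\<close>.\<close>
  have "s \<otimes> s \<notin> m" using s primeideal.I_prime[OF prime] by blast
  then obtain c e where c: "c \<in> carrier R" and e: "e \<in> m" and ce: "s \<otimes> s \<otimes> c \<oplus> e = \<one>"
    using field_quot_inverse[OF assms(1) F, of "s \<otimes> s"] by auto
  have ec [simp]: "e \<in> carrier R" using e a_Hcarr by auto
  obtain y where y: "\<And>x. x \<in> m \<Longrightarrow> y x \<in> carrier R" "\<And>x. x \<in> m \<Longrightarrow> s \<otimes> x = t \<otimes> y x"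
    using div by metis
  have uniq: "s \<otimes> a = s \<otimes> b" if "a \<in> carrier R" "b \<in> carrier R" "t \<otimes> a = t \<otimes> b" for a b
  proof -
    have "t \<otimes> (a \<ominus> b) = t \<otimes> a \<ominus> t \<otimes> b" using that(1,2) tc by algebra
    then have "s \<otimes> (a \<ominus> b) = \<zero>" using that by (intro ann) (auto simp: a_minus_def r_neg)
    moreover have "s \<otimes> a = s \<otimes> (a \<ominus> b) \<oplus> s \<otimes> b" using that(1,2) sc by algebra
    ultimately show ?thesis using that by simp
  qed
  let ?\<phi> = "\<lambda>x. s \<otimes> y x"
  have "dual_basis R m e (c \<otimes> t) ?\<phi>"
    unfolding dual_basis_def
  proof (intro conjI ballI)
    show "e \<in> m" by fact
    show "c \<otimes> t \<in> m" using c t by (simp add: I_l_closed)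
    show "?\<phi> \<in> module_hom R (ideal_module R m) (ideal_module R (carrier R))"
      unfolding module_hom_def
    proof (intro CollectI conjI ballI; simp)
      show "?\<phi> \<in> m \<rightarrow> carrier R" using y by auto
    next
      fix a b assume ab: "a \<in> m" "b \<in> m"
      then have abc: "a \<in> carrier R" "b \<in> carrier R" using a_Hcarr by auto
      have "s \<otimes> y (a \<oplus> b) = s \<otimes> (y a \<oplus> y b)"
        using ab abc y by (intro uniq) (simp_all add: r_distr flip: y(2))
      then show "s \<otimes> y (a \<oplus> b) = s \<otimes> y a \<oplus> s \<otimes> y b" using ab y by (simp add: r_distr)
    next
      fix r a assume ra: "r \<in> carrier R" "a \<in> m"
      then have ac: "a \<in> carrier R" "r \<otimes> a \<in> m" using a_Hcarr I_l_closed by auto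
      have "t \<otimes> (r \<otimes> y a) = r \<otimes> (t \<otimes> y a)" using ra y by (simp add: m_lcomm)
      also have "\<dots> = t \<otimes> y (r \<otimes> a)" using ra ac by (simp add: m_lcomm flip: y(2))
      finally have "s \<otimes> y (r \<otimes> a) = s \<otimes> (r \<otimes> y a)"
        using ra ac y by (intro uniq) auto
      then show "s \<otimes> y (r \<otimes> a) = r \<otimes> (s \<otimes> y a)" using ra y by (simp add: m_lcomm)
    qed
  next
    fix x assume x: "x \<in> m"
    then have xc: "x \<in> carrier R" "y x \<in> carrier R" using a_Hcarr y by auto
    have "e \<otimes> x \<oplus> c \<otimes> t \<otimes> (s \<otimes> y x) = e \<otimes> x \<oplus> c \<otimes> s \<otimes> (t \<otimes> y x)" using xc c ec tc sc by algebra
    also have "\<dots> = (s \<otimes> s \<otimes> c \<oplus> e) \<otimes> x" unfolding y(2)[OF x, symmetric] using xc c ec sc by algebra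
    also have "\<dots> = x" unfolding ce using xc by simp
    finally show "x = e \<otimes> x \<oplus> c \<otimes> t \<otimes> (s \<otimes> y x)" by simp
  qed
  then show ?thesis using that by blast
qed

section \<open>Tensor products\<close>

lemma (in abelian_group) add_minus_minus:
  assumes "a \<in> carrier G" "b \<in> carrier G"
  shows "a \<oplus> b \<ominus> a \<ominus> b = \<zero>"
proof -
  have "a \<oplus> b \<ominus> a \<ominus> b = (a \<oplus> b) \<oplus> (\<ominus> (a \<oplus> b))"
    using assms by (simp add: a_minus_def minus_add a_assoc)
  then show ?thesis using assms by (simp add: r_neg)
qed

lemma (in module) smult_lcomm:
  assumes "r \<in> carrier R" "s \<in> carrier R" "x \<in> carrier M"
  shows "r \<odot>\<^bsub>M\<^esub> (s \<odot>\<^bsub>M\<^esub> x) = s \<odot>\<^bsub>M\<^esub> (r \<odot>\<^bsub>M\<^esub> x)"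
  using assms by (simp flip: smult_assoc1) (simp add: m_comm)

text \<open>The additive extension of \<open>F\<close> to formal sums, in the shape of the sum in
  \<open>ideal_tensor_map\<close>, which it becomes when \<open>F\<close> multiplies the scalar and
  the vector of a pair.\<close>

definition frag_sum :: "('a, 'm) ring_scheme \<Rightarrow> ('p \<Rightarrow> 'a) \<Rightarrow> ('p \<Rightarrow>\<^sub>0 int) \<Rightarrow> 'a" where
  "frag_sum G F c = (\<Oplus>\<^bsub>G\<^esub>p\<in>Poly_Mapping.keys c. [Poly_Mapping.lookup c p] \<cdot>\<^bsub>G\<^esub> F p)"

lemma (in abelian_group) frag_sum_hom:
  assumes F: "F \<in> S \<rightarrow> carrier G"
  shows "frag_sum G F \<in> hom (free_Abelian_group S) (add_monoid G)"
    and "p \<in> S \<Longrightarrow> frag_sum G F (frag_of p) = F p"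
proof -
  let ?L = "frag_sum G F"
  \<comment> \<open>Coefficients of a sum may cancel, so the key sets of \<open>c\<close>,
    \<open>d\<close> and \<open>c + d\<close> do not match; all three sums are therefore taken over
    one finite set.\<close>
  have eq: "?L c = (\<Oplus>p\<in>K. [Poly_Mapping.lookup c p] \<cdot> F p)"
    if "finite K" "Poly_Mapping.keys c \<subseteq> K" "K \<subseteq> S" for c K
    unfolding frag_sum_def using that F
    by (intro add.finprod_mono_neutral_cong_left) (auto simp: in_keys_iff add_pow_int_ge intro!: add.int_pow_closed)
  show "?L \<in> hom (free_Abelian_group S) (add_monoid G)"
  proof (rule homI)
    fix c assume "c \<in> carrier (free_Abelian_group S)"
    then show "?L c \<in> carrier (add_monoid G)"
      using F by (auto simp: frag_sum_def intro!: finsum_closed add.int_pow_closed)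
    fix d assume "d \<in> carrier (free_Abelian_group S)"
    with \<open>c \<in> _\<close> have S: "Poly_Mapping.keys c \<union> Poly_Mapping.keys d \<subseteq> S" by auto
    let ?K = "Poly_Mapping.keys c \<union> Poly_Mapping.keys d"
    have FK: "F p \<in> carrier G" if "p \<in> ?K" for p using F S that by auto
    have "?L (c + d) = (\<Oplus>p\<in>?K. [Poly_Mapping.lookup (c + d) p] \<cdot> F p)"
      using S by (intro eq) (auto dest: subsetD[OF Poly_Mapping.keys_add])
    also have "\<dots> = (\<Oplus>p\<in>?K. [Poly_Mapping.lookup c p] \<cdot> F p \<oplus> [Poly_Mapping.lookup d p] \<cdot> F p)"
      using FK by (intro finsum_cong') (auto simp: lookup_add add.int_pow_mult intro!: add.int_pow_closed)
    also have "\<dots> = (\<Oplus>p\<in>?K. [Poly_Mapping.lookup c p] \<cdot> F p) \<oplus> (\<Oplus>p\<in>?K. [Poly_Mapping.lookup d p] \<cdot> F p)"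
      using FK by (intro finsum_addf) (auto intro!: add.int_pow_closed)
    also have "\<dots> = ?L c \<oplus> ?L d"
      using S by (simp add: eq[of ?K])
    finally show "?L (c \<otimes>\<^bsub>free_Abelian_group S\<^esub> d) = ?L c \<otimes>\<^bsub>add_monoid G\<^esub> ?L d" by simp
  qed
  show "?L (frag_of p) = F p" if "p \<in> S"
    using F that by (auto simp: frag_sum_def keys_frag_of finsum_singleton Pi_def finsum_insert)
qed

lemma (in abelian_group) frag_hom_diff:
  assumes h: "h \<in> hom (free_Abelian_group S) (add_monoid G)"
    and "Poly_Mapping.keys c \<subseteq> S" "Poly_Mapping.keys d \<subseteq> S"
  shows "h (c - d) = h c \<ominus> h d"
proof -
  interpret h: group_hom "free_Abelian_group S" "add_monoid G" h
    by (simp add: group_hom_def group_hom_axioms_def h a_group)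
  have "h (c + (- d)) = h c \<oplus> h (- d)"
    using h.hom_mult[of c "- d"] assms by simp
  also have "h (- d) = \<ominus> h d"
    using h.hom_inv[of d] assms by (simp add: a_inv_def)
  finally show ?thesis by (simp add: a_minus_def)
qed

lemma add_monoid_pretensor: "add_monoid (pretensor M N) = free_Abelian_group (carrier M \<times> carrier N)"
  by (simp add: pretensor_def free_Abelian_group_def)

lemma pretensor_simps:
  "carrier (pretensor M N) = {c. Poly_Mapping.keys c \<subseteq> carrier M \<times> carrier N}"
  "add (pretensor M N) = (+)" "\<zero>\<^bsub>pretensor M N\<^esub> = 0"
  by (simp_all add: pretensor_def)

locale tensor_pair = MR?: module R M + NR: module R N for R (structure) and M (structure) and N
begin

abbreviation "S \<equiv> carrier M \<times> carrier N"
abbreviation "T \<equiv> tensor_relations R M N"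
abbreviation "P \<equiv> pretensor M N"

definition "rels =
     {frag_of (x \<oplus>\<^bsub>M\<^esub> x', y) - frag_of (x, y) - frag_of (x', y) | x x' y.
          x \<in> carrier M \<and> x' \<in> carrier M \<and> y \<in> carrier N} \<union>
      {frag_of (x, y \<oplus>\<^bsub>N\<^esub> y') - frag_of (x, y) - frag_of (x, y') | x y y'.
          x \<in> carrier M \<and> y \<in> carrier N \<and> y' \<in> carrier N} \<union>
      {frag_of (r \<odot>\<^bsub>M\<^esub> x, y) - frag_of (x, r \<odot>\<^bsub>N\<^esub> y) | r x y.
          r \<in> carrier R \<and> x \<in> carrier M \<and> y \<in> carrier N}"

lemma T_eq: "T = generate (free_Abelian_group S) rels"
  unfolding tensor_relations_def rels_def add_monoid_pretensor ..

lemma keys_diff_frag: "Poly_Mapping.keys c \<subseteq> A \<Longrightarrow> Poly_Mapping.keys d \<subseteq> A \<Longrightarrow> Poly_Mapping.keys (c - d) \<subseteq> A"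
  for c d :: "'z \<Rightarrow>\<^sub>0 int"
  using keys_diff by fastforce

lemma keys_frag: "p \<in> A \<Longrightarrow> Poly_Mapping.keys (frag_of p) \<subseteq> A"
  by (simp add: keys_frag_of)

lemma rels_carrier: "rels \<subseteq> carrier (free_Abelian_group S)"
proof
  fix c assume "c \<in> rels"
  then show "c \<in> carrier (free_Abelian_group S)"
    unfolding rels_def
    by (elim UnE CollectE exE conjE)
      (simp only: carrier_free_Abelian_group_iff, intro keys_diff_frag keys_frag, (simp; fail)+)+
qed

lemma T_subgroup: "subgroup T (free_Abelian_group S)"
  unfolding T_eq using rels_carrier by (rule group.generate_is_subgroup[OF group_free_Abelian_group])

lemma T_keys: "c \<in> T \<Longrightarrow> Poly_Mapping.keys c \<subseteq> S"
  using subsetD[OF subgroup.subset[OF T_subgroup], of c] by (simp only: carrier_free_Abelian_group_iff)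

lemma T_zero: "0 \<in> T"
  using subgroup.one_closed[OF T_subgroup] by simp

lemma T_add: "c \<in> T \<Longrightarrow> d \<in> T \<Longrightarrow> c + d \<in> T"
  using subgroup.m_closed[OF T_subgroup] by simp

lemma T_minus: "c \<in> T \<Longrightarrow> - c \<in> T"
  using subgroup.m_inv_closed[OF T_subgroup, of c] T_keys by simp

lemma T_diff: "c \<in> T \<Longrightarrow> d \<in> T \<Longrightarrow> c - d \<in> T"
  using T_add[OF _ T_minus] by fastforce

lemma T_left: "x \<in> carrier M \<Longrightarrow> x' \<in> carrier M \<Longrightarrow> y \<in> carrier N \<Longrightarrow>
    frag_of (x \<oplus>\<^bsub>M\<^esub> x', y) - frag_of (x, y) - frag_of (x', y) \<in> T"
  unfolding T_eq by (rule generate.incl) (auto simp: rels_def)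

lemma T_right: "x \<in> carrier M \<Longrightarrow> y \<in> carrier N \<Longrightarrow> y' \<in> carrier N \<Longrightarrow>
    frag_of (x, y \<oplus>\<^bsub>N\<^esub> y') - frag_of (x, y) - frag_of (x, y') \<in> T"
  unfolding T_eq by (rule generate.incl) (auto simp: rels_def)

lemma T_scalar: "r \<in> carrier R \<Longrightarrow> x \<in> carrier M \<Longrightarrow> y \<in> carrier N \<Longrightarrow>
    frag_of (r \<odot>\<^bsub>M\<^esub> x, y) - frag_of (x, r \<odot>\<^bsub>N\<^esub> y) \<in> T"
  unfolding T_eq by (rule generate.incl) (auto simp: rels_def)

lemma T_right_zero: "x \<in> carrier M \<Longrightarrow> frag_of (x, \<zero>\<^bsub>N\<^esub>) \<in> T"
  using T_minus[OF T_right[of x "\<zero>\<^bsub>N\<^esub>" "\<zero>\<^bsub>N\<^esub>"]] by simp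

lemma T_left_zero: "y \<in> carrier N \<Longrightarrow> frag_of (\<zero>\<^bsub>M\<^esub>, y) \<in> T"
  using T_minus[OF T_left[of "\<zero>\<^bsub>M\<^esub>" "\<zero>\<^bsub>M\<^esub>" y]] by simp

lemma T_right_diff:
  assumes "x \<in> carrier M" "y \<in> carrier N" "y' \<in> carrier N"
  shows "frag_of (x, y \<ominus>\<^bsub>N\<^esub> y') - (frag_of (x, y) - frag_of (x, y')) \<in> T"
proof -
  have "y \<ominus>\<^bsub>N\<^esub> y' \<oplus>\<^bsub>N\<^esub> y' = y"
    using assms by (simp add: a_minus_def NR.a_assoc NR.l_neg)
  then have "frag_of (x, y) - frag_of (x, y \<ominus>\<^bsub>N\<^esub> y') - frag_of (x, y') \<in> T"
    using T_right[of x "y \<ominus>\<^bsub>N\<^esub> y'" y'] assms by simp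
  from T_minus[OF this] show ?thesis by (simp add: algebra_simps)
qed

text \<open>Only the three kinds of generating relations have to be checked. With
  \<open>K = T\<close> the result makes operations on formal sums descend to the tensor product;
  with \<open>K\<close> in another group it produces maps out of the tensor product.\<close>

lemma T_image:
  assumes h: "h \<in> hom (free_Abelian_group S) H" and K: "subgroup K H" and "group H"
    and left: "\<And>x x' y. x \<in> carrier M \<Longrightarrow> x' \<in> carrier M \<Longrightarrow> y \<in> carrier N \<Longrightarrow>
      h (frag_of (x \<oplus>\<^bsub>M\<^esub> x', y) - frag_of (x, y) - frag_of (x', y)) \<in> K"
    and right: "\<And>x y y'. x \<in> carrier M \<Longrightarrow> y \<in> carrier N \<Longrightarrow> y' \<in> carrier N \<Longrightarrow>
      h (frag_of (x, y \<oplus>\<^bsub>N\<^esub> y') - frag_of (x, y) - frag_of (x, y')) \<in> K"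
    and scalar: "\<And>r x y. r \<in> carrier R \<Longrightarrow> x \<in> carrier M \<Longrightarrow> y \<in> carrier N \<Longrightarrow>
      h (frag_of (r \<odot>\<^bsub>M\<^esub> x, y) - frag_of (x, r \<odot>\<^bsub>N\<^esub> y)) \<in> K"
    and c: "c \<in> T"
  shows "h c \<in> K"
proof -
  interpret h: group_hom "free_Abelian_group S" H h
    by (simp add: group_hom_def group_hom_axioms_def assms)
  have rel: "h c \<in> K" if "c \<in> rels" for c
    using that unfolding rels_def by (elim UnE CollectE exE conjE) (simp_all only: left right scalar)
  have "h c \<in> K \<and> c \<in> carrier (free_Abelian_group S)" using c unfolding T_eq
  proof (induction c rule: generate.induct)
    case one
    then show ?case using subgroup.one_closed[OF K] h.hom_one by simp
  next
    case (incl c)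
    then show ?case using rel subsetD[OF rels_carrier] by blast
  next
    case (inv c)
    then have c: "c \<in> carrier (free_Abelian_group S)" by (rule subsetD[OF rels_carrier])
    then have "h (inv\<^bsub>free_Abelian_group S\<^esub> c) = inv\<^bsub>H\<^esub> (h c)" by (rule h.hom_inv)
    then show ?case using rel[OF inv] subgroup.m_inv_closed[OF K] h.G.inv_closed[OF c] by simp
  next
    case (eng c d)
    then show ?case using subgroup.m_closed[OF K] h.hom_mult h.G.m_closed by metis
  qed
  then show ?thesis ..
qed

lemma coset_eq: "T +>\<^bsub>P\<^esub> c = {\<tau> + c | \<tau>. \<tau> \<in> T}"
  by (auto simp: a_r_coset_def r_coset_def pretensor_simps)

lemma coset_self: "c \<in> T +>\<^bsub>P\<^esub> c"
  using T_zero by (force simp: coset_eq)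

lemma coset_eq_iff: "T +>\<^bsub>P\<^esub> c = T +>\<^bsub>P\<^esub> d \<longleftrightarrow> c - d \<in> T"
proof
  assume "T +>\<^bsub>P\<^esub> c = T +>\<^bsub>P\<^esub> d"
  then have "c \<in> T +>\<^bsub>P\<^esub> d" using coset_self by metis
  then show "c - d \<in> T" by (auto simp: coset_eq)
next
  assume cd: "c - d \<in> T"
  have "\<exists>\<tau>'. \<tau> + c = \<tau>' + d \<and> \<tau>' \<in> T" if "\<tau> \<in> T" for \<tau>
    using T_add[OF that cd] by (intro exI[of _ "\<tau> + (c - d)"]) simp
  moreover have "\<exists>\<tau>'. \<tau> + d = \<tau>' + c \<and> \<tau>' \<in> T" if "\<tau> \<in> T" for \<tau>
    using T_diff[OF that cd] by (intro exI[of _ "\<tau> - (c - d)"]) simp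
  ultimately show "T +>\<^bsub>P\<^esub> c = T +>\<^bsub>P\<^esub> d" unfolding coset_eq by blast
qed

lemma carrier_tensor: "carrier (tensor R M N) = {T +>\<^bsub>P\<^esub> c | c. Poly_Mapping.keys c \<subseteq> S}"
  by (auto simp: tensor_def FactRing_def A_RCOSETS_def' pretensor_simps)



text \<open>The universal property of the tensor product relative to a subgroup \<open>K\<close>,
  where \<open>F\<close> is balanced and biadditive only modulo \<open>K\<close>. For
  \<open>K\<close> zero it gives maps into a module, and for \<open>K = I M\<close> maps into
  \<open>M/IM\<close> without forming that quotient.\<close>

lemma T_finsum:
  assumes H: "abelian_group H" and F: "F \<in> S \<rightarrow> carrier H" and K: "subgroup K (add_monoid H)"
    and left: "\<And>x x' y. x \<in> carrier M \<Longrightarrow> x' \<in> carrier M \<Longrightarrow> y \<in> carrier N \<Longrightarrow>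
      F (x \<oplus>\<^bsub>M\<^esub> x', y) \<ominus>\<^bsub>H\<^esub> F (x, y) \<ominus>\<^bsub>H\<^esub> F (x', y) \<in> K"
    and right: "\<And>x y y'. x \<in> carrier M \<Longrightarrow> y \<in> carrier N \<Longrightarrow> y' \<in> carrier N \<Longrightarrow>
      F (x, y \<oplus>\<^bsub>N\<^esub> y') \<ominus>\<^bsub>H\<^esub> F (x, y) \<ominus>\<^bsub>H\<^esub> F (x, y') \<in> K"
    and scalar: "\<And>r x y. r \<in> carrier R \<Longrightarrow> x \<in> carrier M \<Longrightarrow> y \<in> carrier N \<Longrightarrow>
      F (r \<odot>\<^bsub>M\<^esub> x, y) \<ominus>\<^bsub>H\<^esub> F (x, r \<odot>\<^bsub>N\<^esub> y) \<in> K"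
    and c: "c \<in> T"
  shows "frag_sum H F c \<in> K"
proof -
  let ?L = "frag_sum H F"
  interpret H: abelian_group H by (rule H)
  note hom = H.frag_sum_hom(1)[OF F] and L_frag = H.frag_sum_hom(2)[OF F]
  note diff = H.frag_hom_diff[OF hom]
  have L2: "?L (frag_of p - frag_of q) = F p \<ominus>\<^bsub>H\<^esub> F q" if "p \<in> S" "q \<in> S" for p q
    by (subst diff) (use that L_frag keys_frag[of _ S] in simp_all)
  have L3: "?L (frag_of p - frag_of q - frag_of r) = F p \<ominus>\<^bsub>H\<^esub> F q \<ominus>\<^bsub>H\<^esub> F r"
    if "p \<in> S" "q \<in> S" "r \<in> S" for p q r
    by (subst diff) (use that L2 L_frag keys_frag[of _ S] keys_diff_frag[of "frag_of p" S "frag_of q"] in simp_all)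
  show ?thesis
  proof (rule T_image[OF hom K H.a_group _ _ _ c])
    fix x x' y assume "x \<in> carrier M" "x' \<in> carrier M" "y \<in> carrier N"
    then show "?L (frag_of (x \<oplus>\<^bsub>M\<^esub> x', y) - frag_of (x, y) - frag_of (x', y)) \<in> K"
      by (subst L3) (auto intro: left)
  next
    fix x y y' assume "x \<in> carrier M" "y \<in> carrier N" "y' \<in> carrier N"
    then show "?L (frag_of (x, y \<oplus>\<^bsub>N\<^esub> y') - frag_of (x, y) - frag_of (x, y')) \<in> K"
      by (subst L3) (auto intro: right)
  next
    fix r x y assume "r \<in> carrier R" "x \<in> carrier M" "y \<in> carrier N"
    then show "?L (frag_of (r \<odot>\<^bsub>M\<^esub> x, y) - frag_of (x, r \<odot>\<^bsub>N\<^esub> y)) \<in> K"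
      by (subst L2) (auto intro: scalar)
  qed
qed

end

section \<open>Flatness at an ideal with a dual basis\<close>

lemma (in cring) module_ideal_module:
  assumes "ideal I R"
  shows "module R (ideal_module R I)"
proof (rule moduleI)
  interpret ideal I R by fact
  show "cring R" by (rule is_cring)
  show "abelian_group (ideal_module R I)"
  proof (rule abelian_groupI; simp)
    fix x assume "x \<in> I"
    then show "\<exists>y\<in>I. y \<oplus> x = \<zero>" using a_inv_closed a_Hcarr by (intro bexI[of _ "\<ominus> x"]) (auto simp: l_neg)
  qed (use a_Hcarr in \<open>auto simp: a_assoc intro: a_comm\<close>)
qed (use ideal.Icarr[OF assms] ideal.I_l_closed[OF assms] in \<open>auto simp: l_distr r_distr m_assoc\<close>)

text \<open>The condition on the right expresses that the coordinates \<open>z \<mapsto> z\<close> and \<open>\<phi>\<close> with respect to the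
  dual basis can be transported from the ideal to its image in \<open>N\<close>.\<close>

lemma (in module) flat_iff_dual_basis:
  assumes I: "ideal I R" and db: "dual_basis R I e t \<phi>"
  shows "inj_on (ideal_tensor_map M) (carrier (tensor R (ideal_module R I) M)) \<longleftrightarrow>
    (\<forall>y\<in>carrier M. \<forall>z\<in>carrier M. e \<odot>\<^bsub>M\<^esub> y \<oplus>\<^bsub>M\<^esub> t \<odot>\<^bsub>M\<^esub> z = \<zero>\<^bsub>M\<^esub> \<longrightarrow>
        \<phi> e \<odot>\<^bsub>M\<^esub> y \<oplus>\<^bsub>M\<^esub> \<phi> t \<odot>\<^bsub>M\<^esub> z = \<zero>\<^bsub>M\<^esub>)" (is "?inj \<longleftrightarrow> ?cond")
proof -
  interpret I: ideal I R by fact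
  let ?I = "ideal_module R I"
  interpret IM: module R ?I by (rule module_ideal_module[OF I])
  interpret tensor_pair R ?I M ..
  from db have e: "e \<in> I" and t: "t \<in> I"
    and \<phi>: "\<phi> \<in> module_hom R ?I (ideal_module R (carrier R))"
    and split: "\<And>x. x \<in> I \<Longrightarrow> e \<otimes> x \<oplus> t \<otimes> \<phi> x = x"
    by (auto simp: dual_basis_def)
  note \<phi>D = module_homD[OF \<phi>, simplified]
  have ec [simp]: "e \<in> carrier R" and tc [simp]: "t \<in> carrier R" using e t I.a_Hcarr by auto
  have \<phi>e [simp]: "\<phi> e \<in> carrier R" and \<phi>t [simp]: "\<phi> t \<in> carrier R" using \<phi>D(1) e t by auto
  let ?F = "\<lambda>p. fst p \<odot>\<^bsub>M\<^esub> snd p"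
  define L where "L = frag_sum M ?F"
  have F: "?F \<in> S \<rightarrow> carrier M" using I.a_Hcarr by auto
  have K0: "subgroup {\<zero>\<^bsub>M\<^esub>} (add_monoid M)" using M.add.triv_subgroup by simp
  have LT: "L c = \<zero>\<^bsub>M\<^esub>" if "c \<in> T" for c
  proof -
    have "L c \<in> {\<zero>\<^bsub>M\<^esub>}" unfolding L_def
    proof (rule T_finsum[OF _ F K0 _ _ _ that])
      show "abelian_group M" by (rule M.abelian_group_axioms)
    qed (use I.a_Hcarr in \<open>simp_all add: smult_l_distr smult_r_distr smult_assoc1 smult_lcomm
          M.add_minus_minus a_minus_def[of M "_ \<odot>\<^bsub>M\<^esub> (_ \<odot>\<^bsub>M\<^esub> _)"] M.r_neg\<close>)
    then show ?thesis by simp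
  qed
  have L_hom: "L \<in> hom (free_Abelian_group S) (add_monoid M)"
    using M.frag_sum_hom(1)[OF F] unfolding L_def .
  have L_frag: "L (frag_of (x, y)) = x \<odot>\<^bsub>M\<^esub> y" if "x \<in> I" "y \<in> carrier M" for x y
    using M.frag_sum_hom(2)[OF F, of "(x, y)"] that unfolding L_def by simp
  have L_closed: "L c \<in> carrier M" if "Poly_Mapping.keys c \<subseteq> S" for c
    using hom_in_carrier[OF L_hom, of c] that by simp
  have L_add: "L (c + d) = L c \<oplus>\<^bsub>M\<^esub> L d" if "Poly_Mapping.keys c \<subseteq> S" "Poly_Mapping.keys d \<subseteq> S" for c d
    using hom_mult[OF L_hom, of c d] that by simp
  note L_diff = M.frag_hom_diff[OF L_hom]
  have map: "ideal_tensor_map M (T +>\<^bsub>P\<^esub> c) = L c" if c: "Poly_Mapping.keys c \<subseteq> S" for c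
  proof -
    have "L d = L c" if "d \<in> T +>\<^bsub>P\<^esub> c" for d
      using that c T_keys LT L_closed[OF c] by (auto simp: coset_eq L_add)
    then have "L ` (T +>\<^bsub>P\<^esub> c) = {L c}" using coset_self by blast
    then show ?thesis unfolding ideal_tensor_map_def L_def frag_sum_def by simp
  qed
  \<comment> \<open>Insert \<open>x = x e + \<phi>(x) t\<close> in the left factor and move the
    scalars \<open>x\<close> and \<open>\<phi>(x)\<close> to the right factor.\<close>
  have expand: "frag_of (x, y) - (frag_of (e, x \<odot>\<^bsub>M\<^esub> y) + frag_of (t, \<phi> x \<odot>\<^bsub>M\<^esub> y)) \<in> T"
    if x: "x \<in> I" and y: "y \<in> carrier M" for x y
  proof -
    have xc [simp]: "x \<in> carrier R" "\<phi> x \<in> carrier R" using x I.a_Hcarr \<phi>D(1) by auto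
    have x_eq: "x \<otimes> e \<oplus> \<phi> x \<otimes> t = x" using split[OF x] by (simp add: m_comm)
    have A: "frag_of (x, y) - frag_of (x \<otimes> e, y) - frag_of (\<phi> x \<otimes> t, y) \<in> T"
      using T_left[of "x \<otimes> e" "\<phi> x \<otimes> t" y] e t y I.I_l_closed x_eq by simp
    have B: "frag_of (x \<otimes> e, y) - frag_of (e, x \<odot>\<^bsub>M\<^esub> y) \<in> T"
      using T_scalar[of x e y] e y by simp
    have C: "frag_of (\<phi> x \<otimes> t, y) - frag_of (t, \<phi> x \<odot>\<^bsub>M\<^esub> y) \<in> T"
      using T_scalar[of "\<phi> x" t y] t y by simp
    have "(frag_of (x, y) - frag_of (x \<otimes> e, y) - frag_of (\<phi> x \<otimes> t, y))
       + (frag_of (x \<otimes> e, y) - frag_of (e, x \<odot>\<^bsub>M\<^esub> y)) + (frag_of (\<phi> x \<otimes> t, y) - frag_of (t, \<phi> x \<odot>\<^bsub>M\<^esub> y)) \<in> T"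
      by (rule T_add[OF T_add[OF A B] C])
    then show ?thesis
      by (simp add: algebra_simps)
  qed
  \<comment> \<open>Every tensor has the form \<open>e \<otimes> y + t \<otimes> z\<close>, so
    injectivity becomes a question about pairs \<open>y\<close>, \<open>z\<close>.\<close>
  have normal: "\<exists>y\<in>carrier M. \<exists>z\<in>carrier M. c - (frag_of (e, y) + frag_of (t, z)) \<in> T"
    if "Poly_Mapping.keys c \<subseteq> S" for c
    using that
  proof (induction c rule: free_Abelian_group_induct[consumes 1, case_names zero diff frag])
    case zero
    have "frag_of (e, \<zero>\<^bsub>M\<^esub>) \<in> T" "frag_of (t, \<zero>\<^bsub>M\<^esub>) \<in> T" using e t by (auto intro!: T_right_zero)
    then have "0 - (frag_of (e, \<zero>\<^bsub>M\<^esub>) + frag_of (t, \<zero>\<^bsub>M\<^esub>)) \<in> T"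
      by (rule T_diff[OF T_zero T_add])
    then show ?case by blast
  next
    case (diff c d)
    then obtain y z y' z' where *: "y \<in> carrier M" "z \<in> carrier M" "c - (frag_of (e, y) + frag_of (t, z)) \<in> T"
      "y' \<in> carrier M" "z' \<in> carrier M" "d - (frag_of (e, y') + frag_of (t, z')) \<in> T" by blast
    let ?a = "frag_of (e, y \<ominus>\<^bsub>M\<^esub> y') - (frag_of (e, y) - frag_of (e, y'))"
    let ?b = "frag_of (t, z \<ominus>\<^bsub>M\<^esub> z') - (frag_of (t, z) - frag_of (t, z'))"
    have ab: "?a \<in> T" "?b \<in> T" using * e t by (auto intro!: T_right_diff)
    have "(c - (frag_of (e, y) + frag_of (t, z))) - (d - (frag_of (e, y') + frag_of (t, z'))) - ?a - ?b \<in> T"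
      by (rule T_diff[OF T_diff[OF T_diff[OF *(3,6)] ab(1)] ab(2)])
    then have "(c - d) - (frag_of (e, y \<ominus>\<^bsub>M\<^esub> y') + frag_of (t, z \<ominus>\<^bsub>M\<^esub> z')) \<in> T"
      by (simp add: algebra_simps)
    then show ?case using * by blast
  next
    case (frag p)
    then obtain x y where p: "p = (x, y)" "x \<in> I" "y \<in> carrier M" by auto
    then have "x \<odot>\<^bsub>M\<^esub> y \<in> carrier M" "\<phi> x \<odot>\<^bsub>M\<^esub> y \<in> carrier M" using \<phi>D(1) I.a_Hcarr by auto
    then show ?case using expand[OF p(2,3)] unfolding p(1) by blast
  qed
  have pair_keys: "Poly_Mapping.keys (frag_of (e, y) + frag_of (t, z)) \<subseteq> S" if "y \<in> carrier M" "z \<in> carrier M" for y z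
    using e t that by (intro order_trans[OF Poly_Mapping.keys_add] Un_least keys_frag) auto
  have L_pair: "L (frag_of (e, y) + frag_of (t, z)) = e \<odot>\<^bsub>M\<^esub> y \<oplus>\<^bsub>M\<^esub> t \<odot>\<^bsub>M\<^esub> z"
    if "y \<in> carrier M" "z \<in> carrier M" for y z
    using e t that by (subst L_add) (auto simp: L_frag)
  show ?thesis
  proof
    assume inj: ?inj
    show ?cond
    proof (intro ballI impI)
      fix y z assume yz: "y \<in> carrier M" "z \<in> carrier M" and 0: "e \<odot>\<^bsub>M\<^esub> y \<oplus>\<^bsub>M\<^esub> t \<odot>\<^bsub>M\<^esub> z = \<zero>\<^bsub>M\<^esub>"
      let ?c = "frag_of (e, y) + frag_of (t, z)"
      have "ideal_tensor_map M (T +>\<^bsub>P\<^esub> ?c) = ideal_tensor_map M (T +>\<^bsub>P\<^esub> 0)"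
        using map[OF pair_keys[OF yz]] map[of 0] L_pair[OF yz] 0 LT[OF T_zero] by simp
      moreover have "T +>\<^bsub>P\<^esub> ?c \<in> carrier (tensor R ?I M)" "T +>\<^bsub>P\<^esub> 0 \<in> carrier (tensor R ?I M)"
        unfolding carrier_tensor using pair_keys[OF yz] by (blast, force)
      ultimately have "T +>\<^bsub>P\<^esub> ?c = T +>\<^bsub>P\<^esub> 0" using inj by (auto dest: inj_onD)
      then have cT: "?c \<in> T" by (simp add: coset_eq_iff)
      \<comment> \<open>The form \<open>\<phi>\<close> induces the map
        \<open>a \<otimes> y \<mapsto> \<phi>(a) y\<close> on the tensor product. Injectivity has
        just shown that the tensor \<open>?c\<close> is zero, so its image under this map is zero
        too.\<close>
      let ?G = "\<lambda>p. \<phi> (fst p) \<odot>\<^bsub>M\<^esub> snd p"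
      define L' where "L' = frag_sum M ?G"
      have G: "?G \<in> S \<rightarrow> carrier M" using \<phi>D(1) by auto
      have "L' ?c \<in> {\<zero>\<^bsub>M\<^esub>}" unfolding L'_def
      proof (rule T_finsum[OF _ G K0 _ _ _ cT])
        show "abelian_group M" by (rule M.abelian_group_axioms)
      qed (use \<phi>D in \<open>simp_all add: Pi_iff smult_l_distr smult_r_distr smult_assoc1 smult_lcomm
          M.add_minus_minus a_minus_def[of M "_ \<odot>\<^bsub>M\<^esub> (_ \<odot>\<^bsub>M\<^esub> _)"] M.r_neg\<close>)
      moreover have "L' ?c = \<phi> e \<odot>\<^bsub>M\<^esub> y \<oplus>\<^bsub>M\<^esub> \<phi> t \<odot>\<^bsub>M\<^esub> z"
      proof -
        have "L' ?c = L' (frag_of (e, y)) \<oplus>\<^bsub>M\<^esub> L' (frag_of (t, z))"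
          using hom_mult[OF M.frag_sum_hom(1)[OF G], of "frag_of (e, y)" "frag_of (t, z)"] e t yz
          unfolding L'_def by simp
        then show ?thesis
          using M.frag_sum_hom(2)[OF G, of "(e, y)"] M.frag_sum_hom(2)[OF G, of "(t, z)"] e t yz
          unfolding L'_def by simp
      qed
      ultimately show "\<phi> e \<odot>\<^bsub>M\<^esub> y \<oplus>\<^bsub>M\<^esub> \<phi> t \<odot>\<^bsub>M\<^esub> z = \<zero>\<^bsub>M\<^esub>" by simp
    qed
  next
    assume cond: ?cond
    have ker: "c \<in> T" if c: "Poly_Mapping.keys c \<subseteq> S" and 0: "L c = \<zero>\<^bsub>M\<^esub>" for c
    proof -
      obtain y z where yz: "y \<in> carrier M" "z \<in> carrier M" and cT: "c - (frag_of (e, y) + frag_of (t, z)) \<in> T"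
        using normal[OF c] by blast
      have "L c \<ominus>\<^bsub>M\<^esub> L (frag_of (e, y) + frag_of (t, z)) = \<zero>\<^bsub>M\<^esub>"
        using LT[OF cT] L_diff[OF c pair_keys[OF yz]] by simp
      then have 1: "e \<odot>\<^bsub>M\<^esub> y \<oplus>\<^bsub>M\<^esub> t \<odot>\<^bsub>M\<^esub> z = \<zero>\<^bsub>M\<^esub>"
        using L_pair[OF yz] yz 0 by (simp add: a_minus_def M.add.inv_eq_1_iff)
      then have 2: "\<phi> e \<odot>\<^bsub>M\<^esub> y \<oplus>\<^bsub>M\<^esub> \<phi> t \<odot>\<^bsub>M\<^esub> z = \<zero>\<^bsub>M\<^esub>" using cond yz by blast
      \<comment> \<open>Expanding \<open>e \<otimes> y\<close> and \<open>t \<otimes> z\<close> once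
        more and collecting terms gives \<open>e \<otimes> (e y + t z) + t \<otimes> (\<phi>(e) y +
        \<phi>(t) z)\<close>, and both right factors are 0.\<close>
      let ?ey = "frag_of (e, e \<odot>\<^bsub>M\<^esub> y \<oplus>\<^bsub>M\<^esub> t \<odot>\<^bsub>M\<^esub> z) - frag_of (e, e \<odot>\<^bsub>M\<^esub> y) - frag_of (e, t \<odot>\<^bsub>M\<^esub> z)"
      let ?tz = "frag_of (t, \<phi> e \<odot>\<^bsub>M\<^esub> y \<oplus>\<^bsub>M\<^esub> \<phi> t \<odot>\<^bsub>M\<^esub> z) - frag_of (t, \<phi> e \<odot>\<^bsub>M\<^esub> y) - frag_of (t, \<phi> t \<odot>\<^bsub>M\<^esub> z)"
      have A: "?ey \<in> T" "?tz \<in> T" using e t yz by (auto intro!: T_right)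
      have B: "frag_of (e, \<zero>\<^bsub>M\<^esub>) \<in> T" "frag_of (t, \<zero>\<^bsub>M\<^esub>) \<in> T" using e t by (auto intro!: T_right_zero)
      have "frag_of (e, \<zero>\<^bsub>M\<^esub>) + frag_of (t, \<zero>\<^bsub>M\<^esub>) - ?ey - ?tz
          + (frag_of (e, y) - (frag_of (e, e \<odot>\<^bsub>M\<^esub> y) + frag_of (t, \<phi> e \<odot>\<^bsub>M\<^esub> y)))
          + (frag_of (t, z) - (frag_of (e, t \<odot>\<^bsub>M\<^esub> z) + frag_of (t, \<phi> t \<odot>\<^bsub>M\<^esub> z))) \<in> T"
        by (rule T_add[OF T_add[OF T_diff[OF T_diff[OF T_add[OF B] A(1)] A(2)]
              expand[OF e yz(1)]] expand[OF t yz(2)]])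
      then have "frag_of (e, y) + frag_of (t, z) \<in> T" unfolding 1 2 by (simp add: algebra_simps)
      then show ?thesis using T_add[OF cT] by fastforce
    qed
    show ?inj
    proof (rule inj_onI)
      fix X Y assume "X \<in> carrier (tensor R ?I M)" "Y \<in> carrier (tensor R ?I M)"
        and eq: "ideal_tensor_map M X = ideal_tensor_map M Y"
      then obtain c d where cd: "Poly_Mapping.keys c \<subseteq> S" "X = T +>\<^bsub>P\<^esub> c" "Poly_Mapping.keys d \<subseteq> S" "Y = T +>\<^bsub>P\<^esub> d"
        unfolding carrier_tensor by blast
      have "L (c - d) = \<zero>\<^bsub>M\<^esub>"
        using L_diff[OF cd(1,3)] eq map cd L_closed[OF cd(3)] by (simp add: a_minus_def M.r_neg)
      then have "c - d \<in> T" using ker keys_diff_frag cd by blast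
      then show "X = Y" using cd by (simp add: coset_eq_iff)
    qed
  qed
qed

section \<open>Tensor products of algebras and reduction modulo an ideal\<close>

lemma cring_cong:
  assumes "cring A" and "carrier B = carrier A"
    "\<And>x y. x \<in> carrier A \<Longrightarrow> y \<in> carrier A \<Longrightarrow> x \<oplus>\<^bsub>B\<^esub> y = x \<oplus>\<^bsub>A\<^esub> y"
    "\<And>x y. x \<in> carrier A \<Longrightarrow> y \<in> carrier A \<Longrightarrow> x \<otimes>\<^bsub>B\<^esub> y = x \<otimes>\<^bsub>A\<^esub> y"
    "\<zero>\<^bsub>B\<^esub> = \<zero>\<^bsub>A\<^esub>" "\<one>\<^bsub>B\<^esub> = \<one>\<^bsub>A\<^esub>"
  shows "cring B"
proof -
  interpret A: cring A by fact
  show ?thesis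
  proof (rule cringI)
    show "abelian_group B"
    proof (rule abelian_groupI)
      fix x assume "x \<in> carrier B"
      then show "\<exists>y\<in>carrier B. y \<oplus>\<^bsub>B\<^esub> x = \<zero>\<^bsub>B\<^esub>"
        using assms by (intro bexI[of _ "\<ominus>\<^bsub>A\<^esub> x"]) (simp_all add: A.l_neg)
    qed (use assms in \<open>simp_all add: A.a_ac\<close>)
    show "comm_monoid B"
      by (rule comm_monoidI) (use assms in \<open>simp_all add: A.m_ac\<close>)
  qed (use assms in \<open>simp_all add: A.l_distr\<close>)
qed

lemma quot_algebra_simps [simp]:
  "carrier (quot_algebra R I) = carrier (R Quot I)"
  "add (quot_algebra R I) = add (R Quot I)"
  "monoid.mult (quot_algebra R I) = monoid.mult (R Quot I)"
  "\<zero>\<^bsub>quot_algebra R I\<^esub> = \<zero>\<^bsub>R Quot I\<^esub>" "\<one>\<^bsub>quot_algebra R I\<^esub> = \<one>\<^bsub>R Quot I\<^esub>"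
  "r \<odot>\<^bsub>quot_algebra R I\<^esub> X = (I +>\<^bsub>R\<^esub> r) \<otimes>\<^bsub>R Quot I\<^esub> X"
  by (simp_all add: quot_algebra_def ring.defs module.defs)

lemma (in cring) algebra_quot_algebra:
  assumes "ideal I R"
  shows "algebra R (quot_algebra R I)"
proof -
  interpret ideal I R by fact
  interpret Q: cring "R Quot I" using quotient_is_cring is_cring .
  interpret h: ring_hom_cring R "R Quot I" "(+>) I" using rcos_ring_hom_cring is_cring .
  show ?thesis
  proof (rule algebraI)
    show "cring (quot_algebra R I)" by (rule cring_cong[OF Q.is_cring]) auto
    show "\<one> \<odot>\<^bsub>quot_algebra R I\<^esub> X = X" if "X \<in> carrier (quot_algebra R I)" for X
      using that h.hom_one by simp
  qed (auto simp: is_cring Q.l_distr Q.r_distr Q.m_assoc)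
qed

locale algebra_tensor_pair = MA: algebra R M + NA: algebra R N for R (structure) and M (structure) and N
begin

sublocale tensor_pair R M N ..

abbreviation pmult where "pmult \<equiv> monoid.mult (pretensor M N)"

lemma pmult_frag: "pmult (frag_of (x, y)) (frag_of (x', y')) = frag_of (x \<otimes>\<^bsub>M\<^esub> x', y \<otimes>\<^bsub>N\<^esub> y')"
  by (simp add: pretensor_def)

lemma frag_extend_distrib:
  "frag_extend (\<lambda>i. f i - g i) c = frag_extend f c - frag_extend g c"
proof -
  have "Poly_Mapping.keys c \<subseteq> UNIV" by simp
  then show ?thesis by (induction c rule: frag_induction) (simp_all add: frag_extend_diff)
qed

lemma pmult_diff_left: "pmult (c - c') d = pmult c d - pmult c' d"
  by (simp add: pretensor_def frag_extend_diff)

lemma pmult_diff_right: "pmult c (d - d') = pmult c d - pmult c d'"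
  by (simp add: pretensor_def frag_extend_diff case_prod_unfold flip: frag_extend_distrib)

lemma pmult_zero: "pmult 0 d = 0" "pmult c 0 = 0"
  using pmult_diff_left[of 0 0 d] pmult_diff_right[of c 0 0] by simp_all

lemma pmult_minus: "pmult (- c) d = - pmult c d" "pmult c (- d) = - pmult c d"
  using pmult_diff_left[of 0 c d] pmult_diff_right[of c 0 d] by (simp_all add: pmult_zero)

lemma pmult_add: "pmult (c + c') d = pmult c d + pmult c' d" "pmult c (d + d') = pmult c d + pmult c d'"
  using pmult_diff_left[of c "- c'" d] pmult_diff_right[of c d "- d'"] by (simp_all add: pmult_minus)

lemma pmult_comm:
  assumes "Poly_Mapping.keys c \<subseteq> S" "Poly_Mapping.keys d \<subseteq> S"
  shows "pmult c d = pmult d c"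
  using assms(1)
proof (induction c rule: frag_induction)
  case (one p)
  show ?case using assms(2)
    by (induction d rule: frag_induction)
      (use one in \<open>auto simp: pmult_zero pmult_diff_left pmult_diff_right pmult_frag MA.m_comm NA.m_comm\<close>)
qed (auto simp: pmult_zero pmult_diff_left pmult_diff_right)

text \<open>Multiplication by a pair sends each generating relation to a relation of the same kind,
  so \<open>T_image\<close> applies with \<open>K = T\<close>.\<close>

lemma T_pmult_frag:
  assumes c: "c \<in> T" and p: "p \<in> S"
  shows "pmult c (frag_of p) \<in> T"
proof -
  obtain x' y' where p': "p = (x', y')" "x' \<in> carrier M" "y' \<in> carrier N" using p by auto
  have "(\<lambda>c. pmult c (frag_of p)) \<in> hom (free_Abelian_group S) (free_Abelian_group S)"
  proof (rule homI)
    fix c assume "c \<in> carrier (free_Abelian_group S)"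
    then have "Poly_Mapping.keys c \<subseteq> S" by (simp only: carrier_free_Abelian_group_iff)
    then have "Poly_Mapping.keys (pmult c (frag_of p)) \<subseteq> S"
    proof (induction c rule: frag_induction)
      case (one q)
      then obtain x y where "q = (x, y)" "x \<in> carrier M" "y \<in> carrier N" by auto
      then show ?case using p' by (simp only: pmult_frag, intro keys_frag) simp
    qed (simp_all only: pmult_zero pmult_diff_left keys_zero empty_subsetI keys_diff_frag)
    then show "pmult c (frag_of p) \<in> carrier (free_Abelian_group S)" by (simp only: carrier_free_Abelian_group_iff)
  qed (simp add: pmult_add)
  then show ?thesis
  proof (rule T_image[OF _ T_subgroup group_free_Abelian_group _ _ _ c])
    fix x x1 y assume "x \<in> carrier M" "x1 \<in> carrier M" "y \<in> carrier N"
    then show "pmult (frag_of (x \<oplus>\<^bsub>M\<^esub> x1, y) - frag_of (x, y) - frag_of (x1, y)) (frag_of p) \<in> T"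
      using p' T_left[of "x \<otimes>\<^bsub>M\<^esub> x'" "x1 \<otimes>\<^bsub>M\<^esub> x'" "y \<otimes>\<^bsub>N\<^esub> y'"]
      by (simp add: pmult_diff_left pmult_frag MA.l_distr)
  next
    fix x y y1 assume "x \<in> carrier M" "y \<in> carrier N" "y1 \<in> carrier N"
    then show "pmult (frag_of (x, y \<oplus>\<^bsub>N\<^esub> y1) - frag_of (x, y) - frag_of (x, y1)) (frag_of p) \<in> T"
      using p' T_right[of "x \<otimes>\<^bsub>M\<^esub> x'" "y \<otimes>\<^bsub>N\<^esub> y'" "y1 \<otimes>\<^bsub>N\<^esub> y'"]
      by (simp add: pmult_diff_left pmult_frag NA.l_distr)
  next
    fix r x y assume "r \<in> carrier R" "x \<in> carrier M" "y \<in> carrier N"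
    then show "pmult (frag_of (r \<odot>\<^bsub>M\<^esub> x, y) - frag_of (x, r \<odot>\<^bsub>N\<^esub> y)) (frag_of p) \<in> T"
      using p' T_scalar[of r "x \<otimes>\<^bsub>M\<^esub> x'" "y \<otimes>\<^bsub>N\<^esub> y'"]
      by (simp add: pmult_diff_left pmult_frag MA.smult_assoc2 NA.smult_assoc2)
  qed
qed

lemma T_pmult:
  assumes "c \<in> T" and "Poly_Mapping.keys d \<subseteq> S"
  shows "pmult c d \<in> T"
  using assms(2)
  by (induction d rule: frag_induction)
    (auto simp: pmult_zero pmult_diff_right T_zero intro: T_diff T_pmult_frag assms(1))

text \<open>The product of cosets is a union over all representatives. It is a single coset because
  \<open>T\<close> absorbs products; commutativity brings the relation into the left factor, where
  \<open>T_pmult\<close> applies.\<close>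

lemma coset_mult:
  assumes "Poly_Mapping.keys c \<subseteq> S" "Poly_Mapping.keys d \<subseteq> S"
  shows "(T +>\<^bsub>P\<^esub> c) \<otimes>\<^bsub>tensor R M N\<^esub> (T +>\<^bsub>P\<^esub> d) = T +>\<^bsub>P\<^esub> pmult c d"
proof -
  have "T +>\<^bsub>P\<^esub> pmult a b = T +>\<^bsub>P\<^esub> pmult c d" if ab: "a \<in> T +>\<^bsub>P\<^esub> c" "b \<in> T +>\<^bsub>P\<^esub> d" for a b
  proof -
    obtain \<sigma> \<tau> where st: "\<sigma> \<in> T" "\<tau> \<in> T" "a = \<sigma> + c" "b = \<tau> + d"
      using ab unfolding coset_eq by blast
    have "pmult a b - pmult c d = pmult \<sigma> \<tau> + pmult \<sigma> d + pmult \<tau> c"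
      using pmult_comm[OF T_keys[OF st(2)] assms(1)] by (simp add: st pmult_add)
    also have "\<dots> \<in> T"
      by (rule T_add[OF T_add[OF T_pmult T_pmult] T_pmult]) (use st assms T_keys in auto)
    finally show ?thesis by (simp add: coset_eq_iff)
  qed
  then have "(\<Union>a\<in>T +>\<^bsub>P\<^esub> c. \<Union>b\<in>T +>\<^bsub>P\<^esub> d. T +>\<^bsub>P\<^esub> pmult a b) = T +>\<^bsub>P\<^esub> pmult c d"
    using coset_self by blast
  then show ?thesis by (simp add: tensor_def FactRing_def rcoset_mult_def)
qed

lemma tensor_one: "\<one>\<^bsub>tensor R M N\<^esub> = T +>\<^bsub>P\<^esub> frag_of (\<one>\<^bsub>M\<^esub>, \<one>\<^bsub>N\<^esub>)"
  by (simp add: tensor_def FactRing_def pretensor_def)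

lemma tensor_pow:
  assumes "y \<in> carrier N"
  shows "(T +>\<^bsub>P\<^esub> frag_of (\<one>\<^bsub>M\<^esub>, y)) [^]\<^bsub>tensor R M N\<^esub> (n :: nat) = T +>\<^bsub>P\<^esub> frag_of (\<one>\<^bsub>M\<^esub>, y [^]\<^bsub>N\<^esub> n)"
proof (induction n)
  case (Suc n)
  have "(T +>\<^bsub>P\<^esub> frag_of (\<one>\<^bsub>M\<^esub>, y)) [^]\<^bsub>tensor R M N\<^esub> Suc n =
    (T +>\<^bsub>P\<^esub> frag_of (\<one>\<^bsub>M\<^esub>, y [^]\<^bsub>N\<^esub> n)) \<otimes>\<^bsub>tensor R M N\<^esub> (T +>\<^bsub>P\<^esub> frag_of (\<one>\<^bsub>M\<^esub>, y))"
    using Suc by (simp add: nat_pow_def)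
  also have "\<dots> = T +>\<^bsub>P\<^esub> pmult (frag_of (\<one>\<^bsub>M\<^esub>, y [^]\<^bsub>N\<^esub> n)) (frag_of (\<one>\<^bsub>M\<^esub>, y))"
    by (rule coset_mult; rule keys_frag) (use assms in auto)
  finally show ?case using assms by (simp add: pmult_frag)
qed (simp add: tensor_one nat_pow_def)


end

text \<open>\<open>R/I \<otimes> A\<close> is \<open>A/IA\<close>: every tensor is of the form \<open>1 \<otimes> b\<close>, and \<open>1 \<otimes> b\<close> vanishes exactly for
  \<open>b \<in> IA\<close>.\<close>

lemma (in algebra) tensor_frobenius_iff:
  assumes I: "ideal I R" and f: "f \<in> alg_hom R M M"
  shows "(\<forall>x\<in>carrier (tensor R (quot_algebra R I) M).
      tensor_induced R (quot_algebra R I) M f x = x [^]\<^bsub>tensor R (quot_algebra R I) M\<^esub> (n :: nat)) \<longleftrightarrow>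
    (\<forall>y\<in>carrier M. f y \<ominus>\<^bsub>M\<^esub> y [^]\<^bsub>M\<^esub> n \<in> ideal_smult I (carrier M) M)"
proof -
  interpret I: ideal I R by fact
  let ?Q = "quot_algebra R I"
  interpret Q: algebra R ?Q by (rule R.algebra_quot_algebra[OF I])
  interpret algebra_tensor_pair R ?Q M ..
  have coset_in: "I +> r \<in> carrier (R Quot I)" if "r \<in> carrier R" for r
    using that by (auto simp: FactRing_def A_RCOSETS_def')
  let ?one = "I +> \<one>"
  have one: "\<one>\<^bsub>?Q\<^esub> = ?one" by (simp add: FactRing_def)
  let ?K = "ideal_smult I (carrier M) M"
  let ?gens = "{r \<odot>\<^bsub>M\<^esub> x | r x. r \<in> I \<and> x \<in> carrier M}"
  have gens: "?gens \<subseteq> carrier M" using I.a_Hcarr by auto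
  have K: "subgroup ?K (add_monoid M)"
    unfolding ideal_smult_def using M.add.generate_is_subgroup[OF gens] .
  have fc: "f y \<in> carrier M" if "y \<in> carrier M" for y
    using f that by (auto simp: alg_hom_def ring_hom_def)
  have fadd: "f (y \<oplus>\<^bsub>M\<^esub> z) = f y \<oplus>\<^bsub>M\<^esub> f z" if "y \<in> carrier M" "z \<in> carrier M" for y z
    using f that by (auto simp: alg_hom_def ring_hom_def)
  have fsmult: "f (r \<odot>\<^bsub>M\<^esub> y) = r \<odot>\<^bsub>M\<^esub> f y" if "r \<in> carrier R" "y \<in> carrier M" for r y
    using f that by (auto simp: alg_hom_def)
  define G where "G = frag_extend (\<lambda>(x, y). frag_of (x :: 'a set, f y))"
  have G_T: "G c \<in> T" if "c \<in> T" for c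
  proof (rule T_image[OF _ T_subgroup group_free_Abelian_group _ _ _ that])
    show "G \<in> hom (free_Abelian_group S) (free_Abelian_group S)"
    proof (rule homI)
      fix c assume "c \<in> carrier (free_Abelian_group S)"
      then have "Poly_Mapping.keys c \<subseteq> S" by (simp only: carrier_free_Abelian_group_iff)
      then have "Poly_Mapping.keys (G c) \<subseteq> S"
      proof (induction c rule: frag_induction)
        case (one q)
        then obtain x y where "q = (x, y)" "x \<in> carrier ?Q" "y \<in> carrier M" by auto
        then show ?case using fc unfolding G_def by (simp only: frag_extend_of prod.case, intro keys_frag) simp
      qed (simp_all only: G_def frag_extend_diff frag_extend_0 keys_zero empty_subsetI keys_diff_frag)
      then show "G c \<in> carrier (free_Abelian_group S)" by (simp only: carrier_free_Abelian_group_iff)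
    qed (simp add: G_def frag_extend_add)
  next
    fix x x' y assume "x \<in> carrier ?Q" "x' \<in> carrier ?Q" "y \<in> carrier M"
    then show "G (frag_of (x \<oplus>\<^bsub>?Q\<^esub> x', y) - frag_of (x, y) - frag_of (x', y)) \<in> T"
      using T_left[of x x' "f y"] fc by (simp add: G_def frag_extend_diff)
  next
    fix x y y' assume "x \<in> carrier ?Q" "y \<in> carrier M" "y' \<in> carrier M"
    then show "G (frag_of (x, y \<oplus>\<^bsub>M\<^esub> y') - frag_of (x, y) - frag_of (x, y')) \<in> T"
      using T_right[of x "f y" "f y'"] fc by (simp add: G_def frag_extend_diff fadd)
  next
    fix r x y assume "r \<in> carrier R" "x \<in> carrier ?Q" "y \<in> carrier M"
    then show "G (frag_of (r \<odot>\<^bsub>?Q\<^esub> x, y) - frag_of (x, r \<odot>\<^bsub>M\<^esub> y)) \<in> T"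
      using T_scalar[of r x "f y"] fc by (simp add: G_def frag_extend_diff fsmult)
  qed
  have induced: "tensor_induced R ?Q M f (T +>\<^bsub>P\<^esub> frag_of (?one, y)) = T +>\<^bsub>P\<^esub> frag_of (?one, f y)" for y
  proof -
    have "T +>\<^bsub>P\<^esub> G d = T +>\<^bsub>P\<^esub> frag_of (?one, f y)" if d: "d \<in> T +>\<^bsub>P\<^esub> frag_of (?one, y)" for d
    proof -
      obtain \<tau> where "\<tau> \<in> T" "d = \<tau> + frag_of (?one, y)" using d unfolding coset_eq by blast
      moreover have "G (\<tau> + frag_of (?one, y)) = G \<tau> + frag_of (?one, f y)"
        by (simp add: G_def frag_extend_add)
      ultimately show ?thesis using G_T by (simp add: coset_eq_iff)
    qed
    then have "(\<Union>d\<in>T +>\<^bsub>P\<^esub> frag_of (?one, y). T +>\<^bsub>P\<^esub> G d) = T +>\<^bsub>P\<^esub> frag_of (?one, f y)"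
      using coset_self by blast
    then show ?thesis by (simp add: tensor_induced_def G_def)
  qed
  have scalar_one: "r \<odot>\<^bsub>?Q\<^esub> ?one = I +> r" if "r \<in> carrier R" for r
    using that by (simp add: FactRing_def I.rcoset_mult_add)
  have normal: "\<exists>y\<in>carrier M. c - frag_of (?one, y) \<in> T" if "Poly_Mapping.keys c \<subseteq> S" for c
    using that
  proof (induction c rule: free_Abelian_group_induct[consumes 1, case_names zero diff frag])
    case zero
    have "0 - frag_of (?one, \<zero>\<^bsub>M\<^esub>) \<in> T"
      using coset_in by (intro T_diff[OF T_zero] T_right_zero) simp
    then show ?case by blast
  next
    case (diff c d)
    then obtain y z where *: "y \<in> carrier M" "z \<in> carrier M"
      "c - frag_of (?one, y) \<in> T" "d - frag_of (?one, z) \<in> T" by blast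
    have "frag_of (?one, y \<ominus>\<^bsub>M\<^esub> z) - (frag_of (?one, y) - frag_of (?one, z)) \<in> T"
      using * coset_in by (intro T_right_diff) auto
    from T_diff[OF T_diff[OF *(3,4)] this] have "c - d - frag_of (?one, y \<ominus>\<^bsub>M\<^esub> z) \<in> T"
      by (simp add: algebra_simps)
    then show ?case using * by blast
  next
    case (frag p)
    then obtain r y where p: "p = (I +> r, y)" "r \<in> carrier R" "y \<in> carrier M"
      by (auto simp: FactRing_def A_RCOSETS_def')
    have "frag_of (r \<odot>\<^bsub>?Q\<^esub> ?one, y) - frag_of (?one, r \<odot>\<^bsub>M\<^esub> y) \<in> T"
      using p coset_in by (intro T_scalar) auto
    then have "frag_of p - frag_of (?one, r \<odot>\<^bsub>M\<^esub> y) \<in> T" using p scalar_one by simp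
    then show ?case using p smult_closed by blast
  qed
  \<comment> \<open>On a generator \<open>r x\<close> with \<open>r\<close> in \<open>I\<close> this
    is \<open>1 \<otimes> r x = r 1 \<otimes> x\<close>, and \<open>r 1\<close> is zero in
    \<open>R/I\<close>.\<close>
  have K_T: "frag_of (?one, z) \<in> T" if "z \<in> ?K" for z
  proof -
    have inc: "frag_of (?one, h) \<in> T" if hg: "h \<in> ?gens" for h
    proof -
      obtain r x where h: "h = r \<odot>\<^bsub>M\<^esub> x" "r \<in> I" "x \<in> carrier M" using hg by auto
      have rc: "r \<in> carrier R" using h I.a_Hcarr by auto
      have "frag_of (r \<odot>\<^bsub>?Q\<^esub> ?one, x) - frag_of (?one, r \<odot>\<^bsub>M\<^esub> x) \<in> T"
        using h rc coset_in by (intro T_scalar) auto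
      moreover have "r \<odot>\<^bsub>?Q\<^esub> ?one = \<zero>\<^bsub>?Q\<^esub>"
        using scalar_one[OF rc] I.a_rcos_const[OF h(2)] by (simp add: FactRing_def)
      ultimately have "frag_of (\<zero>\<^bsub>?Q\<^esub>, x) - frag_of (?one, h) \<in> T" using h by simp
      from T_diff[OF T_left_zero[OF h(3)] this] show ?thesis by simp
    qed
    have "frag_of (?one, z) \<in> T \<and> z \<in> carrier M" using that unfolding ideal_smult_def
    proof (induction z rule: generate.induct)
      case one
      then show ?case using T_right_zero coset_in by simp
    next
      case (incl h)
      then show ?case using inc gens by blast
    next
      case (inv h)
      have hc: "h \<in> carrier M" using inv gens by blast
      have "frag_of (?one, \<zero>\<^bsub>M\<^esub> \<ominus>\<^bsub>M\<^esub> h) - (frag_of (?one, \<zero>\<^bsub>M\<^esub>) - frag_of (?one, h)) \<in> T"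
        using coset_in hc by (intro T_right_diff) auto
      moreover have "frag_of (?one, \<zero>\<^bsub>M\<^esub>) \<in> T" using coset_in by (intro T_right_zero) auto
      ultimately have "frag_of (?one, \<zero>\<^bsub>M\<^esub> \<ominus>\<^bsub>M\<^esub> h) \<in> T"
        using T_add T_diff inc[OF inv] by (metis diff_add_cancel)
      then show ?case using hc by (simp add: a_minus_def a_inv_def)
    next
      case (eng g h)
      have "frag_of (?one, g \<oplus>\<^bsub>M\<^esub> h) - frag_of (?one, g) - frag_of (?one, h) \<in> T"
        using eng coset_in by (intro T_right) auto
      from T_add[OF T_add[OF this] ] eng show ?case by force
    qed
    then show ?thesis ..
  qed
  have T_K: "y \<ominus>\<^bsub>M\<^esub> z \<in> ?K" if y: "y \<in> carrier M" and z: "z \<in> carrier M"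
    and T: "frag_of (?one, y) - frag_of (?one, z) \<in> T" for y z
  proof -
    \<comment> \<open>An arbitrary choice of representatives. Two representatives of a coset differ
      by an element of \<open>I\<close>, so \<open>(X, w) \<mapsto> \<rho>(X) w\<close> is bilinear
      modulo \<open>I M\<close>, and \<open>T_finsum\<close> turns it into the inverse of
      \<open>w \<mapsto> 1 \<otimes> w\<close>.\<close>
    define \<rho> where "\<rho> X = (SOME r. r \<in> X)" for X :: "'a set"
    have \<rho>: "\<rho> X \<in> carrier R" "I +> \<rho> X = X" if X: "X \<in> carrier ?Q" for X
    proof -
      obtain r where r: "r \<in> carrier R" "X = I +> r" using X by (auto simp: FactRing_def A_RCOSETS_def')
      have "\<rho> X \<in> X" unfolding \<rho>_def r(2) some_in_eq using I.a_rcos_self[OF r(1)] by auto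
      then show "\<rho> X \<in> carrier R" "I +> \<rho> X = X"
        unfolding r(2) using I.a_repr_independence'[OF _ r(1)] I.a_elemrcos_carrier r(1) by blast+
    qed
    let ?F = "\<lambda>p. \<rho> (fst p) \<odot>\<^bsub>M\<^esub> snd p"
    have F: "?F \<in> S \<rightarrow> carrier M" using \<rho> by auto
    have IK: "r \<odot>\<^bsub>M\<^esub> w \<in> ?K" if "r \<in> I" "w \<in> carrier M" for r w
      unfolding ideal_smult_def using that by (auto intro: generate.incl)
    have diffI: "a \<ominus> b \<in> I" if "a \<in> carrier R" "b \<in> carrier R" "I +> a = I +> b" for a b
    proof -
      have "a \<in> I +> b" using I.a_rcos_self[OF that(1)] that(3) by simp
      then obtain i where "i \<in> I" "a = i \<oplus> b" by (auto simp: a_r_coset_def')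
      then show ?thesis using that I.a_Hcarr by (simp add: a_minus_def R.a_assoc R.r_neg)
    qed
    have "frag_sum M ?F (frag_of (?one, y) - frag_of (?one, z)) \<in> ?K"
    proof (rule T_finsum[OF M.abelian_group_axioms F K _ _ _ T])
      fix X X' w assume X: "X \<in> carrier ?Q" "X' \<in> carrier ?Q" and w: "w \<in> carrier M"
      have c: "X \<oplus>\<^bsub>?Q\<^esub> X' \<in> carrier ?Q" using X by (rule Q.M.a_closed)
      have "I +> \<rho> (X \<oplus>\<^bsub>?Q\<^esub> X') = I +> (\<rho> X \<oplus> \<rho> X')"
        using I.a_rcos_sum[of "\<rho> X" "\<rho> X'"] \<rho>[OF c] \<rho>[OF X(1)] \<rho>[OF X(2)] by (simp add: FactRing_def)
      then have "(\<rho> (X \<oplus>\<^bsub>?Q\<^esub> X') \<ominus> (\<rho> X \<oplus> \<rho> X')) \<odot>\<^bsub>M\<^esub> w \<in> ?K"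
        using \<rho>[OF c] \<rho>[OF X(1)] \<rho>[OF X(2)] w by (intro IK diffI) auto
      then show "?F (X \<oplus>\<^bsub>?Q\<^esub> X', w) \<ominus>\<^bsub>M\<^esub> ?F (X, w) \<ominus>\<^bsub>M\<^esub> ?F (X', w) \<in> ?K"
        using \<rho>[OF c] \<rho>[OF X(1)] \<rho>[OF X(2)] w
        by (simp add: a_minus_def smult_l_distr smult_l_minus minus_add M.a_assoc)
    next
      fix X w w' assume X: "X \<in> carrier ?Q" and w: "w \<in> carrier M" "w' \<in> carrier M"
      show "?F (X, w \<oplus>\<^bsub>M\<^esub> w') \<ominus>\<^bsub>M\<^esub> ?F (X, w) \<ominus>\<^bsub>M\<^esub> ?F (X, w') \<in> ?K"
        using \<rho>[OF X] w subgroup.one_closed[OF K] by (simp add: smult_r_distr M.add_minus_minus)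
    next
      fix r X w assume r: "r \<in> carrier R" and X: "X \<in> carrier ?Q" and w: "w \<in> carrier M"
      have c: "r \<odot>\<^bsub>?Q\<^esub> X \<in> carrier ?Q" using r X by (rule Q.smult_closed)
      have "I +> \<rho> (r \<odot>\<^bsub>?Q\<^esub> X) = I +> (r \<otimes> \<rho> X)"
        using I.rcoset_mult_add[OF r, of "\<rho> X"] \<rho>[OF c] \<rho>[OF X] by (simp add: FactRing_def)
      then have "(\<rho> (r \<odot>\<^bsub>?Q\<^esub> X) \<ominus> r \<otimes> \<rho> X) \<odot>\<^bsub>M\<^esub> w \<in> ?K"
        using \<rho>[OF c] \<rho>[OF X] w r by (intro IK diffI) auto
      then show "?F (r \<odot>\<^bsub>?Q\<^esub> X, w) \<ominus>\<^bsub>M\<^esub> ?F (X, r \<odot>\<^bsub>M\<^esub> w) \<in> ?K"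
        using \<rho>[OF c] \<rho>[OF X] w r
        by (simp add: a_minus_def smult_l_distr smult_l_minus smult_assoc1 smult_lcomm[of r])
    qed
    moreover have "frag_sum M ?F (frag_of (?one, y) - frag_of (?one, z)) = \<rho> ?one \<odot>\<^bsub>M\<^esub> y \<ominus>\<^bsub>M\<^esub> \<rho> ?one \<odot>\<^bsub>M\<^esub> z"
      using M.frag_hom_diff[OF M.frag_sum_hom(1)[OF F], of "frag_of (?one, y)" "frag_of (?one, z)"]
        M.frag_sum_hom(2)[OF F, of "(?one, y)"] M.frag_sum_hom(2)[OF F, of "(?one, z)"] y z coset_in
      by simp
    moreover have one_in: "?one \<in> carrier ?Q" using coset_in by simp
    ultimately have 1: "\<rho> ?one \<odot>\<^bsub>M\<^esub> (y \<ominus>\<^bsub>M\<^esub> z) \<in> ?K"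
      using \<rho>[OF one_in] y z by (simp add: a_minus_def smult_r_distr smult_r_minus)
    \<comment> \<open>The representative chosen for the coset of 1 may differ from 1. The difference
      lies in \<open>I\<close>, so the correction is again in \<open>I M\<close>.\<close>
    have 2: "(\<one> \<ominus> \<rho> ?one) \<odot>\<^bsub>M\<^esub> (y \<ominus>\<^bsub>M\<^esub> z) \<in> ?K"
      using \<rho>[OF one_in] y z by (intro IK diffI) auto
    have "(\<one> \<ominus> \<rho> ?one) \<odot>\<^bsub>M\<^esub> (y \<ominus>\<^bsub>M\<^esub> z) \<oplus>\<^bsub>M\<^esub> \<rho> ?one \<odot>\<^bsub>M\<^esub> (y \<ominus>\<^bsub>M\<^esub> z) = y \<ominus>\<^bsub>M\<^esub> z"
      using \<rho>(1)[OF one_in] y z by (simp flip: smult_l_distr) (simp add: a_minus_def R.a_assoc R.l_neg)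
    then show ?thesis using subgroup.m_closed[OF K 2 1] by simp
  qed
  show ?thesis
  proof (intro iffI ballI)
    fix y assume y: "y \<in> carrier M"
      and *: "\<forall>x\<in>carrier (tensor R ?Q M). tensor_induced R ?Q M f x = x [^]\<^bsub>tensor R ?Q M\<^esub> n"
    have "T +>\<^bsub>P\<^esub> frag_of (?one, y) \<in> carrier (tensor R ?Q M)"
      unfolding carrier_tensor using keys_frag[of "(?one, y)" S] y coset_in by auto
    then have "T +>\<^bsub>P\<^esub> frag_of (?one, f y) = T +>\<^bsub>P\<^esub> frag_of (?one, y [^]\<^bsub>M\<^esub> n)"
      using * induced tensor_pow[OF y, of n] one by metis
    then show "f y \<ominus>\<^bsub>M\<^esub> y [^]\<^bsub>M\<^esub> n \<in> ?K" unfolding coset_eq_iff using fc y by (intro T_K) auto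
  next
    fix x assume x: "x \<in> carrier (tensor R ?Q M)" and *: "\<forall>y\<in>carrier M. f y \<ominus>\<^bsub>M\<^esub> y [^]\<^bsub>M\<^esub> n \<in> ?K"
    obtain c where c: "Poly_Mapping.keys c \<subseteq> S" "x = T +>\<^bsub>P\<^esub> c" using x unfolding carrier_tensor by blast
    obtain y where y: "y \<in> carrier M" "c - frag_of (?one, y) \<in> T" using normal[OF c(1)] by blast
    have x_eq: "x = T +>\<^bsub>P\<^esub> frag_of (?one, y)" using y c by (simp add: coset_eq_iff)
    have "frag_of (?one, f y \<ominus>\<^bsub>M\<^esub> y [^]\<^bsub>M\<^esub> n) - (frag_of (?one, f y) - frag_of (?one, y [^]\<^bsub>M\<^esub> n)) \<in> T"
      using coset_in y fc by (intro T_right_diff) auto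
    from T_diff[OF K_T[OF bspec[OF * y(1)]] this]
    have "frag_of (?one, f y) - frag_of (?one, y [^]\<^bsub>M\<^esub> n) \<in> T" by simp
    then have "T +>\<^bsub>P\<^esub> frag_of (?one, f y) = T +>\<^bsub>P\<^esub> frag_of (?one, y [^]\<^bsub>M\<^esub> n)" by (simp add: coset_eq_iff)
    then show "tensor_induced R ?Q M f x = x [^]\<^bsub>tensor R ?Q M\<^esub> n"
      using induced tensor_pow[OF y(1), of n] one unfolding x_eq by metis
  qed
qed

section \<open>Frobenius in residue characteristic\<close>

lemma (in cring) binomial_expansion:
  assumes x: "x \<in> carrier R" and y: "y \<in> carrier R"
  shows "(x \<oplus> y) [^] (n::nat) = (\<Oplus>k\<in>{..n}. [(n choose k)] \<cdot> (x [^] k \<otimes> y [^] (n - k)))"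
proof (induction n)
  case 0
  then show ?case by simp
next
  case (Suc n)
  let ?f = "\<lambda>n k. [(n choose k)] \<cdot> (x [^] k \<otimes> y [^] (n - k))"
  have c: "?f m k \<in> carrier R" for m k using x y by simp
  let ?S = "\<Oplus>k\<in>{..n}. ?f n k"
  have S: "?S \<in> carrier R" using c by (intro finsum_closed) auto
  have step: "?f (Suc n) (Suc k) = x \<otimes> ?f n k \<oplus> y \<otimes> ?f n (Suc k)" if "k \<le> n" for k
  proof -
    \<comment> \<open>At \<open>k = n\<close> the truncated exponent \<open>n - Suc k\<close> breaks
      the recursion, but there the binomial coefficient is 0.\<close>
    have "y \<otimes> ?f n (Suc k) = [(n choose Suc k)] \<cdot> (x [^] Suc k \<otimes> y [^] (n - k))"
    proof (cases "k = n")
      case False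
      then have "y [^] (n - k) = y [^] Suc (n - Suc k)" using that by (simp add: Suc_diff_Suc)
      also have "\<dots> = y [^] (n - Suc k) \<otimes> y" by simp
      finally have "y [^] (n - k) = y [^] (n - Suc k) \<otimes> y" .
      then show ?thesis using x y by (simp add: add_pow_rdistr m_ac del: nat_pow_Suc)
    qed (use x y in \<open>simp add: binomial_eq_0\<close>)
    moreover have "x \<otimes> ?f n k = [(n choose k)] \<cdot> (x [^] Suc k \<otimes> y [^] (n - k))"
      using x y by (simp add: add_pow_rdistr m_ac)
    ultimately show ?thesis
      using x y by (simp add: add.nat_pow_mult add.m_comm del: nat_pow_Suc)
  qed
  have "(\<Oplus>k\<in>{..Suc n}. ?f (Suc n) k) = (\<Oplus>k\<in>{..n}. ?f (Suc n) (Suc k)) \<oplus> ?f (Suc n) 0"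
    using c by (intro finsum_Suc2) auto
  also have "(\<Oplus>k\<in>{..n}. ?f (Suc n) (Suc k)) = (\<Oplus>k\<in>{..n}. x \<otimes> ?f n k \<oplus> y \<otimes> ?f n (Suc k))"
    using c x y step by (intro finsum_cong') auto
  also have "\<dots> = (\<Oplus>k\<in>{..n}. x \<otimes> ?f n k) \<oplus> (\<Oplus>k\<in>{..n}. y \<otimes> ?f n (Suc k))"
    using c x y by (intro finsum_addf) auto
  also have "(\<Oplus>k\<in>{..n}. x \<otimes> ?f n k) = x \<otimes> ?S"
    using c x by (intro finsum_rdistr[symmetric]) auto
  also have "(\<Oplus>k\<in>{..n}. y \<otimes> ?f n (Suc k)) = y \<otimes> (\<Oplus>k\<in>{..n}. ?f n (Suc k))"
    using x y by (intro finsum_rdistr[symmetric]) auto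
  also have "?f (Suc n) 0 = y \<otimes> ?f n 0" using x y by (simp add: m_comm)
  also have "x \<otimes> ?S \<oplus> y \<otimes> (\<Oplus>k\<in>{..n}. ?f n (Suc k)) \<oplus> y \<otimes> ?f n 0
      = x \<otimes> ?S \<oplus> y \<otimes> ((\<Oplus>k\<in>{..n}. ?f n (Suc k)) \<oplus> ?f n 0)"
    using c S x y finsum_closed[of "\<lambda>k. ?f n (Suc k)" "{..n}"] by (simp add: r_distr a_assoc Pi_def)
  also have "(\<Oplus>k\<in>{..n}. ?f n (Suc k)) \<oplus> ?f n 0 = (\<Oplus>k\<in>{..Suc n}. ?f n k)"
    using c by (intro finsum_Suc2[symmetric]) auto
  also have "\<dots> = ?f n (Suc n) \<oplus> ?S" using c by (intro finsum_Suc) auto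
  also have "\<dots> = ?S" using S x y by (simp add: binomial_eq_0)
  finally show ?case using Suc S x y by (simp add: l_distr m_comm r_distr)
qed

text \<open>The inner binomial coefficients are divisible by \<open>p\<close>. The error is recorded
  as \<open>p\<close> times an element of the ring itself, so that for a subring \<open>U\<close> it
  lies in \<open>p U\<close>, which is stronger than divisibility by \<open>p\<close> in the ambient
  ring.\<close>

lemma (in cring) prime_power_sum:
  assumes p: "prime (p::nat)" and x: "x \<in> carrier R" and y: "y \<in> carrier R"
  shows "\<exists>z\<in>carrier R. (x \<oplus> y) [^] p = x [^] p \<oplus> y [^] p \<oplus> [p] \<cdot> z"
proof -
  let ?f = "\<lambda>k. [(p choose k)] \<cdot> (x [^] k \<otimes> y [^] (p - k))"
  let ?g = "\<lambda>k. [((p choose k) div p)] \<cdot> (x [^] k \<otimes> y [^] (p - k))"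
  have p2: "p \<ge> 2" using p prime_ge_2_nat by blast
  have c: "?f k \<in> carrier R" "?g k \<in> carrier R" for k using x y by auto
  have fg: "?f k = [p] \<cdot> ?g k" if "k \<in> {0<..<p}" for k
  proof -
    have "p dvd p choose k" using that p by (intro dvd_choose_prime) auto
    then have "[(p choose k)] \<cdot> w = [p] \<cdot> ([((p choose k) div p)] \<cdot> w)" if "w \<in> carrier R" for w
      using that add.nat_pow_pow[of w p "(p choose k) div p"] by simp
    then show ?thesis using x y by simp
  qed
  let ?Z = "\<Oplus>k\<in>{0<..<p}. ?g k"
  have Z: "?Z \<in> carrier R" using c by (intro finsum_closed) auto
  have mid: "(\<Oplus>k\<in>{0<..<p}. ?f k) = [p] \<cdot> ?Z"
  proof -
    have "(\<Oplus>k\<in>A. ?f k) = [p] \<cdot> (\<Oplus>k\<in>A. ?g k)" if "finite A" "A \<subseteq> {0<..<p}" for A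
      using that
    proof (induction A rule: finite_induct)
      case (insert k A)
      have "(\<Oplus>k\<in>insert k A. ?f k) = ?f k \<oplus> (\<Oplus>k\<in>A. ?f k)"
        using insert.hyps c by (intro finsum_insert) auto
      also have "\<dots> = [p] \<cdot> ?g k \<oplus> [p] \<cdot> (\<Oplus>k\<in>A. ?g k)"
        using insert fg[of k] by simp
      also have "\<dots> = [p] \<cdot> (?g k \<oplus> (\<Oplus>k\<in>A. ?g k))"
        using c by (intro add.nat_pow_distrib[symmetric] finsum_closed) auto
      also have "?g k \<oplus> (\<Oplus>k\<in>A. ?g k) = (\<Oplus>k\<in>insert k A. ?g k)"
        using insert.hyps c by (intro finsum_insert[symmetric]) auto
      finally show ?case .
    qed simp
    then show ?thesis by simp
  qed
  have "{..p} = insert 0 (insert p {0<..<p})" using p2 by auto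
  then have "(x \<oplus> y) [^] p = (\<Oplus>k\<in>insert 0 (insert p {0<..<p}). ?f k)"
    using binomial_expansion[OF x y, of p] by simp
  also have "\<dots> = ?f 0 \<oplus> (?f p \<oplus> (\<Oplus>k\<in>{0<..<p}. ?f k))"
    using c p2 x y by (subst finsum_insert; (subst finsum_insert)?) auto
  also have "\<dots> = x [^] p \<oplus> y [^] p \<oplus> [p] \<cdot> ?Z"
    unfolding mid using x y Z by (simp add: a_ac)
  finally show ?thesis using Z by blast
qed

lemma (in cring) prime_power_sum_iterate:
  assumes p: "prime (p::nat)" and x: "x \<in> carrier R" and y: "y \<in> carrier R"
  shows "\<exists>z\<in>carrier R. (x \<oplus> y) [^] (p ^ n) = x [^] (p ^ n) \<oplus> y [^] (p ^ n) \<oplus> [p] \<cdot> z"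
proof (induction n)
  case 0
  show ?case using x y by (intro bexI[of _ \<zero>]) auto
next
  case (Suc n)
  then obtain z where z: "z \<in> carrier R" "(x \<oplus> y) [^] (p ^ n) = x [^] (p ^ n) \<oplus> y [^] (p ^ n) \<oplus> [p] \<cdot> z" by blast
  let ?a = "x [^] (p ^ n)" and ?b = "y [^] (p ^ n)"
  have pw: "w [^] (p ^ Suc n) = (w [^] (p ^ n)) [^] p" if "w \<in> carrier R" for w
    using that by (simp add: nat_pow_pow mult.commute)
  obtain u where u: "u \<in> carrier R" "(?a \<oplus> ?b) [^] p = ?a [^] p \<oplus> ?b [^] p \<oplus> [p] \<cdot> u"
    using prime_power_sum[OF p, of ?a ?b] x y by auto
  obtain v where v: "v \<in> carrier R"
    "(?a \<oplus> ?b \<oplus> [p] \<cdot> z) [^] p = (?a \<oplus> ?b) [^] p \<oplus> ([p] \<cdot> z) [^] p \<oplus> [p] \<cdot> v"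
    using prime_power_sum[OF p, of "?a \<oplus> ?b" "[p] \<cdot> z"] x y z by auto
  \<comment> \<open>The error of the previous stage is itself raised to the power \<open>p\<close>;
    it stays a multiple of \<open>p\<close> because the exponent is positive.\<close>
  have "\<exists>w\<in>carrier R. ([p] \<cdot> z) [^] p = [p] \<cdot> w"
  proof -
    obtain k where "p = Suc k" using prime_gt_0_nat[OF p] gr0_conv_Suc by blast
    then have "([p] \<cdot> z) [^] p = ([p] \<cdot> z) [^] k \<otimes> ([p] \<cdot> z)" by (metis nat_pow_Suc)
    also have "\<dots> = [p] \<cdot> (([p] \<cdot> z) [^] k \<otimes> z)" using z by (intro add_pow_rdistr) auto
    finally show ?thesis by (rule bexI) (use z in simp)
  qed
  then obtain w where w: "w \<in> carrier R" "([p] \<cdot> z) [^] p = [p] \<cdot> w" by blast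
  have "(x \<oplus> y) [^] (p ^ Suc n) = (?a \<oplus> ?b \<oplus> [p] \<cdot> z) [^] p"
    using x y z pw[of "x \<oplus> y"] by simp
  also have "\<dots> = ?a [^] p \<oplus> ?b [^] p \<oplus> ([p] \<cdot> u \<oplus> [p] \<cdot> w \<oplus> [p] \<cdot> v)"
    unfolding v(2) w(2) u(2) using x y u w v by (simp add: a_assoc)
  also have "[p] \<cdot> u \<oplus> [p] \<cdot> w \<oplus> [p] \<cdot> v = [p] \<cdot> (u \<oplus> w \<oplus> v)"
    using u w v by (simp add: add.nat_pow_distrib)
  finally show ?case using u v w x y pw[OF x] pw[OF y] by (intro bexI[of _ "u \<oplus> w \<oplus> v"]) auto
qed

section \<open>Finite residue fields\<close>

text \<open>By Sylow, a prime \<open>l\<close> dividing the order is the order of an additive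
  subgroup. A nonzero \<open>h\<close> in it satisfies \<open>l h = 0\<close>, and cancelling
  \<open>h\<close> gives \<open>l 1 = 0\<close>. Two different such primes would yield
  \<open>1 = 0\<close> by Bezout, so the order is a power of one prime.\<close>

lemma (in field) finite_field_card:
  assumes fin: "finite (carrier R)"
  obtains p n where "prime (p::nat)" "card (carrier R) = p ^ n" "[p] \<cdot> \<one> = \<zero>"
proof -
  have char: "[l] \<cdot> \<one> = \<zero>" if l: "prime (l::nat)" "l dvd card (carrier R)" for l
  proof -
    obtain m where m: "card (carrier R) = l * m" using l by blast
    have "\<exists>H. subgroup H (add_monoid R) \<and> card H = l ^ 1"
      by (rule sylow_thm[OF l(1) a_group, of 1 m]) (use m fin in \<open>auto simp: order_def\<close>)
    then obtain H where H: "subgroup H (add_monoid R)" "card H = l" by auto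
    have "\<exists>h\<in>H. h \<noteq> \<zero>"
    proof (rule ccontr)
      assume "\<not> ?thesis"
      then have "H \<subseteq> {\<zero>}" by blast
      then have "card H \<le> 1" using card_mono[of "{\<zero>}" H] by simp
      then show False using H(2) prime_ge_2_nat[OF l(1)] by simp
    qed
    then obtain h where h: "h \<in> H" "h \<noteq> \<zero>" by blast
    have hc: "h \<in> carrier R" using subgroup.subset[OF H(1)] h by auto
    interpret H: group "(add_monoid R)\<lparr>carrier := H\<rparr>"
      using subgroup.subgroup_is_group[OF H(1) a_group] .
    have "h [^]\<^bsub>(add_monoid R)\<lparr>carrier := H\<rparr>\<^esub> l = \<zero>"
      using H.pow_order_eq_1[of h] h H by (simp add: order_def)
    then have "[l] \<cdot> h = \<zero>" by (simp add: add_pow_def nat_pow_def)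
    then have "([l] \<cdot> \<one>) \<otimes> h = \<zero>" using hc by (simp add: add_pow_ldistr)
    then show ?thesis using integral[of "[l] \<cdot> \<one>" h] h hc by simp
  qed
  have "card (carrier R) \<ge> 2"
    using card_mono[OF fin, of "{\<zero>, \<one>}"] by simp
  then obtain p where p: "prime p" "p dvd card (carrier R)"
    using prime_factor_nat[of "card (carrier R)"] by auto
  have uniq: "l = p" if l: "prime l" "l dvd card (carrier R)" for l
  proof (rule ccontr)
    assume "l \<noteq> p"
    then have "coprime l p" using l p primes_coprime by blast
    then obtain a b where ab: "a * l = b * p + 1"
      using bezout_nat[of l p] prime_gt_0_nat[OF l(1)] by (auto simp: coprime_iff_gcd_eq_1 mult.commute)
    have "[(a * l)] \<cdot> \<one> = [a] \<cdot> ([l] \<cdot> \<one>)" using add.nat_pow_pow[of \<one> a l] by (simp add: mult.commute)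
    then have 1: "[(a * l)] \<cdot> \<one> = \<zero>" using char[OF l] by simp
    have "[(b * p)] \<cdot> \<one> = [b] \<cdot> ([p] \<cdot> \<one>)" using add.nat_pow_pow[of \<one> b p] by (simp add: mult.commute)
    then have 2: "[(b * p)] \<cdot> \<one> = \<zero>" using char[OF p] by simp
    have "[(b * p + 1)] \<cdot> \<one> = [(b * p)] \<cdot> \<one> \<oplus> \<one>" by (simp flip: add.nat_pow_mult)
    then show False using 1 2 ab by simp
  qed
  have nz: "card (carrier R) \<noteq> 0" using \<open>2 \<le> card (carrier R)\<close> by simp
  have "prime_factors (card (carrier R)) = {p}"
  proof (rule Set.set_eqI)
    fix l
    show "l \<in> prime_factors (card (carrier R)) \<longleftrightarrow> l \<in> {p}"
      using uniq[of l] p nz by (metis in_prime_factors_iff singleton_iff)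
  qed
  then have "card (carrier R) = p ^ multiplicity p (card (carrier R))"
    using prime_factorization_nat[of "card (carrier R)"] nz by simp
  then show ?thesis by (rule that[OF p(1) _ char[OF p]])
qed

text \<open>For nonzero \<open>x\<close> this is Lagrange's theorem in the multiplicative group,
  whose order is one less than that of the field.\<close>

lemma (in field) finite_field_frobenius:
  assumes fin: "finite (carrier R)" and x: "x \<in> carrier R"
  shows "x [^] card (carrier R) = x"
proof (cases "x = \<zero>")
  case True
  have "card (carrier R) \<noteq> 0" using fin x by auto
  then show ?thesis using True by (simp add: nat_pow_zero)
next
  case False
  interpret M: group "Multiplicative_Group.mult_of R" by (rule field_mult_group)
  have "x [^]\<^bsub>Multiplicative_Group.mult_of R\<^esub> order (Multiplicative_Group.mult_of R) = \<one>\<^bsub>Multiplicative_Group.mult_of R\<^esub>"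
    using False x by (intro M.pow_order_eq_1) auto
  then have "x [^] (card (carrier R) - 1) = \<one>"
    using order_mult_of[OF fin] by (simp add: Multiplicative_Group.nat_pow_mult_of order_def)
  moreover have "card (carrier R) = Suc (card (carrier R) - 1)" using fin x by (metis Suc_diff_1 card_gt_0_iff empty_iff)
  ultimately show ?thesis using x by (metis l_one nat_pow_Suc)
qed

lemma zero_FactRing: "\<zero>\<^bsub>R Quot I\<^esub> = I"
  by (simp add: FactRing_def)

text \<open>The facts about \<open>q\<close> that make the \<open>q\<close>-th power additive and
  linear modulo the ideal, in a form that covers the unit ideal as well.\<close>

lemma (in cring) supramaximal_residue:
  assumes "supramaximal R I" and q: "q = card (carrier (R Quot I))"
  obtains p n where "prime (p::nat)" "q = p ^ n" "[p] \<cdot> \<one> \<in> I" "\<And>r. r \<in> carrier R \<Longrightarrow> r [^] q \<ominus> r \<in> I"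
proof -
  interpret ideal I R using assms by (simp add: supramaximal_def)
  show ?thesis
  proof (cases "I = carrier R")
    case True
    have "carrier (R Quot I) = {carrier R}"
    proof -
      have "I +> r = carrier R" if "r \<in> carrier R" for r
        using a_rcos_const[of r] that True by simp
      then have "(\<Union>r\<in>carrier R. {I +> r}) = {carrier R}" by auto
      then show ?thesis by (simp add: FactRing_def A_RCOSETS_def')
    qed
    \<comment> \<open>For the unit ideal the quotient has one element, so \<open>q = 1\<close>. The
      prime 2 with exponent 0 is an arbitrary choice, and the memberships in \<open>I\<close> are
      trivial.\<close>
    then have "q = 2 ^ 0" using q by simp
    then show ?thesis using that[of 2 0] True by (auto simp: two_is_prime_nat)
  next
    case False
    then have F: "field (R Quot I)" and fin: "finite (carrier (R Quot I))"
      using assms by (auto simp: supramaximal_def)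
    interpret F: field "R Quot I" by (rule F)
    interpret h: ring_hom_cring R "R Quot I" "(+>) I" by (rule rcos_ring_hom_cring[OF is_cring])
    have zero: "r \<in> I" if "r \<in> carrier R" "I +> r = \<zero>\<^bsub>R Quot I\<^esub>" for r
    proof -
      show ?thesis using a_rcos_self[OF that(1)] unfolding that(2) zero_FactRing .
    qed
    obtain p n where pn: "prime p" "q = p ^ n" "[p] \<cdot>\<^bsub>R Quot I\<^esub> \<one>\<^bsub>R Quot I\<^esub> = \<zero>\<^bsub>R Quot I\<^esub>"
      using F.finite_field_card[OF fin] q by metis
    have "I +> [k] \<cdot> \<one> = [k] \<cdot>\<^bsub>R Quot I\<^esub> \<one>\<^bsub>R Quot I\<^esub>" for k :: nat
    proof (induction k)
      case 0
      show ?case using h.hom_zero by simp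
    next
      case (Suc k)
      show ?case using h.hom_add[of "[k] \<cdot> \<one>" \<one>] Suc h.hom_one by simp
    qed
    then have 1: "[p] \<cdot> \<one> \<in> I" using pn by (intro zero) auto
    have 2: "r [^] q \<ominus> r \<in> I" if r: "r \<in> carrier R" for r
    proof (rule zero)
      have "I +> r [^] k = (I +> r) [^]\<^bsub>R Quot I\<^esub> k" for k :: nat
      proof (induction k)
        case 0
        show ?case using h.hom_one by simp
      next
        case (Suc k)
        show ?case using h.hom_mult[of "r [^] k" r] Suc r by simp
      qed
      then have "I +> r [^] q = I +> r"
        using F.finite_field_frobenius[OF fin h.hom_closed[OF r]] q by simp
      then show "I +> (r [^] q \<ominus> r) = \<zero>\<^bsub>R Quot I\<^esub>" using r by (simp add: a_minus_def F.r_neg)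
    qed (use r in auto)
    show ?thesis by (rule that[OF pn(1,2) 1 2])
  qed
qed

section \<open>The ideal generated in a subring\<close>

lemma (in abelian_group) minus_add_left:
  "a \<in> carrier G \<Longrightarrow> b \<in> carrier G \<Longrightarrow> a \<ominus> (a \<oplus> b) = \<ominus> b"
  by (simp add: a_minus_def minus_add r_neg2)

section \<open>Elementary rules for Psi-rings and algebra maps\<close>

lemma is_psi_ringD:
  assumes "is_psi_ring R E B"
  shows "algebra R B"
    and "k \<in> NE E \<Longrightarrow> psi B k \<in> alg_hom R B B"
    and "k \<in> NE E \<Longrightarrow> x \<in> carrier B \<Longrightarrow> psi B k x \<in> carrier B"
    and "k \<in> NE E \<Longrightarrow> x \<in> carrier B \<Longrightarrow> y \<in> carrier B \<Longrightarrow> psi B k (x \<oplus>\<^bsub>B\<^esub> y) = psi B k x \<oplus>\<^bsub>B\<^esub> psi B k y"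
    and "k \<in> NE E \<Longrightarrow> x \<in> carrier B \<Longrightarrow> y \<in> carrier B \<Longrightarrow> psi B k (x \<otimes>\<^bsub>B\<^esub> y) = psi B k x \<otimes>\<^bsub>B\<^esub> psi B k y"
    and "k \<in> NE E \<Longrightarrow> psi B k \<one>\<^bsub>B\<^esub> = \<one>\<^bsub>B\<^esub>"
    and "k \<in> NE E \<Longrightarrow> r \<in> carrier R \<Longrightarrow> x \<in> carrier B \<Longrightarrow> psi B k (r \<odot>\<^bsub>B\<^esub> x) = r \<odot>\<^bsub>B\<^esub> psi B k x"
    and "x \<in> carrier B \<Longrightarrow> psi B 0 x = x"
    and "k \<in> NE E \<Longrightarrow> l \<in> NE E \<Longrightarrow> x \<in> carrier B \<Longrightarrow> psi B (k + l) x = psi B k (psi B l x)"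
  using assms unfolding is_psi_ring_def alg_hom_def ring_hom_def by (auto simp: Pi_iff)

lemma single_in_NE [simp]: "Poly_Mapping.single \<alpha> n \<in> NE E \<longleftrightarrow> n = 0 \<or> \<alpha> \<in> E"
  by (simp add: NE_def)

lemma zero_in_NE [simp]: "0 \<in> NE E"
  by (simp add: NE_def)

lemma add_in_NE: "k \<in> NE E \<Longrightarrow> l \<in> NE E \<Longrightarrow> k + l \<in> NE E"
  unfolding NE_def using Poly_Mapping.keys_add[of k l] by blast

lemma alg_homD:
  assumes "h \<in> alg_hom R A B"
  shows "x \<in> carrier A \<Longrightarrow> h x \<in> carrier B"
    and "x \<in> carrier A \<Longrightarrow> y \<in> carrier A \<Longrightarrow> h (x \<oplus>\<^bsub>A\<^esub> y) = h x \<oplus>\<^bsub>B\<^esub> h y"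
    and "x \<in> carrier A \<Longrightarrow> y \<in> carrier A \<Longrightarrow> h (x \<otimes>\<^bsub>A\<^esub> y) = h x \<otimes>\<^bsub>B\<^esub> h y"
    and "h \<one>\<^bsub>A\<^esub> = \<one>\<^bsub>B\<^esub>"
    and "r \<in> carrier R \<Longrightarrow> x \<in> carrier A \<Longrightarrow> h (r \<odot>\<^bsub>A\<^esub> x) = r \<odot>\<^bsub>B\<^esub> h x"
  using assms unfolding alg_hom_def ring_hom_def by auto

lemma alg_homI:
  assumes "\<And>x. x \<in> carrier A \<Longrightarrow> h x \<in> carrier B"
    and "\<And>x y. x \<in> carrier A \<Longrightarrow> y \<in> carrier A \<Longrightarrow> h (x \<oplus>\<^bsub>A\<^esub> y) = h x \<oplus>\<^bsub>B\<^esub> h y"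
    and "\<And>x y. x \<in> carrier A \<Longrightarrow> y \<in> carrier A \<Longrightarrow> h (x \<otimes>\<^bsub>A\<^esub> y) = h x \<otimes>\<^bsub>B\<^esub> h y"
    and "h \<one>\<^bsub>A\<^esub> = \<one>\<^bsub>B\<^esub>"
    and "\<And>r x. r \<in> carrier R \<Longrightarrow> x \<in> carrier A \<Longrightarrow> h (r \<odot>\<^bsub>A\<^esub> x) = r \<odot>\<^bsub>B\<^esub> h x"
  shows "h \<in> alg_hom R A B"
  using assms unfolding alg_hom_def ring_hom_def by auto

lemma alg_hom_ring_hom_cring:
  assumes "h \<in> alg_hom R A B" "algebra R A" "algebra R B"
  shows "ring_hom_cring A B h"
proof -
  interpret A: algebra R A by fact
  interpret B: algebra R B by fact
  show ?thesis
    by (intro ring_hom_cringI ring_hom_ringI2 A.M_cring B.M_cring cring.axioms(1))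
      (use assms(1) in \<open>auto simp: alg_hom_def\<close>)
qed

lemma alg_hom_minus:
  assumes h: "h \<in> alg_hom R A B" and A: "algebra R A" and B: "algebra R B"
    and x: "x \<in> carrier A" and y: "y \<in> carrier A"
  shows "h (x \<ominus>\<^bsub>A\<^esub> y) = h x \<ominus>\<^bsub>B\<^esub> h y"
proof -
  interpret A: algebra R A by fact
  interpret B: algebra R B by fact
  interpret h: ring_hom_cring A B h using h A B by (rule alg_hom_ring_hom_cring)
  show ?thesis using x y by (simp add: a_minus_def)
qed

lemma alg_hom_pow:
  assumes h: "h \<in> alg_hom R A B" and A: "algebra R A" and B: "algebra R B" and x: "x \<in> carrier A"
  shows "h (x [^]\<^bsub>A\<^esub> (n::nat)) = h x [^]\<^bsub>B\<^esub> n"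
proof -
  interpret A: algebra R A by fact
  interpret B: algebra R B by fact
  show ?thesis using x by (induction n) (simp_all add: alg_homD[OF h])
qed

section \<open>The subgroup I U and its stability\<close>

lemma (in algebra) ideal_smult_subgroup:
  assumes I: "ideal I R" and U: "U \<subseteq> carrier M"
  shows "subgroup (ideal_smult I U M) (add_monoid M)"
  unfolding ideal_smult_def
  by (rule M.add.generate_is_subgroup) (use U ideal.Icarr[OF I] in auto)

lemma ideal_smult_incl: "r \<in> I \<Longrightarrow> x \<in> U \<Longrightarrow> r \<odot>\<^bsub>M\<^esub> x \<in> ideal_smult I U M"
  unfolding ideal_smult_def by (rule generate.incl) auto

lemma (in algebra) ideal_smult_induct [consumes 3, case_names zero base minus add]:
  assumes I: "ideal I R" and U: "U \<subseteq> carrier M" and z: "z \<in> ideal_smult I U M"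
    and "P \<zero>\<^bsub>M\<^esub>" and base: "\<And>r x. r \<in> I \<Longrightarrow> x \<in> U \<Longrightarrow> P (r \<odot>\<^bsub>M\<^esub> x)"
    and minus: "\<And>y. y \<in> carrier M \<Longrightarrow> P y \<Longrightarrow> P (\<ominus>\<^bsub>M\<^esub> y)"
    and "\<And>y w. y \<in> carrier M \<Longrightarrow> w \<in> carrier M \<Longrightarrow> P y \<Longrightarrow> P w \<Longrightarrow> P (y \<oplus>\<^bsub>M\<^esub> w)"
  shows "P z"
proof -
  have c: "r \<odot>\<^bsub>M\<^esub> x \<in> carrier M" if "r \<in> I" "x \<in> U" for r x using that U ideal.Icarr[OF I] by auto
  have "P z \<and> z \<in> carrier M" using z unfolding ideal_smult_def
  proof (induction z rule: generate.induct)
    case (inv h)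
    then obtain r x where "h = r \<odot>\<^bsub>M\<^esub> x" "r \<in> I" "x \<in> U" by auto
    then show ?case using minus base c by (simp flip: a_inv_def)
  qed (use assms c in auto)
  then show ?thesis ..
qed

lemma (in algebra) ideal_smult_mono_hom:
  assumes I: "ideal I R" and U: "U \<subseteq> carrier M" and B: "algebra R B" and h: "h \<in> alg_hom R M B"
    and V: "V \<subseteq> carrier B" "h ` U \<subseteq> V"
    and z: "z \<in> ideal_smult I U M"
  shows "h z \<in> ideal_smult I V B"
proof -
  interpret B: algebra R B by fact
  note K = B.ideal_smult_subgroup[OF I V(1)]
  note hD = alg_homD[OF h]
  interpret h: ring_hom_cring M B h using h algebra_axioms B by (rule alg_hom_ring_hom_cring)
  show ?thesis using I U z
  proof (induction z rule: ideal_smult_induct)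
    case zero
    then show ?case using subgroup.one_closed[OF K] by simp
  next
    case (base r x)
    then show ?case using U V hD(5)[of r x] ideal.Icarr[OF I] ideal_smult_incl[of r I "h x" V] by (auto simp: subset_iff)
  next
    case (minus y)
    then show ?case using subgroup.m_inv_closed[OF K] by (simp flip: a_inv_def)
  next
    case (add y w)
    then show ?case using subgroup.m_closed[OF K] by simp
  qed
qed

lemma (in algebra) ideal_smult_subset:
  assumes I: "ideal I R" and U: "subring U M" "\<And>r x. r \<in> carrier R \<Longrightarrow> x \<in> U \<Longrightarrow> r \<odot>\<^bsub>M\<^esub> x \<in> U"
  shows "ideal_smult I U M \<subseteq> U"
proof
  fix z assume "z \<in> ideal_smult I U M"
  with I subringE(1)[OF U(1)] show "z \<in> U"
    by (induction z rule: ideal_smult_induct)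
      (use subringE[OF U(1)] U(2) ideal.Icarr[OF I] in auto)
qed

lemma (in algebra) ideal_smult_mult:
  assumes I: "ideal I R" and U: "subring U M" and u: "u \<in> U" and z: "z \<in> ideal_smult I U M"
  shows "z \<otimes>\<^bsub>M\<^esub> u \<in> ideal_smult I U M"
proof -
  note UD = subringE[OF U]
  note K = ideal_smult_subgroup[OF I UD(1)]
  have uc: "u \<in> carrier M" using u UD by auto
  show ?thesis using I UD(1) z
  proof (induction z rule: ideal_smult_induct)
    case zero
    then show ?case using subgroup.one_closed[OF K] uc by simp
  next
    case (base r x)
    then show ?case using u uc UD(1,6) ideal.Icarr[OF I] ideal_smult_incl[of r I "x \<otimes>\<^bsub>M\<^esub> u" U]
      by (auto simp: smult_assoc2 subset_iff)
  next
    case (minus y)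
    then show ?case using uc subgroup.m_inv_closed[OF K] by (simp add: l_minus flip: a_inv_def)
  next
    case (add y w)
    then show ?case using uc subgroup.m_closed[OF K] by (simp add: l_distr)
  qed
qed

lemma (in algebra) ideal_smult_smult:
  assumes I: "ideal I R" and U: "U \<subseteq> carrier M" "\<And>r x. r \<in> carrier R \<Longrightarrow> x \<in> U \<Longrightarrow> r \<odot>\<^bsub>M\<^esub> x \<in> U"
    and r: "r \<in> carrier R" and z: "z \<in> ideal_smult I U M"
  shows "r \<odot>\<^bsub>M\<^esub> z \<in> ideal_smult I U M"
proof -
  note K = ideal_smult_subgroup[OF I U(1)]
  show ?thesis using I U(1) z
  proof (induction z rule: ideal_smult_induct)
    case zero
    then show ?case using subgroup.one_closed[OF K] r by simp
  next
    case (base s x)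
    have "r \<odot>\<^bsub>M\<^esub> (s \<odot>\<^bsub>M\<^esub> x) = s \<odot>\<^bsub>M\<^esub> (r \<odot>\<^bsub>M\<^esub> x)"
      using r base U ideal.Icarr[OF I] by (intro smult_lcomm) auto
    then show ?case using base U r by (auto intro: ideal_smult_incl)
  next
    case (minus y)
    then show ?case using r subgroup.m_inv_closed[OF K] by (simp add: smult_r_minus flip: a_inv_def)
  next
    case (add y w)
    then show ?case using r subgroup.m_closed[OF K] by (simp add: smult_r_distr)
  qed
qed

section \<open>The Frobenius condition relative to a subalgebra\<close>

text \<open>The passage from one approximation to the next, for an arbitrary \<Psi>-ring in place of
  the ghost ring. Its iterates on the ghost ring are the approximations, and a \<Psi>-ring
  \<open>B\<close> is a \<Lambda>-ring when the step leaves \<open>carrier B\<close> unchanged, so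
  both notions can be compared through equivariant maps.\<close>

definition frob_step ::
  "('r, 'k) ring_scheme \<Rightarrow> 'e set \<Rightarrow> ('e \<Rightarrow> 'r set) \<Rightarrow> ('r, 'a, 'e, 'm) psi_ring_scheme \<Rightarrow> 'a set \<Rightarrow> 'a set"
where
  "frob_step R E \<mm> B U = {b \<in> U. \<forall>\<alpha>\<in>E.
     psi_at B \<alpha> b \<ominus>\<^bsub>B\<^esub> (b [^]\<^bsub>B\<^esub> residue_card R \<mm> \<alpha>) \<in> ideal_smult (\<mm> \<alpha>) U B}"

lemma nat_pow_carrier_update: "b [^]\<^bsub>B\<lparr>carrier := U\<rparr>\<^esub> (n::nat) = b [^]\<^bsub>B\<^esub> n"
  by (simp add: nat_pow_def)

lemma subring_cring:
  assumes "cring B" "subring U B"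
  shows "cring (B\<lparr>carrier := U\<rparr>)"
proof -
  interpret B: cring B by fact
  have "subcring U B" using assms(2) by (rule B.subcringI')
  then show ?thesis using B.subcring_iff subringE(1)[OF assms(2)] by blast
qed

lemma (in cring) subring_nat_pow_closed:
  assumes "subring U R" "x \<in> U"
  shows "x [^] (n::nat) \<in> U"
  using subringE[OF assms(1)] assms(2) by (induction n) auto

lemma (in cring) subring_minus_closed:
  assumes "subring U R" "x \<in> U" "y \<in> U"
  shows "x \<ominus> y \<in> U"
  using subringE[OF assms(1)] assms(2,3) by (simp add: a_minus_def)

text \<open>The ideal \<open>I U\<close> of \<open>U\<close> contains the error terms of \<open>x \<mapsto> x\<^sup>q\<close>, so that this map is
  \<open>R\<close>-linear modulo \<open>I U\<close>.\<close>

lemma (in algebra) frobenius_mod_ideal: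
  assumes smax: "supramaximal R I" and q: "q = card (carrier (R Quot I))"
    and U: "subring U M" "\<And>r x. r \<in> carrier R \<Longrightarrow> x \<in> U \<Longrightarrow> r \<odot>\<^bsub>M\<^esub> x \<in> U"
  shows "x \<in> U \<Longrightarrow> y \<in> U \<Longrightarrow>
      (x [^]\<^bsub>M\<^esub> q \<oplus>\<^bsub>M\<^esub> y [^]\<^bsub>M\<^esub> q) \<ominus>\<^bsub>M\<^esub> (x \<oplus>\<^bsub>M\<^esub> y) [^]\<^bsub>M\<^esub> q \<in> ideal_smult I U M"
    and "r \<in> carrier R \<Longrightarrow> x \<in> U \<Longrightarrow> r \<odot>\<^bsub>M\<^esub> x [^]\<^bsub>M\<^esub> q \<ominus>\<^bsub>M\<^esub> (r \<odot>\<^bsub>M\<^esub> x) [^]\<^bsub>M\<^esub> q \<in> ideal_smult I U M"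
proof -
  have I: "ideal I R" using smax by (simp add: supramaximal_def)
  obtain p n where p: "prime (p::nat)" "q = p ^ n" "[p] \<cdot> \<one> \<in> I"
    and fr: "\<And>r. r \<in> carrier R \<Longrightarrow> r [^] q \<ominus> r \<in> I"
    using R.supramaximal_residue[OF smax q] by metis
  note UD = subringE[OF U(1)]
  note K = ideal_smult_subgroup[OF I UD(1)]
  have Kinv: "\<ominus>\<^bsub>M\<^esub> w \<in> ideal_smult I U M" if "w \<in> ideal_smult I U M" for w
    using subgroup.m_inv_closed[OF K that] by (simp add: a_inv_def)
  show "(x [^]\<^bsub>M\<^esub> q \<oplus>\<^bsub>M\<^esub> y [^]\<^bsub>M\<^esub> q) \<ominus>\<^bsub>M\<^esub> (x \<oplus>\<^bsub>M\<^esub> y) [^]\<^bsub>M\<^esub> q \<in> ideal_smult I U M"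
    if xy: "x \<in> U" "y \<in> U"
  proof -
    \<comment> \<open>The expansion is carried out in the ring \<open>U\<close>, so that the
      cofactor \<open>z\<close> of \<open>p\<close> lies in \<open>U\<close>.\<close>
    interpret UR: cring "M\<lparr>carrier := U\<rparr>" using subring_cring[OF M_cring U(1)] .
    obtain z where z: "z \<in> U" and eq: "(x \<oplus>\<^bsub>M\<^esub> y) [^]\<^bsub>M\<^esub> q =
        x [^]\<^bsub>M\<^esub> q \<oplus>\<^bsub>M\<^esub> y [^]\<^bsub>M\<^esub> q \<oplus>\<^bsub>M\<^esub> [p] \<cdot>\<^bsub>M\<lparr>carrier := U\<rparr>\<^esub> z"
      using UR.prime_power_sum_iterate[OF p(1), of x y n] xy p(2) by (auto simp: nat_pow_carrier_update)
    have zc: "z \<in> carrier M" using z UD by auto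
    \<comment> \<open>An integer multiple of \<open>z\<close> is a scalar multiple, and for
      \<open>k = p\<close> the scalar lies in \<open>I\<close>.\<close>
    have "[k] \<cdot>\<^bsub>M\<lparr>carrier := U\<rparr>\<^esub> z = ([k] \<cdot> \<one>) \<odot>\<^bsub>M\<^esub> z" for k :: nat
      using zc by (induction k) (simp_all add: smult_l_distr add_pow_def nat_pow_def flip: add_pow_def)
    then have "[p] \<cdot>\<^bsub>M\<lparr>carrier := U\<rparr>\<^esub> z \<in> ideal_smult I U M"
      using ideal_smult_incl[OF p(3) z] by simp
    then have "\<ominus>\<^bsub>M\<^esub> ([p] \<cdot>\<^bsub>M\<lparr>carrier := U\<rparr>\<^esub> z) \<in> ideal_smult I U M" by (rule Kinv)
    moreover have "(x [^]\<^bsub>M\<^esub> q \<oplus>\<^bsub>M\<^esub> y [^]\<^bsub>M\<^esub> q) \<ominus>\<^bsub>M\<^esub> (x \<oplus>\<^bsub>M\<^esub> y) [^]\<^bsub>M\<^esub> q = \<ominus>\<^bsub>M\<^esub> ([p] \<cdot>\<^bsub>M\<lparr>carrier := U\<rparr>\<^esub> z)"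
    proof -
      have "[p] \<cdot>\<^bsub>M\<lparr>carrier := U\<rparr>\<^esub> z \<in> carrier M" using UR.add.nat_pow_closed[of z p] z UD(1) by auto
      moreover have "x \<in> carrier M" "y \<in> carrier M" using xy UD(1) by auto
      ultimately show ?thesis unfolding eq by (simp add: M.minus_add_left)
    qed
    ultimately show ?thesis by simp
  qed
  show "r \<odot>\<^bsub>M\<^esub> x [^]\<^bsub>M\<^esub> q \<ominus>\<^bsub>M\<^esub> (r \<odot>\<^bsub>M\<^esub> x) [^]\<^bsub>M\<^esub> q \<in> ideal_smult I U M"
    if r: "r \<in> carrier R" and x: "x \<in> U"
  proof -
    have xc: "x \<in> carrier M" using x UD by auto
    have pow: "(r \<odot>\<^bsub>M\<^esub> x) [^]\<^bsub>M\<^esub> k = r [^] k \<odot>\<^bsub>M\<^esub> x [^]\<^bsub>M\<^esub> k" for k :: nat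
    proof (induction k)
      case (Suc k)
      have "(r \<odot>\<^bsub>M\<^esub> x) [^]\<^bsub>M\<^esub> Suc k = (r [^] k \<odot>\<^bsub>M\<^esub> x [^]\<^bsub>M\<^esub> k) \<otimes>\<^bsub>M\<^esub> (r \<odot>\<^bsub>M\<^esub> x)" using Suc by simp
      also have "\<dots> = r [^] k \<odot>\<^bsub>M\<^esub> (x [^]\<^bsub>M\<^esub> k \<otimes>\<^bsub>M\<^esub> (r \<odot>\<^bsub>M\<^esub> x))"
        using r xc by (intro smult_assoc2) auto
      also have "x [^]\<^bsub>M\<^esub> k \<otimes>\<^bsub>M\<^esub> (r \<odot>\<^bsub>M\<^esub> x) = (r \<odot>\<^bsub>M\<^esub> x) \<otimes>\<^bsub>M\<^esub> x [^]\<^bsub>M\<^esub> k"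
        using r xc by (intro m_comm) auto
      also have "r [^] k \<odot>\<^bsub>M\<^esub> ((r \<odot>\<^bsub>M\<^esub> x) \<otimes>\<^bsub>M\<^esub> x [^]\<^bsub>M\<^esub> k) = r [^] Suc k \<odot>\<^bsub>M\<^esub> x [^]\<^bsub>M\<^esub> Suc k"
        using r xc by (simp add: smult_assoc1 smult_assoc2 m_comm[of x])
      finally show ?case .
    qed simp
    have "(r [^] q \<ominus> r) \<odot>\<^bsub>M\<^esub> x [^]\<^bsub>M\<^esub> q \<in> ideal_smult I U M"
      using fr[OF r] subring_nat_pow_closed[OF U(1) x] by (rule ideal_smult_incl)
    then have "\<ominus>\<^bsub>M\<^esub> ((r [^] q \<ominus> r) \<odot>\<^bsub>M\<^esub> x [^]\<^bsub>M\<^esub> q) \<in> ideal_smult I U M" by (rule Kinv)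
    moreover have "\<ominus>\<^bsub>M\<^esub> ((r [^] q \<ominus> r) \<odot>\<^bsub>M\<^esub> x [^]\<^bsub>M\<^esub> q) = r \<odot>\<^bsub>M\<^esub> x [^]\<^bsub>M\<^esub> q \<ominus>\<^bsub>M\<^esub> (r \<odot>\<^bsub>M\<^esub> x) [^]\<^bsub>M\<^esub> q"
      using r xc by (simp add: pow a_minus_def smult_l_distr smult_l_minus M.minus_add M.a_comm)
    ultimately show ?thesis by simp
  qed
qed

section \<open>The approximations of the Witt vectors\<close>

text \<open>In the application \<open>a\<close>, \<open>b\<close> are values of \<open>psi\<close>,
  \<open>c\<close>, \<open>d\<close> are \<open>q\<close>-th powers, and \<open>w\<close> is the
  \<open>q\<close>-th power of the sum. The defect at a sum is then the sum of the two defects and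
  the failure of the power to be additive.\<close>

lemma (in cring) add_error:
  "\<lbrakk>a \<in> carrier R; b \<in> carrier R; c \<in> carrier R; d \<in> carrier R; w \<in> carrier R\<rbrakk> \<Longrightarrow>
    (a \<oplus> b) \<ominus> w = (a \<ominus> c) \<oplus> (b \<ominus> d) \<oplus> ((c \<oplus> d) \<ominus> w)"
  by algebra

lemma (in cring) mult_error:
  "\<lbrakk>a \<in> carrier R; b \<in> carrier R; c \<in> carrier R; d \<in> carrier R\<rbrakk> \<Longrightarrow>
    a \<otimes> b \<ominus> c \<otimes> d = (a \<ominus> c) \<otimes> b \<oplus> (b \<ominus> d) \<otimes> c"
  by algebra

lemma (in cring) minus_split:
  "\<lbrakk>a \<in> carrier R; b \<in> carrier R; w \<in> carrier R\<rbrakk> \<Longrightarrow> a \<ominus> w = (a \<ominus> b) \<oplus> (b \<ominus> w)"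
  by algebra

lemma is_sub_psi_ringD:
  assumes "is_sub_psi_ring R E U B"
  shows "is_psi_ring R E B" "subring U B"
    and "r \<in> carrier R \<Longrightarrow> x \<in> U \<Longrightarrow> r \<odot>\<^bsub>B\<^esub> x \<in> U"
    and "k \<in> NE E \<Longrightarrow> x \<in> U \<Longrightarrow> psi B k x \<in> U"
  using assms by (auto simp: is_sub_psi_ring_def)

text \<open>Modulo the ideal \<open>\<mm> \<alpha> U\<close> of \<open>U\<close>, both
  \<open>psi_at B \<alpha>\<close> and the \<open>q\<close>-th power are \<open>R\<close>-algebra
  maps, and the elements on which two such maps agree form a subalgebra. It is stable under
  \<open>psi B k\<close>, which commutes with both maps and carries \<open>\<mm> \<alpha> U\<close>
  into itself.\<close>

lemma frob_step_sub_psi_ring: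
  fixes B :: "('r, 'a, 'e, 'm) psi_ring_scheme"
  assumes U: "is_sub_psi_ring R E U B" and smax: "\<And>\<alpha>. \<alpha> \<in> E \<Longrightarrow> supramaximal R (\<mm> \<alpha>)"
  shows "is_sub_psi_ring R E (frob_step R E \<mm> B U) B"
proof -
  note UD = is_sub_psi_ringD[OF U]
  note sub = subringE[OF UD(2)]
  note psi = is_psi_ringD[OF UD(1)]
  interpret B: algebra R B by (rule psi(1))
  have BC: "cring B" by (rule B.M_cring)
  let ?K = "\<lambda>\<alpha>. ideal_smult (\<mm> \<alpha>) U B"
  let ?q = "residue_card R \<mm>"
  let ?V = "frob_step R E \<mm> B U"
  have I: "ideal (\<mm> \<alpha>) R" if "\<alpha> \<in> E" for \<alpha> using smax[OF that] by (simp add: supramaximal_def)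
  have K: "subgroup (?K \<alpha>) (add_monoid B)" if "\<alpha> \<in> E" for \<alpha>
    using B.ideal_smult_subgroup[OF I[OF that] sub(1)] .
  have K0: "\<zero>\<^bsub>B\<^esub> \<in> ?K \<alpha>" if "\<alpha> \<in> E" for \<alpha> using subgroup.one_closed[OF K[OF that]] by simp
  have Kadd: "x \<oplus>\<^bsub>B\<^esub> y \<in> ?K \<alpha>" if "\<alpha> \<in> E" "x \<in> ?K \<alpha>" "y \<in> ?K \<alpha>" for \<alpha> x y
    using subgroup.m_closed[OF K[OF that(1)] that(2,3)] by simp
  have frob_add: "(x [^]\<^bsub>B\<^esub> ?q \<alpha> \<oplus>\<^bsub>B\<^esub> y [^]\<^bsub>B\<^esub> ?q \<alpha>) \<ominus>\<^bsub>B\<^esub> (x \<oplus>\<^bsub>B\<^esub> y) [^]\<^bsub>B\<^esub> ?q \<alpha> \<in> ?K \<alpha>"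
    if "\<alpha> \<in> E" "x \<in> U" "y \<in> U" for \<alpha> x y
    using smax[OF that(1)] residue_card_def UD(2,3) that(2,3) by (rule B.frobenius_mod_ideal(1))
  have frob_smult: "r \<odot>\<^bsub>B\<^esub> x [^]\<^bsub>B\<^esub> ?q \<alpha> \<ominus>\<^bsub>B\<^esub> (r \<odot>\<^bsub>B\<^esub> x) [^]\<^bsub>B\<^esub> ?q \<alpha> \<in> ?K \<alpha>"
    if "\<alpha> \<in> E" "r \<in> carrier R" "x \<in> U" for \<alpha> r x
    using smax[OF that(1)] residue_card_def UD(2,3) that(2,3) by (rule B.frobenius_mod_ideal(2))
  have Ksmult: "r \<odot>\<^bsub>B\<^esub> z \<in> ?K \<alpha>" if "\<alpha> \<in> E" "r \<in> carrier R" "z \<in> ?K \<alpha>" for \<alpha> r z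
    using I[OF that(1)] sub(1) UD(3) that(2,3) by (rule B.ideal_smult_smult)
  have UB: "x \<in> carrier B" if "x \<in> U" for x using that sub(1) by auto
  have s: "Poly_Mapping.single \<alpha> 1 \<in> NE E" if "\<alpha> \<in> E" for \<alpha> using that by simp
  have VU: "b \<in> U" if "b \<in> ?V" for b using that by (simp add: frob_step_def)
  have VK: "psi_at B \<alpha> b \<ominus>\<^bsub>B\<^esub> b [^]\<^bsub>B\<^esub> ?q \<alpha> \<in> ?K \<alpha>" if "b \<in> ?V" "\<alpha> \<in> E" for b \<alpha>
    using that by (simp add: frob_step_def)
  have VI: "b \<in> ?V" if "b \<in> U" "\<And>\<alpha>. \<alpha> \<in> E \<Longrightarrow> psi_at B \<alpha> b \<ominus>\<^bsub>B\<^esub> b [^]\<^bsub>B\<^esub> ?q \<alpha> \<in> ?K \<alpha>" for b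
    using that by (simp add: frob_step_def)
  have smult: "r \<odot>\<^bsub>B\<^esub> b \<in> ?V" if r: "r \<in> carrier R" and b: "b \<in> ?V" for r b
  proof (rule VI)
    show "r \<odot>\<^bsub>B\<^esub> b \<in> U" using UD(3) r VU[OF b] by blast
    fix \<alpha> assume \<alpha>: "\<alpha> \<in> E"
    have c: "b \<in> carrier B" "psi_at B \<alpha> b \<in> carrier B" using UB[OF VU[OF b]] psi(3)[OF s[OF \<alpha>]] by auto
    have "psi_at B \<alpha> (r \<odot>\<^bsub>B\<^esub> b) \<ominus>\<^bsub>B\<^esub> (r \<odot>\<^bsub>B\<^esub> b) [^]\<^bsub>B\<^esub> ?q \<alpha>
      = (r \<odot>\<^bsub>B\<^esub> psi_at B \<alpha> b \<ominus>\<^bsub>B\<^esub> r \<odot>\<^bsub>B\<^esub> b [^]\<^bsub>B\<^esub> ?q \<alpha>) \<oplus>\<^bsub>B\<^esub>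
        (r \<odot>\<^bsub>B\<^esub> b [^]\<^bsub>B\<^esub> ?q \<alpha> \<ominus>\<^bsub>B\<^esub> (r \<odot>\<^bsub>B\<^esub> b) [^]\<^bsub>B\<^esub> ?q \<alpha>)"
      unfolding psi(7)[OF s[OF \<alpha>] r c(1)] using r c by (intro cring.minus_split[OF BC]) auto
    also have "r \<odot>\<^bsub>B\<^esub> psi_at B \<alpha> b \<ominus>\<^bsub>B\<^esub> r \<odot>\<^bsub>B\<^esub> b [^]\<^bsub>B\<^esub> ?q \<alpha> = r \<odot>\<^bsub>B\<^esub> (psi_at B \<alpha> b \<ominus>\<^bsub>B\<^esub> b [^]\<^bsub>B\<^esub> ?q \<alpha>)"
      using r c by (simp add: a_minus_def B.smult_r_distr B.smult_r_minus)
    finally show "psi_at B \<alpha> (r \<odot>\<^bsub>B\<^esub> b) \<ominus>\<^bsub>B\<^esub> (r \<odot>\<^bsub>B\<^esub> b) [^]\<^bsub>B\<^esub> ?q \<alpha> \<in> ?K \<alpha>"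
      using Kadd[OF \<alpha> Ksmult[OF \<alpha> r VK[OF b \<alpha>]] frob_smult[OF \<alpha> r VU[OF b]]]
      by simp
  qed
  have "subring ?V B"
  proof (rule B.subringI)
    show "?V \<subseteq> carrier B" using VU UB by blast
    show "\<one>\<^bsub>B\<^esub> \<in> ?V"
    proof (rule VI)
      fix \<alpha> assume \<alpha>: "\<alpha> \<in> E"
      show "psi_at B \<alpha> \<one>\<^bsub>B\<^esub> \<ominus>\<^bsub>B\<^esub> \<one>\<^bsub>B\<^esub> [^]\<^bsub>B\<^esub> ?q \<alpha> \<in> ?K \<alpha>"
        using K0[OF \<alpha>] psi(6)[OF s[OF \<alpha>]] by (simp add: a_minus_def B.r_neg)
    qed (rule sub(3))
    fix b assume b: "b \<in> ?V"
    have bc: "b \<in> carrier B" using UB[OF VU[OF b]] .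
    \<comment> \<open>Negation is treated as scalar multiplication by -1, which avoids the sign of
      the \<open>q\<close>-th power of a negative.\<close>
    have "(\<ominus>\<^bsub>R\<^esub> \<one>\<^bsub>R\<^esub>) \<odot>\<^bsub>B\<^esub> b \<in> ?V" by (rule smult[OF _ b]) simp
    then show "\<ominus>\<^bsub>B\<^esub> b \<in> ?V" using bc by (simp add: B.smult_l_minus)
    fix c assume c: "c \<in> ?V"
    have cc: "c \<in> carrier B" using UB[OF VU[OF c]] .
    show "b \<otimes>\<^bsub>B\<^esub> c \<in> ?V"
    proof (rule VI)
      show "b \<otimes>\<^bsub>B\<^esub> c \<in> U" using sub(6) VU b c by blast
      fix \<alpha> assume \<alpha>: "\<alpha> \<in> E"
      have pc: "psi_at B \<alpha> b \<in> carrier B" "psi_at B \<alpha> c \<in> carrier B" using psi(3)[OF s[OF \<alpha>]] bc cc by auto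
      have "psi_at B \<alpha> (b \<otimes>\<^bsub>B\<^esub> c) \<ominus>\<^bsub>B\<^esub> (b \<otimes>\<^bsub>B\<^esub> c) [^]\<^bsub>B\<^esub> ?q \<alpha> =
        psi_at B \<alpha> b \<otimes>\<^bsub>B\<^esub> psi_at B \<alpha> c \<ominus>\<^bsub>B\<^esub> b [^]\<^bsub>B\<^esub> ?q \<alpha> \<otimes>\<^bsub>B\<^esub> c [^]\<^bsub>B\<^esub> ?q \<alpha>"
        using bc cc psi(5)[OF s[OF \<alpha>]] by (simp add: B.nat_pow_distrib)
      also have "\<dots> = (psi_at B \<alpha> b \<ominus>\<^bsub>B\<^esub> b [^]\<^bsub>B\<^esub> ?q \<alpha>) \<otimes>\<^bsub>B\<^esub> psi_at B \<alpha> c \<oplus>\<^bsub>B\<^esub>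
          (psi_at B \<alpha> c \<ominus>\<^bsub>B\<^esub> c [^]\<^bsub>B\<^esub> ?q \<alpha>) \<otimes>\<^bsub>B\<^esub> b [^]\<^bsub>B\<^esub> ?q \<alpha>"
        using bc cc pc by (intro cring.mult_error[OF BC]) auto
      finally show "psi_at B \<alpha> (b \<otimes>\<^bsub>B\<^esub> c) \<ominus>\<^bsub>B\<^esub> (b \<otimes>\<^bsub>B\<^esub> c) [^]\<^bsub>B\<^esub> ?q \<alpha> \<in> ?K \<alpha>"
        using Kadd[OF \<alpha> B.ideal_smult_mult[OF I[OF \<alpha>] UD(2) UD(4)[OF s[OF \<alpha>] VU[OF c]] VK[OF b \<alpha>]]
            B.ideal_smult_mult[OF I[OF \<alpha>] UD(2) cring.subring_nat_pow_closed[OF BC UD(2) VU[OF b]] VK[OF c \<alpha>]]]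
        by simp
    qed
    show "b \<oplus>\<^bsub>B\<^esub> c \<in> ?V"
    proof (rule VI)
      show "b \<oplus>\<^bsub>B\<^esub> c \<in> U" using sub(7) VU b c by blast
      fix \<alpha> assume \<alpha>: "\<alpha> \<in> E"
      have pc: "psi_at B \<alpha> b \<in> carrier B" "psi_at B \<alpha> c \<in> carrier B" using psi(3)[OF s[OF \<alpha>]] bc cc by auto
      have "psi_at B \<alpha> (b \<oplus>\<^bsub>B\<^esub> c) \<ominus>\<^bsub>B\<^esub> (b \<oplus>\<^bsub>B\<^esub> c) [^]\<^bsub>B\<^esub> ?q \<alpha> =
        (psi_at B \<alpha> b \<ominus>\<^bsub>B\<^esub> b [^]\<^bsub>B\<^esub> ?q \<alpha>) \<oplus>\<^bsub>B\<^esub> (psi_at B \<alpha> c \<ominus>\<^bsub>B\<^esub> c [^]\<^bsub>B\<^esub> ?q \<alpha>) \<oplus>\<^bsub>B\<^esub>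
        ((b [^]\<^bsub>B\<^esub> ?q \<alpha> \<oplus>\<^bsub>B\<^esub> c [^]\<^bsub>B\<^esub> ?q \<alpha>) \<ominus>\<^bsub>B\<^esub> (b \<oplus>\<^bsub>B\<^esub> c) [^]\<^bsub>B\<^esub> ?q \<alpha>)"
        unfolding psi(4)[OF s[OF \<alpha>] bc cc] using bc cc pc by (intro cring.add_error[OF BC]) auto
      then show "psi_at B \<alpha> (b \<oplus>\<^bsub>B\<^esub> c) \<ominus>\<^bsub>B\<^esub> (b \<oplus>\<^bsub>B\<^esub> c) [^]\<^bsub>B\<^esub> ?q \<alpha> \<in> ?K \<alpha>"
        using Kadd[OF \<alpha> Kadd[OF \<alpha> VK[OF b \<alpha>] VK[OF c \<alpha>]] frob_add[OF \<alpha> VU[OF b] VU[OF c]]] by simp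
    qed
  qed
  moreover have "psi B k b \<in> ?V" if k: "k \<in> NE E" and b: "b \<in> ?V" for k b
  proof (rule VI)
    have bc: "b \<in> carrier B" using UB[OF VU[OF b]] .
    show "psi B k b \<in> U" using UD(4)[OF k VU[OF b]] .
    fix \<alpha> assume \<alpha>: "\<alpha> \<in> E"
    note sa = s[OF \<alpha>]
    have "psi_at B \<alpha> (psi B k b) = psi B k (psi_at B \<alpha> b)"
      using psi(9)[OF sa k bc] psi(9)[OF k sa bc] by (simp add: add.commute)
    moreover have "(psi B k b) [^]\<^bsub>B\<^esub> ?q \<alpha> = psi B k (b [^]\<^bsub>B\<^esub> ?q \<alpha>)"
      using alg_hom_pow[OF psi(2)[OF k] psi(1) psi(1) bc] by simp
    moreover have "psi B k (psi_at B \<alpha> b \<ominus>\<^bsub>B\<^esub> b [^]\<^bsub>B\<^esub> ?q \<alpha>) \<in> ?K \<alpha>"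
      using UD(4)[OF k] VK[OF b \<alpha>]
      by (intro B.ideal_smult_mono_hom[OF I[OF \<alpha>] sub(1) psi(1) psi(2)[OF k] sub(1)]) auto
    ultimately show "psi_at B \<alpha> (psi B k b) \<ominus>\<^bsub>B\<^esub> (psi B k b) [^]\<^bsub>B\<^esub> ?q \<alpha> \<in> ?K \<alpha>"
      using alg_hom_minus[OF psi(2)[OF k] psi(1) psi(1) psi(3)[OF sa bc], of "b [^]\<^bsub>B\<^esub> ?q \<alpha>"] bc by simp
  qed
  ultimately show ?thesis using UD(1) smult by (auto simp: is_sub_psi_ring_def)
qed

lemma sub_psi_ring_INT:
  assumes "\<And>i. is_sub_psi_ring R E (U i) B"
  shows "is_sub_psi_ring R E (\<Inter>i. U i) B"
proof -
  interpret B: algebra R B using assms is_psi_ringD(1) is_sub_psi_ringD(1) by metis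
  have "subring (\<Inter>i. U i) B"
    by (rule B.subring_Inter) (use is_sub_psi_ringD(2)[OF assms] in auto)
  then show ?thesis using assms by (auto simp: is_sub_psi_ring_def)
qed

text \<open>An equivariant algebra map respects \<open>psi\<close>, powers and multiples by
  \<open>\<mm> \<alpha>\<close>, hence the whole condition. This is the induction step both for the
  action of \<open>witt_map\<close> and for the transposes of maps out of a \<Lambda>-ring.\<close>

lemma frob_step_image:
  fixes B :: "('r, 'a, 'e, 'm) psi_ring_scheme" and C :: "('r, 'b, 'e, 'n) psi_ring_scheme"
  assumes B: "is_psi_ring R E B" and C: "algebra R C" and I: "\<And>\<alpha>. \<alpha> \<in> E \<Longrightarrow> ideal (\<mm> \<alpha>) R"
    and h: "h \<in> alg_hom R B C"
    and eqv: "\<And>k x. k \<in> NE E \<Longrightarrow> x \<in> carrier B \<Longrightarrow> h (psi B k x) = psi C k (h x)"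
    and V: "V \<subseteq> carrier B" and U: "U \<subseteq> carrier C" and VU: "h ` V \<subseteq> U"
  shows "h ` frob_step R E \<mm> B V \<subseteq> frob_step R E \<mm> C U"
proof
  fix c assume "c \<in> h ` frob_step R E \<mm> B V"
  then obtain b where b: "b \<in> frob_step R E \<mm> B V" "c = h b" by blast
  have bV: "b \<in> V" and bc: "b \<in> carrier B" using b V by (auto simp: frob_step_def)
  interpret B: algebra R B by (rule is_psi_ringD(1)[OF B])
  have "psi_at C \<alpha> (h b) \<ominus>\<^bsub>C\<^esub> h b [^]\<^bsub>C\<^esub> residue_card R \<mm> \<alpha> \<in> ideal_smult (\<mm> \<alpha>) U C" if \<alpha>: "\<alpha> \<in> E" for \<alpha>
  proof -
    have s: "Poly_Mapping.single \<alpha> 1 \<in> NE E" using \<alpha> by simp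
    have "h (psi_at B \<alpha> b \<ominus>\<^bsub>B\<^esub> b [^]\<^bsub>B\<^esub> residue_card R \<mm> \<alpha>) \<in> ideal_smult (\<mm> \<alpha>) U C"
      using b \<alpha> by (intro B.ideal_smult_mono_hom[OF I[OF \<alpha>] V C h U VU]) (auto simp: frob_step_def)
    then show ?thesis
      using alg_hom_minus[OF h B.algebra_axioms C is_psi_ringD(3)[OF B s bc], of "b [^]\<^bsub>B\<^esub> residue_card R \<mm> \<alpha>"]
        alg_hom_pow[OF h B.algebra_axioms C bc] eqv[OF s bc] bc by simp
  qed
  then show "c \<in> frob_step R E \<mm> C U" using b(2) VU bV by (auto simp: frob_step_def)
qed

section \<open>The ghost ring and its approximations\<close>

lemma ghost_ring_simps:
  "carrier (ghost_ring E A) = NE E \<rightarrow>\<^sub>E carrier A"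
  "a \<otimes>\<^bsub>ghost_ring E A\<^esub> b = (\<lambda>k\<in>NE E. a k \<otimes>\<^bsub>A\<^esub> b k)"
  "\<one>\<^bsub>ghost_ring E A\<^esub> = (\<lambda>k\<in>NE E. \<one>\<^bsub>A\<^esub>)"
  "\<zero>\<^bsub>ghost_ring E A\<^esub> = (\<lambda>k\<in>NE E. \<zero>\<^bsub>A\<^esub>)"
  "a \<oplus>\<^bsub>ghost_ring E A\<^esub> b = (\<lambda>k\<in>NE E. a k \<oplus>\<^bsub>A\<^esub> b k)"
  "r \<odot>\<^bsub>ghost_ring E A\<^esub> a = (\<lambda>k\<in>NE E. r \<odot>\<^bsub>A\<^esub> a k)"
  "psi (ghost_ring E A) m a = (\<lambda>k\<in>NE E. a (k + m))"
  by (simp_all add: ghost_ring_def)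

lemma ghost_ring_ext:
  assumes "a \<in> carrier (ghost_ring E A)" "b \<in> carrier (ghost_ring E A)" "\<And>k. k \<in> NE E \<Longrightarrow> a k = b k"
  shows "a = b"
  using assms unfolding ghost_ring_simps by (rule PiE_ext)

lemma ghost_ring_psi_ring:
  assumes "algebra R A"
  shows "is_psi_ring R E (ghost_ring E A)"
proof -
  interpret A: algebra R A by fact
  have "algebra R (ghost_ring E A)"
  proof (rule algebraI)
    show "cring R" by (rule A.R_cring)
    show "cring (ghost_ring E A)"
    proof (rule cringI)
      show "abelian_group (ghost_ring E A)"
      proof (rule abelian_groupI)
        fix x assume x: "x \<in> carrier (ghost_ring E A)"
        then show "\<exists>y\<in>carrier (ghost_ring E A). y \<oplus>\<^bsub>ghost_ring E A\<^esub> x = \<zero>\<^bsub>ghost_ring E A\<^esub>"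
          by (intro bexI[of _ "\<lambda>k\<in>NE E. \<ominus>\<^bsub>A\<^esub> x k"])
            (auto simp: ghost_ring_simps PiE_iff A.l_neg intro!: restrict_ext)
        show "\<zero>\<^bsub>ghost_ring E A\<^esub> \<oplus>\<^bsub>ghost_ring E A\<^esub> x = x"
          using x by (intro ghost_ring_ext[of _ E A]) (auto simp: ghost_ring_simps PiE_iff)
      qed (auto simp: ghost_ring_simps PiE_iff A.M.a_ac intro!: restrict_ext)
      show "comm_monoid (ghost_ring E A)"
      proof (rule comm_monoidI)
        fix x assume x: "x \<in> carrier (ghost_ring E A)"
        then show "\<one>\<^bsub>ghost_ring E A\<^esub> \<otimes>\<^bsub>ghost_ring E A\<^esub> x = x"
          by (intro ghost_ring_ext[of _ E A]) (auto simp: ghost_ring_simps PiE_iff)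
      qed (auto simp: ghost_ring_simps PiE_iff A.m_ac intro!: restrict_ext)
    qed (auto simp: ghost_ring_simps PiE_iff A.l_distr intro!: restrict_ext)
    fix x assume x: "x \<in> carrier (ghost_ring E A)"
    have xk: "x k \<in> carrier A" if "k \<in> NE E" for k using x that by (auto simp: ghost_ring_simps)
    show "\<one>\<^bsub>R\<^esub> \<odot>\<^bsub>ghost_ring E A\<^esub> x = x"
      using x by (intro ghost_ring_ext[of _ E A]) (auto simp: ghost_ring_simps PiE_iff)
    fix r assume r: "r \<in> carrier R"
    show "r \<odot>\<^bsub>ghost_ring E A\<^esub> x \<in> carrier (ghost_ring E A)"
      using xk r by (simp add: ghost_ring_simps)
    fix s assume s: "s \<in> carrier R"
    show "(r \<oplus>\<^bsub>R\<^esub> s) \<odot>\<^bsub>ghost_ring E A\<^esub> x =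
        r \<odot>\<^bsub>ghost_ring E A\<^esub> x \<oplus>\<^bsub>ghost_ring E A\<^esub> s \<odot>\<^bsub>ghost_ring E A\<^esub> x"
      unfolding ghost_ring_simps by (rule restrict_ext) (use r s xk in \<open>simp add: A.smult_l_distr\<close>)
    show "(r \<otimes>\<^bsub>R\<^esub> s) \<odot>\<^bsub>ghost_ring E A\<^esub> x =
        r \<odot>\<^bsub>ghost_ring E A\<^esub> (s \<odot>\<^bsub>ghost_ring E A\<^esub> x)"
      unfolding ghost_ring_simps by (rule restrict_ext) (use r s xk in \<open>simp add: A.smult_assoc1\<close>)
  next
    fix r x y assume r: "r \<in> carrier R" and "x \<in> carrier (ghost_ring E A)" "y \<in> carrier (ghost_ring E A)"
    then have xy: "x k \<in> carrier A" "y k \<in> carrier A" if "k \<in> NE E" for k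
      using that by (auto simp: ghost_ring_simps)
    show "r \<odot>\<^bsub>ghost_ring E A\<^esub> (x \<oplus>\<^bsub>ghost_ring E A\<^esub> y) =
        r \<odot>\<^bsub>ghost_ring E A\<^esub> x \<oplus>\<^bsub>ghost_ring E A\<^esub> r \<odot>\<^bsub>ghost_ring E A\<^esub> y"
      unfolding ghost_ring_simps by (rule restrict_ext) (simp add: A.smult_r_distr r xy)
    show "r \<odot>\<^bsub>ghost_ring E A\<^esub> x \<otimes>\<^bsub>ghost_ring E A\<^esub> y =
        r \<odot>\<^bsub>ghost_ring E A\<^esub> (x \<otimes>\<^bsub>ghost_ring E A\<^esub> y)"
      unfolding ghost_ring_simps by (rule restrict_ext) (simp add: A.smult_assoc2 r xy)
  qed
  moreover have "psi (ghost_ring E A) k \<in> alg_hom R (ghost_ring E A) (ghost_ring E A)" if k: "k \<in> NE E" for k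
  proof (rule alg_homI)
    have add: "l + k \<in> NE E" if "l \<in> NE E" for l using that k by (rule add_in_NE)
    fix x assume "x \<in> carrier (ghost_ring E A)"
    then show "psi (ghost_ring E A) k x \<in> carrier (ghost_ring E A)"
      unfolding ghost_ring_simps using add by (intro restrict_PiE_iff[THEN iffD2] ballI) (rule PiE_mem)
  qed (auto simp: ghost_ring_simps add_in_NE[OF _ k] intro!: restrict_ext)
  moreover have "psi (ghost_ring E A) 0 x = x" if "x \<in> carrier (ghost_ring E A)" for x
    using that by (intro ghost_ring_ext[of _ E A]) (auto simp: ghost_ring_simps PiE_iff)
  moreover have "psi (ghost_ring E A) (k + l) x = psi (ghost_ring E A) k (psi (ghost_ring E A) l x)"
    if "k \<in> NE E" "l \<in> NE E" for k l x
    unfolding ghost_ring_simps by (rule restrict_ext) (simp add: add_in_NE that add.assoc)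
  ultimately show ?thesis unfolding is_psi_ring_def by blast
qed

lemma witt_approx_Suc: "witt_approx R E \<mm> A (Suc i) = frob_step R E \<mm> (ghost_ring E A) (witt_approx R E \<mm> A i)"
  by (simp add: frob_step_def)

lemma carrier_sub_psi_ring:
  assumes "is_psi_ring R E B"
  shows "is_sub_psi_ring R E (carrier B) B"
proof -
  interpret B: algebra R B by (rule is_psi_ringD(1)[OF assms])
  show ?thesis using assms is_psi_ringD(3)[OF assms] by (auto simp: is_sub_psi_ring_def B.carrier_is_subring)
qed

lemma witt_approx_sub_psi_ring:
  assumes A: "algebra R A" and smax: "\<And>\<alpha>. \<alpha> \<in> E \<Longrightarrow> supramaximal R (\<mm> \<alpha>)"
  shows "is_sub_psi_ring R E (witt_approx R E \<mm> A i) (ghost_ring E A)"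
proof (induction i)
  case 0
  show ?case using carrier_sub_psi_ring[OF ghost_ring_psi_ring[OF A]] by simp
next
  case (Suc i)
  then show ?case unfolding witt_approx_Suc using frob_step_sub_psi_ring smax by blast
qed

lemma witt_vectors_sub_psi_ring:
  assumes A: "algebra R A" and smax: "\<And>\<alpha>. \<alpha> \<in> E \<Longrightarrow> supramaximal R (\<mm> \<alpha>)"
  shows "is_sub_psi_ring R E (witt_vectors R E \<mm> A) (ghost_ring E A)"
  unfolding witt_vectors_def using witt_approx_sub_psi_ring[OF A smax] by (rule sub_psi_ring_INT)

section \<open>Flatness and the Frobenius congruences for Witt vectors\<close>

definition flat_at :: "('r, 'a, 'm) module_scheme \<Rightarrow> 'r \<Rightarrow> 'r \<Rightarrow> ('r \<Rightarrow> 'r) \<Rightarrow> bool" where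
  "flat_at M e t \<phi> \<longleftrightarrow> (\<forall>y\<in>carrier M. \<forall>z\<in>carrier M. e \<odot>\<^bsub>M\<^esub> y \<oplus>\<^bsub>M\<^esub> t \<odot>\<^bsub>M\<^esub> z = \<zero>\<^bsub>M\<^esub> \<longrightarrow>
        \<phi> e \<odot>\<^bsub>M\<^esub> y \<oplus>\<^bsub>M\<^esub> \<phi> t \<odot>\<^bsub>M\<^esub> z = \<zero>\<^bsub>M\<^esub>)"

text \<open>For a supramaximal ideal, to be maximal is to be different from \<open>R\<close>.
  Flatness gives the criterion for every dual basis; conversely one dual basis is enough, and
  \<open>supramaximal_dual_basis\<close> provides it.\<close>

lemma E_flat_iff:
  assumes M: "module R M" and smax: "\<And>\<alpha>. \<alpha> \<in> E \<Longrightarrow> supramaximal R (\<mm> \<alpha>)"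
  shows "E_flat R E \<mm> M \<longleftrightarrow>
    (\<forall>\<alpha>\<in>E. \<mm> \<alpha> \<noteq> carrier R \<longrightarrow> (\<forall>e t \<phi>. dual_basis R (\<mm> \<alpha>) e t \<phi> \<longrightarrow> flat_at M e t \<phi>))"
    (is "_ \<longleftrightarrow> ?rhs")
proof -
  interpret module R M by fact
  have I: "ideal (\<mm> \<alpha>) R" if "\<alpha> \<in> E" for \<alpha> using smax[OF that] by (simp add: supramaximal_def)
  have flat: "inj_on (ideal_tensor_map M) (carrier (tensor R (ideal_module R (\<mm> \<alpha>)) M)) \<longleftrightarrow> flat_at M e t \<phi>"
    if "\<alpha> \<in> E" "dual_basis R (\<mm> \<alpha>) e t \<phi>" for \<alpha> e t \<phi>
    using flat_iff_dual_basis[OF I[OF that(1)] that(2)] by (simp add: flat_at_def)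
  show ?thesis
  proof
    assume L: "E_flat R E \<mm> M"
    show ?rhs
    proof (intro ballI impI allI)
      fix \<alpha> e t \<phi> assume \<alpha>: "\<alpha> \<in> E" and ne: "\<mm> \<alpha> \<noteq> carrier R" and db: "dual_basis R (\<mm> \<alpha>) e t \<phi>"
      have "field (R Quot \<mm> \<alpha>)" using smax[OF \<alpha>] ne by (simp add: supramaximal_def)
      then have "maximalideal (\<mm> \<alpha>) R" using field_quot_maximalideal[OF I[OF \<alpha>]] by simp
      then have "inj_on (ideal_tensor_map M) (carrier (tensor R (ideal_module R (\<mm> \<alpha>)) M))"
        using L \<alpha> by (simp add: E_flat_def)
      then show "flat_at M e t \<phi>" using flat[OF \<alpha> db] by simp
    qed
  next
    assume rhs: ?rhs
    show "E_flat R E \<mm> M"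
      unfolding E_flat_def
    proof (intro ballI impI)
      fix \<alpha> assume \<alpha>: "\<alpha> \<in> E" and mx: "maximalideal (\<mm> \<alpha>) R"
      have ne: "\<mm> \<alpha> \<noteq> carrier R" using maximalideal.I_notcarr[OF mx] by metis
      then obtain e t \<phi> where db: "dual_basis R (\<mm> \<alpha>) e t \<phi>"
        using supramaximal_dual_basis[OF I[OF \<alpha>]] smax[OF \<alpha>] unfolding supramaximal_def by metis
      have "flat_at M e t \<phi>" using rhs \<alpha> ne db by blast
      then show "inj_on (ideal_tensor_map M) (carrier (tensor R (ideal_module R (\<mm> \<alpha>)) M))"
        using flat[OF \<alpha> db] by simp
    qed
  qed
qed

lemma flat_at_submodule:
  assumes "flat_at M e t \<phi>" "U \<subseteq> carrier M"
  shows "flat_at (M\<lparr>carrier := U\<rparr>) e t \<phi>"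
  using assms by (auto simp: flat_at_def subset_iff)

lemma flat_at_ghost_ring:
  assumes "flat_at A e t \<phi>"
  shows "flat_at (ghost_ring E A) e t \<phi>"
  unfolding flat_at_def
proof (intro ballI impI)
  fix y z assume y: "y \<in> carrier (ghost_ring E A)" and z: "z \<in> carrier (ghost_ring E A)"
    and 0: "e \<odot>\<^bsub>ghost_ring E A\<^esub> y \<oplus>\<^bsub>ghost_ring E A\<^esub> t \<odot>\<^bsub>ghost_ring E A\<^esub> z = \<zero>\<^bsub>ghost_ring E A\<^esub>"
  have "\<phi> e \<odot>\<^bsub>A\<^esub> y k \<oplus>\<^bsub>A\<^esub> \<phi> t \<odot>\<^bsub>A\<^esub> z k = \<zero>\<^bsub>A\<^esub>" if k: "k \<in> NE E" for k
  proof -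
    have "y k \<in> carrier A" "z k \<in> carrier A" using y z k by (auto simp: ghost_ring_simps)
    moreover have "e \<odot>\<^bsub>A\<^esub> y k \<oplus>\<^bsub>A\<^esub> t \<odot>\<^bsub>A\<^esub> z k = \<zero>\<^bsub>A\<^esub>"
      using fun_cong[OF 0, of k] k by (simp add: ghost_ring_simps)
    ultimately show ?thesis using assms by (simp add: flat_at_def)
  qed
  then show "\<phi> e \<odot>\<^bsub>ghost_ring E A\<^esub> y \<oplus>\<^bsub>ghost_ring E A\<^esub> \<phi> t \<odot>\<^bsub>ghost_ring E A\<^esub> z = \<zero>\<^bsub>ghost_ring E A\<^esub>"
    unfolding ghost_ring_simps by (intro restrict_ext) simp
qed

text \<open>A product \<open>r x\<close> equals \<open>e (r x) + t (\<phi>(r) x)\<close>, and both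
  coefficients remain in \<open>U\<close> because \<open>U\<close> is closed under scalars.\<close>

lemma (in algebra) ideal_smult_dual_basis:
  assumes I: "ideal I R" and db: "dual_basis R I e t \<phi>"
    and U: "subring U M" "\<And>r x. r \<in> carrier R \<Longrightarrow> x \<in> U \<Longrightarrow> r \<odot>\<^bsub>M\<^esub> x \<in> U"
    and z: "z \<in> ideal_smult I U M"
  shows "\<exists>y\<in>U. \<exists>w\<in>U. z = e \<odot>\<^bsub>M\<^esub> y \<oplus>\<^bsub>M\<^esub> t \<odot>\<^bsub>M\<^esub> w"
proof -
  interpret I: ideal I R by fact
  note UD = subringE[OF U(1)]
  have UM: "x \<in> carrier M" if "x \<in> U" for x using that UD(1) by auto
  have et: "e \<in> carrier R" "t \<in> carrier R" and \<phi>: "\<And>r. r \<in> I \<Longrightarrow> \<phi> r \<in> carrier R"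
    and split: "\<And>r. r \<in> I \<Longrightarrow> e \<otimes> r \<oplus> t \<otimes> \<phi> r = r"
    using db I.a_Hcarr by (auto simp: dual_basis_def module_hom_def)
  show ?thesis using I UD(1) z
  proof (induction z rule: ideal_smult_induct)
    case zero
    show ?case using et UD(2) by (intro bexI[of _ "\<zero>\<^bsub>M\<^esub>"]) auto
  next
    case (base r x)
    have rc: "r \<in> carrier R" using base I.a_Hcarr by auto
    have "r \<odot>\<^bsub>M\<^esub> x = (e \<otimes> r \<oplus> t \<otimes> \<phi> r) \<odot>\<^bsub>M\<^esub> x" using split base by simp
    also have "\<dots> = e \<odot>\<^bsub>M\<^esub> (r \<odot>\<^bsub>M\<^esub> x) \<oplus>\<^bsub>M\<^esub> t \<odot>\<^bsub>M\<^esub> (\<phi> r \<odot>\<^bsub>M\<^esub> x)"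
      using et \<phi>[OF base(1)] rc UM[OF base(2)] by (simp add: smult_l_distr smult_assoc1)
    finally show ?case using U(2) rc \<phi>[OF base(1)] base(2) by blast
  next
    case (minus y)
    then obtain a b where ab: "a \<in> U" "b \<in> U" "y = e \<odot>\<^bsub>M\<^esub> a \<oplus>\<^bsub>M\<^esub> t \<odot>\<^bsub>M\<^esub> b" by blast
    then have "\<ominus>\<^bsub>M\<^esub> y = e \<odot>\<^bsub>M\<^esub> (\<ominus>\<^bsub>M\<^esub> a) \<oplus>\<^bsub>M\<^esub> t \<odot>\<^bsub>M\<^esub> (\<ominus>\<^bsub>M\<^esub> b)"
      using et UM by (simp add: smult_r_minus M.minus_add)
    then show ?case using UD(5) ab by blast
  next
    case (add y w)
    then obtain a b c d where ab: "a \<in> U" "b \<in> U" "y = e \<odot>\<^bsub>M\<^esub> a \<oplus>\<^bsub>M\<^esub> t \<odot>\<^bsub>M\<^esub> b"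
      "c \<in> U" "d \<in> U" "w = e \<odot>\<^bsub>M\<^esub> c \<oplus>\<^bsub>M\<^esub> t \<odot>\<^bsub>M\<^esub> d" by blast
    then have "y \<oplus>\<^bsub>M\<^esub> w = e \<odot>\<^bsub>M\<^esub> (a \<oplus>\<^bsub>M\<^esub> c) \<oplus>\<^bsub>M\<^esub> t \<odot>\<^bsub>M\<^esub> (b \<oplus>\<^bsub>M\<^esub> d)"
      using et UM by (simp add: smult_r_distr M.a_ac)
    then show ?case using UD(7) ab by blast
  qed
qed

text \<open>Flatness makes the second coordinate \<open>w\<close> of \<open>z = e z + t w\<close> independent of \<open>i\<close>.\<close>

lemma (in algebra) ideal_smult_INT:
  fixes U :: "nat \<Rightarrow> 'c set"
  assumes I: "ideal I R" and db: "dual_basis R I e t \<phi>" and flat: "flat_at M e t \<phi>"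
    and U: "\<And>i. subring (U i) M" "\<And>i r x. r \<in> carrier R \<Longrightarrow> x \<in> U i \<Longrightarrow> r \<odot>\<^bsub>M\<^esub> x \<in> U i"
    and z: "\<And>i. z \<in> ideal_smult I (U i) M"
  shows "z \<in> ideal_smult I (\<Inter>i. U i) M"
proof -
  interpret I: ideal I R by fact
  have UM: "x \<in> carrier M" if "x \<in> U i" for x i using that subringE(1)[OF U(1)] by auto
  have e: "e \<in> I" and t: "t \<in> I" and \<phi>: "\<And>r. r \<in> I \<Longrightarrow> \<phi> r \<in> carrier R"
    and split: "\<And>r. r \<in> I \<Longrightarrow> e \<otimes> r \<oplus> t \<otimes> \<phi> r = r"
    using db by (auto simp: dual_basis_def module_hom_def)
  have ec [simp]: "e \<in> carrier R" and tc [simp]: "t \<in> carrier R" using e t I.a_Hcarr by auto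
  have \<phi>e [simp]: "\<phi> e \<in> carrier R" and \<phi>t [simp]: "\<phi> t \<in> carrier R" using \<phi> e t by auto
  have "\<forall>i. \<exists>y w. y \<in> U i \<and> w \<in> U i \<and> z = e \<odot>\<^bsub>M\<^esub> y \<oplus>\<^bsub>M\<^esub> t \<odot>\<^bsub>M\<^esub> w"
    using ideal_smult_dual_basis[OF I db U(1) _ z] U(2) by blast
  then obtain y w where yw: "\<And>i. y i \<in> U i" "\<And>i. w i \<in> U i" "\<And>i. z = e \<odot>\<^bsub>M\<^esub> y i \<oplus>\<^bsub>M\<^esub> t \<odot>\<^bsub>M\<^esub> w i" by metis
  have c [simp]: "y i \<in> carrier M" "w i \<in> carrier M" for i using UM yw by auto
  \<comment> \<open>The value at \<open>z = e y + t w\<close> of the linear extension of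
    \<open>\<phi>\<close> to multiples by \<open>I\<close>. Flatness says that it depends on
    \<open>z\<close> only and not on the chosen expression.\<close>
  let ?v = "\<lambda>i. \<phi> e \<odot>\<^bsub>M\<^esub> y i \<oplus>\<^bsub>M\<^esub> \<phi> t \<odot>\<^bsub>M\<^esub> w i"
  have lin: "a \<odot>\<^bsub>M\<^esub> (y i \<ominus>\<^bsub>M\<^esub> y j) \<oplus>\<^bsub>M\<^esub> b \<odot>\<^bsub>M\<^esub> (w i \<ominus>\<^bsub>M\<^esub> w j) =
    (a \<odot>\<^bsub>M\<^esub> y i \<oplus>\<^bsub>M\<^esub> b \<odot>\<^bsub>M\<^esub> w i) \<ominus>\<^bsub>M\<^esub> (a \<odot>\<^bsub>M\<^esub> y j \<oplus>\<^bsub>M\<^esub> b \<odot>\<^bsub>M\<^esub> w j)"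
    if "a \<in> carrier R" "b \<in> carrier R" for a b i j
    using that by (simp add: a_minus_def smult_r_distr smult_r_minus M.minus_add M.a_ac)
  have v: "?v i = ?v 0" for i
  proof -
    have zc: "z \<in> carrier M" using yw(3)[of 0] by simp
    have "e \<odot>\<^bsub>M\<^esub> (y i \<ominus>\<^bsub>M\<^esub> y 0) \<oplus>\<^bsub>M\<^esub> t \<odot>\<^bsub>M\<^esub> (w i \<ominus>\<^bsub>M\<^esub> w 0) = \<zero>\<^bsub>M\<^esub>"
      unfolding lin[OF ec tc] yw(3)[symmetric] using zc by (simp add: a_minus_def M.r_neg)
    then have "\<phi> e \<odot>\<^bsub>M\<^esub> (y i \<ominus>\<^bsub>M\<^esub> y 0) \<oplus>\<^bsub>M\<^esub> \<phi> t \<odot>\<^bsub>M\<^esub> (w i \<ominus>\<^bsub>M\<^esub> w 0) = \<zero>\<^bsub>M\<^esub>"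
      using flat by (simp add: flat_at_def)
    then have "?v i \<ominus>\<^bsub>M\<^esub> ?v 0 = \<zero>\<^bsub>M\<^esub>" unfolding lin[OF \<phi>e \<phi>t] .
    then show ?thesis by (simp add: r_right_minus_eq)
  qed
  have vU: "?v 0 \<in> U i" for i
    unfolding v[of i, symmetric] using yw U(2) subringE(7)[OF U(1)] by simp
  have zU: "z \<in> U i" for i
    using subsetD[OF ideal_smult_subset[OF I U(1) U(2)] z] .
  \<comment> \<open>The dual basis formula is applied to the coefficients \<open>e\<close> and
    \<open>t\<close> themselves; after regrouping, \<open>e\<close> is multiplied by
    \<open>z\<close> and \<open>t\<close> by \<open>?v 0\<close>. Both of these lie in every
    \<open>U i\<close>.\<close>
  have "z = (e \<otimes> e \<oplus> t \<otimes> \<phi> e) \<odot>\<^bsub>M\<^esub> y 0 \<oplus>\<^bsub>M\<^esub> (e \<otimes> t \<oplus> t \<otimes> \<phi> t) \<odot>\<^bsub>M\<^esub> w 0"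
    using yw(3)[of 0] split[OF e] split[OF t] by simp
  also have "\<dots> = e \<odot>\<^bsub>M\<^esub> (e \<odot>\<^bsub>M\<^esub> y 0 \<oplus>\<^bsub>M\<^esub> t \<odot>\<^bsub>M\<^esub> w 0) \<oplus>\<^bsub>M\<^esub> t \<odot>\<^bsub>M\<^esub> ?v 0"
    by (simp add: smult_l_distr smult_r_distr smult_assoc1 M.a_ac)
  also have "\<dots> = e \<odot>\<^bsub>M\<^esub> z \<oplus>\<^bsub>M\<^esub> t \<odot>\<^bsub>M\<^esub> ?v 0" unfolding yw(3)[of 0, symmetric] ..
  finally have z_eq: "z = e \<odot>\<^bsub>M\<^esub> z \<oplus>\<^bsub>M\<^esub> t \<odot>\<^bsub>M\<^esub> ?v 0" .
  have "subgroup (ideal_smult I (\<Inter>i. U i) M) (add_monoid M)"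
    by (rule ideal_smult_subgroup[OF I]) (use UM in blast)
  from subgroup.m_closed[OF this ideal_smult_incl[OF e] ideal_smult_incl[OF t]]
  have "e \<odot>\<^bsub>M\<^esub> z \<oplus>\<^bsub>M\<^esub> t \<odot>\<^bsub>M\<^esub> ?v 0 \<in> ideal_smult I (\<Inter>i. U i) M"
    using zU vU by simp
  then show ?thesis using z_eq by simp
qed

section \<open>Restriction to a sub-Psi-ring and the Lambda-ring condition\<close>

lemma sub_psi_ring_is_psi_ring:
  fixes B :: "('r, 'a, 'e, 'm) psi_ring_scheme"
  assumes "is_sub_psi_ring R E U B"
  shows "is_psi_ring R E (B\<lparr>carrier := U\<rparr>)"
proof -
  note UD = is_sub_psi_ringD[OF assms]
  note psi = is_psi_ringD[OF UD(1)]
  interpret B: algebra R B by (rule psi(1))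
  have UB: "x \<in> carrier B" if "x \<in> U" for x using that subringE(1)[OF UD(2)] by auto
  have "algebra R (B\<lparr>carrier := U\<rparr>)"
    by (rule algebraI) (use subring_cring[OF B.M_cring UD(2)] UB UD(3) in
      \<open>simp_all add: B.R_cring B.smult_l_distr B.smult_r_distr B.smult_assoc1 B.smult_assoc2\<close>)
  moreover have "psi (B\<lparr>carrier := U\<rparr>) k \<in> alg_hom R (B\<lparr>carrier := U\<rparr>) (B\<lparr>carrier := U\<rparr>)" if "k \<in> NE E" for k
    by (rule alg_homI) (use UB UD(4)[OF that] alg_homD[OF psi(2)[OF that]] in simp_all)
  ultimately show ?thesis using UB psi(8,9) by (simp add: is_psi_ring_def)
qed

text \<open>Negatives in the restricted record are defined by a search inside \<open>U\<close>;
  uniqueness of additive inverses identifies them with those of the ambient ring.\<close>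

lemma (in ring) subring_minus_eq:
  assumes "subring U R" "x \<in> U" "y \<in> U"
  shows "x \<ominus>\<^bsub>R\<lparr>carrier := U\<rparr>\<^esub> y = x \<ominus> y"
proof -
  note UD = subringE[OF assms(1)]
  interpret S: ring "R\<lparr>carrier := U\<rparr>" using subring_is_ring[OF assms(1)] .
  have "y \<in> carrier R" using assms(3) UD(1) by auto
  then have "\<ominus>\<^bsub>R\<lparr>carrier := U\<rparr>\<^esub> y = \<ominus> y"
    using S.minus_equality[of "\<ominus> y" y] UD(5)[OF assms(3)] assms(3) by (simp add: l_neg)
  then show ?thesis by (simp add: a_minus_def)
qed

lemma (in algebra) ideal_smult_carrier_update:
  assumes I: "ideal I R" and U: "subring U M" "\<And>r x. r \<in> carrier R \<Longrightarrow> x \<in> U \<Longrightarrow> r \<odot>\<^bsub>M\<^esub> x \<in> U"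
  shows "ideal_smult I U (M\<lparr>carrier := U\<rparr>) = ideal_smult I U M"
proof -
  have "generate ((add_monoid M)\<lparr>carrier := U\<rparr>) {r \<odot>\<^bsub>M\<^esub> x | r x. r \<in> I \<and> x \<in> U} =
      generate (add_monoid M) {r \<odot>\<^bsub>M\<^esub> x | r x. r \<in> I \<and> x \<in> U}"
    using U ideal.Icarr[OF I] by (intro group.generate_consistent[OF M.a_group] subring.axioms(1)) auto
  then show ?thesis by (simp add: ideal_smult_def)
qed

lemma lambda_ring_iff:
  assumes smax: "\<And>\<alpha>. \<alpha> \<in> E \<Longrightarrow> supramaximal R (\<mm> \<alpha>)" and B: "is_psi_ring R E B"
  shows "is_lambda_ring R E \<mm> B \<longleftrightarrow> frob_step R E \<mm> B (carrier B) = carrier B"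
proof -
  interpret B: algebra R B by (rule is_psi_ringD(1)[OF B])
  have "(\<forall>x\<in>carrier (tensor R (quot_algebra R (\<mm> \<alpha>)) B).
        tensor_induced R (quot_algebra R (\<mm> \<alpha>)) B (psi_at B \<alpha>) x
          = x [^]\<^bsub>tensor R (quot_algebra R (\<mm> \<alpha>)) B\<^esub> residue_card R \<mm> \<alpha>) \<longleftrightarrow>
      (\<forall>y\<in>carrier B. psi_at B \<alpha> y \<ominus>\<^bsub>B\<^esub> y [^]\<^bsub>B\<^esub> residue_card R \<mm> \<alpha> \<in> ideal_smult (\<mm> \<alpha>) (carrier B) B)"
    if \<alpha>: "\<alpha> \<in> E" for \<alpha>
    by (rule B.tensor_frobenius_iff)
      (use smax[OF \<alpha>] is_psi_ringD(2)[OF B, of "Poly_Mapping.single \<alpha> 1"] \<alpha> in \<open>auto simp: supramaximal_def\<close>)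
  then show ?thesis using B by (auto simp: is_lambda_ring_def frob_step_def)
qed

lemma witt_vectors_subset: "witt_vectors R E \<mm> A \<subseteq> witt_approx R E \<mm> A i"
  by (auto simp: witt_vectors_def)

lemma witt_ring_lambda_ring:
  assumes A: "E_flat_algebra R E \<mm> A" and smax: "\<And>\<alpha>. \<alpha> \<in> E \<Longrightarrow> supramaximal R (\<mm> \<alpha>)"
  shows "E_flat_lambda_ring R E \<mm> (witt_ring R E \<mm> A)"
proof -
  let ?G = "ghost_ring E A" and ?W = "witt_vectors R E \<mm> A" and ?U = "witt_approx R E \<mm> A"
  have alg: "algebra R A" and flatA: "E_flat R E \<mm> A" using A by (auto simp: E_flat_algebra_def)
  interpret A: algebra R A by (rule alg)
  have G: "is_psi_ring R E ?G" by (rule ghost_ring_psi_ring[OF alg])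
  interpret G: algebra R ?G by (rule is_psi_ringD(1)[OF G])
  have W: "is_sub_psi_ring R E ?W ?G" using alg smax by (rule witt_vectors_sub_psi_ring)
  note WD = is_sub_psi_ringD[OF W]
  have U: "is_sub_psi_ring R E (?U i) ?G" for i using alg smax by (rule witt_approx_sub_psi_ring)
  note UD = is_sub_psi_ringD[OF U]
  have Wpsi: "is_psi_ring R E (witt_ring R E \<mm> A)"
    unfolding witt_ring_def by (rule sub_psi_ring_is_psi_ring[OF W])
  interpret W: algebra R "witt_ring R E \<mm> A" by (rule is_psi_ringD(1)[OF Wpsi])
  have flat: "flat_at A e t \<phi>"
    if "\<alpha> \<in> E" "\<mm> \<alpha> \<noteq> carrier R" "dual_basis R (\<mm> \<alpha>) e t \<phi>" for \<alpha> e t \<phi>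
    using iffD1[OF E_flat_iff[OF A.module smax] flatA] that by simp
  have "E_flat R E \<mm> (witt_ring R E \<mm> A)"
    unfolding witt_ring_def
    by (rule iffD2[OF E_flat_iff[OF W.module[unfolded witt_ring_def] smax]], assumption)
      (intro ballI impI allI flat_at_submodule flat_at_ghost_ring subringE(1)[OF WD(2)] flat)
  moreover have "frob_step R E \<mm> (witt_ring R E \<mm> A) ?W = ?W"
  proof -
    have "psi_at ?G \<alpha> w \<ominus>\<^bsub>witt_ring R E \<mm> A\<^esub> w [^]\<^bsub>?G\<^esub> residue_card R \<mm> \<alpha> \<in> ideal_smult (\<mm> \<alpha>) ?W (witt_ring R E \<mm> A)"
      if w: "w \<in> ?W" and \<alpha>: "\<alpha> \<in> E" for w \<alpha>
    proof -
      let ?q = "residue_card R \<mm> \<alpha>"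
      let ?d = "psi_at ?G \<alpha> w \<ominus>\<^bsub>?G\<^esub> w [^]\<^bsub>?G\<^esub> ?q"
      have I: "ideal (\<mm> \<alpha>) R" using smax[OF \<alpha>] by (simp add: supramaximal_def)
      have cl: "psi_at ?G \<alpha> w \<in> ?W" "w [^]\<^bsub>?G\<^esub> ?q \<in> ?W"
        using WD(4) w \<alpha> cring.subring_nat_pow_closed[OF G.M_cring WD(2) w] by auto
      have dW: "?d \<in> ?W" using cring.subring_minus_closed[OF G.M_cring WD(2) cl] .
      \<comment> \<open>The condition for \<open>w\<close> to lie in approximation
        \<open>Suc i\<close> is about multiples of approximation \<open>i\<close>; since
        \<open>w\<close> lies in all of them, the shift by one is harmless.\<close>
      have d: "?d \<in> ideal_smult (\<mm> \<alpha>) (?U i) ?G" for i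
        using w \<alpha> subsetD[OF witt_vectors_subset[of R E \<mm> A "Suc i"], of w] by simp
      have "?d \<in> ideal_smult (\<mm> \<alpha>) ?W ?G"
      proof (cases "\<mm> \<alpha> = carrier R")
        case True
        \<comment> \<open>The unit ideal contains 1, so here it is enough that the defect lies in
          \<open>W\<close>.\<close>
        have "\<one>\<^bsub>R\<^esub> \<odot>\<^bsub>?G\<^esub> ?d \<in> ideal_smult (\<mm> \<alpha>) ?W ?G"
          using True dW by (intro ideal_smult_incl) auto
        then show ?thesis using subsetD[OF subringE(1)[OF WD(2)] dW] by simp
      next
        case False
        then obtain e t \<phi> where db: "dual_basis R (\<mm> \<alpha>) e t \<phi>"
          using A.R.supramaximal_dual_basis[OF I] smax[OF \<alpha>] unfolding supramaximal_def by metis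
        have fl: "flat_at ?G e t \<phi>" using flat_at_ghost_ring[OF flat[OF \<alpha> False db]] .
        show ?thesis unfolding witt_vectors_def
          using I db fl UD(2,3) d by (rule G.ideal_smult_INT)
      qed
      then have "?d \<in> ideal_smult (\<mm> \<alpha>) ?W (witt_ring R E \<mm> A)"
        unfolding witt_ring_def using G.ideal_smult_carrier_update[OF I WD(2,3)] by simp
      then show ?thesis unfolding witt_ring_def using G.subring_minus_eq[OF WD(2) cl] by simp
    qed
    then show ?thesis by (auto simp: frob_step_def nat_pow_carrier_update witt_ring_def)
  qed
  ultimately show ?thesis
    using lambda_ring_iff[OF smax Wpsi] by (simp add: E_flat_lambda_ring_def witt_ring_def)
qed

section \<open>The adjunction\<close>

lemma underlying_algebra_simps [simp]:
  "carrier (underlying_algebra B) = carrier B"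
  "a \<otimes>\<^bsub>underlying_algebra B\<^esub> b = a \<otimes>\<^bsub>B\<^esub> b"
  "\<one>\<^bsub>underlying_algebra B\<^esub> = \<one>\<^bsub>B\<^esub>"
  "a \<oplus>\<^bsub>underlying_algebra B\<^esub> b = a \<oplus>\<^bsub>B\<^esub> b"
  "r \<odot>\<^bsub>underlying_algebra B\<^esub> a = r \<odot>\<^bsub>B\<^esub> a"
  by (simp_all add: underlying_algebra_def module.defs)

lemma alg_hom_underlying_algebra [simp]: "alg_hom R (underlying_algebra B) A = alg_hom R B A"
  by (simp add: alg_hom_def ring_hom_def)

lemma witt_ring_simps [simp]:
  "carrier (witt_ring R E \<mm> A) = witt_vectors R E \<mm> A"
  "a \<otimes>\<^bsub>witt_ring R E \<mm> A\<^esub> b = a \<otimes>\<^bsub>ghost_ring E A\<^esub> b"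
  "\<one>\<^bsub>witt_ring R E \<mm> A\<^esub> = \<one>\<^bsub>ghost_ring E A\<^esub>"
  "a \<oplus>\<^bsub>witt_ring R E \<mm> A\<^esub> b = a \<oplus>\<^bsub>ghost_ring E A\<^esub> b"
  "r \<odot>\<^bsub>witt_ring R E \<mm> A\<^esub> a = r \<odot>\<^bsub>ghost_ring E A\<^esub> a"
  "psi (witt_ring R E \<mm> A) k a = psi (ghost_ring E A) k a"
  by (simp_all add: witt_ring_def)

lemma witt_vectorsD:
  assumes "a \<in> witt_vectors R E \<mm> A"
  shows "a \<in> NE E \<rightarrow>\<^sub>E carrier A" and "k \<in> NE E \<Longrightarrow> a k \<in> carrier A"
proof -
  show *: "a \<in> NE E \<rightarrow>\<^sub>E carrier A"
    using subsetD[OF witt_vectors_subset[of R E \<mm> A 0] assms] by (simp add: ghost_ring_simps)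
  show "k \<in> NE E \<Longrightarrow> a k \<in> carrier A" using * by auto
qed

lemma Hom_algD: "g \<in> Hom_alg R A B \<Longrightarrow> g \<in> alg_hom R A B"
  "g \<in> Hom_alg R A B \<Longrightarrow> g \<in> extensional (carrier A)"
  by (auto simp: Hom_alg_def)

lemma Hom_psiD:
  assumes "h \<in> Hom_psi R E B C"
  shows "h \<in> alg_hom R B C" "h \<in> extensional (carrier B)"
    and "k \<in> NE E \<Longrightarrow> x \<in> carrier B \<Longrightarrow> h (psi B k x) = psi C k (h x)"
  using assms by (auto simp: Hom_psi_def Hom_alg_def)

lemma witt_map_apply:
  assumes "a \<in> witt_vectors R E \<mm> A"
  shows "witt_map R E \<mm> A g a = (\<lambda>k\<in>NE E. g (a k))"
  using assms by (simp add: witt_map_def)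

lemma witt_counit_apply: "a \<in> witt_vectors R E \<mm> A \<Longrightarrow> witt_counit R E \<mm> A a = a 0"
  by (simp add: witt_counit_def)

text \<open>The componentwise map commutes with shifts of the index, hence is an equivariant algebra
  map of ghost rings. By \<open>frob_step_image\<close> and induction it respects every
  approximation.\<close>

lemma witt_map_image:
  assumes A: "algebra R A" and A': "algebra R A'" and smax: "\<And>\<alpha>. \<alpha> \<in> E \<Longrightarrow> supramaximal R (\<mm> \<alpha>)"
    and g: "g \<in> alg_hom R A A'" and a: "a \<in> witt_vectors R E \<mm> A"
  shows "(\<lambda>k\<in>NE E. g (a k)) \<in> witt_vectors R E \<mm> A'"
proof -
  let ?h = "\<lambda>a. \<lambda>k\<in>NE E. g (a k)"
  have G: "is_psi_ring R E (ghost_ring E A)" and G': "is_psi_ring R E (ghost_ring E A')"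
    using ghost_ring_psi_ring A A' by auto
  have I: "ideal (\<mm> \<alpha>) R" if "\<alpha> \<in> E" for \<alpha> using smax[OF that] by (simp add: supramaximal_def)
  have sub: "witt_approx R E \<mm> A i \<subseteq> carrier (ghost_ring E A)" for i
    by (rule subringE(1)[OF is_sub_psi_ringD(2)]) (rule witt_approx_sub_psi_ring[OF A], rule smax)
  have sub': "witt_approx R E \<mm> A' i \<subseteq> carrier (ghost_ring E A')" for i
    by (rule subringE(1)[OF is_sub_psi_ringD(2)]) (rule witt_approx_sub_psi_ring[OF A'], rule smax)
  note gD = alg_homD[OF g]
  have h: "?h \<in> alg_hom R (ghost_ring E A) (ghost_ring E A')"
    by (rule alg_homI) (auto simp: ghost_ring_simps PiE_iff gD intro!: restrict_ext)
  have eqv: "?h (psi (ghost_ring E A) k x) = psi (ghost_ring E A') k (?h x)" if "k \<in> NE E" for k x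
    unfolding ghost_ring_simps by (rule restrict_ext) (simp add: add_in_NE that)
  have "?h ` witt_approx R E \<mm> A i \<subseteq> witt_approx R E \<mm> A' i" for i
  proof (induction i)
    case 0
    show ?case unfolding witt_approx.simps using alg_homD(1)[OF h] by (rule image_subsetI)
  next
    case (Suc i)
    show ?case unfolding witt_approx_Suc
      using G is_psi_ringD(1)[OF G'] I h eqv sub sub' Suc by (rule frob_step_image)
  qed
  then show ?thesis using a unfolding witt_vectors_def by blast
qed

lemma transpose_in_witt_vectors:
  assumes A: "algebra R A" and B: "is_lambda_ring R E \<mm> B" and smax: "\<And>\<alpha>. \<alpha> \<in> E \<Longrightarrow> supramaximal R (\<mm> \<alpha>)"
    and g: "g \<in> alg_hom R B A"
  shows "(\<lambda>b. \<lambda>k\<in>NE E. g (psi B k b)) \<in> alg_hom R B (ghost_ring E A)" (is "?h \<in> _")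
    and "l \<in> NE E \<Longrightarrow> b \<in> carrier B \<Longrightarrow>
      (\<lambda>k\<in>NE E. g (psi B k (psi B l b))) = psi (ghost_ring E A) l (\<lambda>k\<in>NE E. g (psi B k b))"
    and "b \<in> carrier B \<Longrightarrow> (\<lambda>k\<in>NE E. g (psi B k b)) \<in> witt_vectors R E \<mm> A"
proof -
  have Bpsi: "is_psi_ring R E B" using B by (simp add: is_lambda_ring_def)
  note psi = is_psi_ringD[OF Bpsi]
  have G: "is_psi_ring R E (ghost_ring E A)" using A by (rule ghost_ring_psi_ring)
  have I: "ideal (\<mm> \<alpha>) R" if "\<alpha> \<in> E" for \<alpha> using smax[OF that] by (simp add: supramaximal_def)
  note gD = alg_homD[OF g]
  show h: "?h \<in> alg_hom R B (ghost_ring E A)"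
    by (rule alg_homI) (auto simp: ghost_ring_simps gD psi intro!: restrict_ext)
  \<comment> \<open>Both sides have \<open>k\<close>-th component
    \<open>g (psi B (k + l) b)\<close>: on the left by the action on \<open>B\<close>, on the right
    by the shift of the index.\<close>
  show eqv: "?h (psi B l b) = psi (ghost_ring E A) l (?h b)" if "l \<in> NE E" "b \<in> carrier B" for l b
    unfolding ghost_ring_simps by (rule restrict_ext) (simp add: add_in_NE that psi)
  have step: "frob_step R E \<mm> B (carrier B) = carrier B"
    using lambda_ring_iff[OF smax Bpsi] B by simp
  have sub: "witt_approx R E \<mm> A i \<subseteq> carrier (ghost_ring E A)" for i
    by (rule subringE(1)[OF is_sub_psi_ringD(2)]) (rule witt_approx_sub_psi_ring[OF A], rule smax)
  have "?h ` carrier B \<subseteq> witt_approx R E \<mm> A i" for i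
  proof (induction i)
    case 0
    show ?case unfolding witt_approx.simps using alg_homD(1)[OF h] by (rule image_subsetI)
  next
    case (Suc i)
    \<comment> \<open>Only the target shrinks from stage to stage. The source stays
      \<open>carrier B\<close>, which \<open>frob_step\<close> leaves unchanged because
      \<open>B\<close> is a \<Lambda>-ring.\<close>
    have "?h ` frob_step R E \<mm> B (carrier B) \<subseteq> frob_step R E \<mm> (ghost_ring E A) (witt_approx R E \<mm> A i)"
      using Bpsi is_psi_ringD(1)[OF G] I h eqv order.refl sub Suc by (rule frob_step_image)
    then show ?case unfolding step witt_approx_Suc .
  qed
  then show "?h b \<in> witt_vectors R E \<mm> A" if "b \<in> carrier B" using that unfolding witt_vectors_def by blast
qed

section \<open>Functoriality of the Witt vectors\<close>

lemma witt_map_Hom_psi: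
  assumes A: "algebra R A" and A': "algebra R A'" and smax: "\<And>\<alpha>. \<alpha> \<in> E \<Longrightarrow> supramaximal R (\<mm> \<alpha>)"
    and g: "g \<in> Hom_alg R A A'"
  shows "witt_map R E \<mm> A g \<in> Hom_psi R E (witt_ring R E \<mm> A) (witt_ring R E \<mm> A')"
proof -
  have W: "is_sub_psi_ring R E (witt_vectors R E \<mm> A) (ghost_ring E A)"
    using A smax by (rule witt_vectors_sub_psi_ring)
  note WD = is_sub_psi_ringD[OF W] and sub = subringE[OF is_sub_psi_ringD(2)[OF W]]
  note gD = alg_homD[OF Hom_algD(1)[OF g]]
  have img: "(\<lambda>k\<in>NE E. g (a k)) \<in> witt_vectors R E \<mm> A'" if "a \<in> witt_vectors R E \<mm> A" for a
    using A A' smax Hom_algD(1)[OF g] that by (rule witt_map_image)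
  have "witt_map R E \<mm> A g \<in> alg_hom R (witt_ring R E \<mm> A) (witt_ring R E \<mm> A')"
  proof (rule alg_homI; simp only: witt_ring_simps)
    fix a assume a: "a \<in> witt_vectors R E \<mm> A"
    show "witt_map R E \<mm> A g a \<in> witt_vectors R E \<mm> A'" unfolding witt_map_apply[OF a] by (rule img[OF a])
    show "witt_map R E \<mm> A g (r \<odot>\<^bsub>ghost_ring E A\<^esub> a) = r \<odot>\<^bsub>ghost_ring E A'\<^esub> witt_map R E \<mm> A g a"
      if "r \<in> carrier R" for r
      unfolding witt_map_apply[OF a] witt_map_apply[OF WD(3)[OF that a]]
      unfolding ghost_ring_simps
      by (rule restrict_ext) (simp add: gD witt_vectorsD(2)[OF a] that)
    fix b assume b: "b \<in> witt_vectors R E \<mm> A"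
    show "witt_map R E \<mm> A g (a \<oplus>\<^bsub>ghost_ring E A\<^esub> b) =
        witt_map R E \<mm> A g a \<oplus>\<^bsub>ghost_ring E A'\<^esub> witt_map R E \<mm> A g b"
      unfolding witt_map_apply[OF a] witt_map_apply[OF b] witt_map_apply[OF sub(7)[OF a b]]
      unfolding ghost_ring_simps
      by (rule restrict_ext) (simp add: gD witt_vectorsD(2)[OF a] witt_vectorsD(2)[OF b])
    show "witt_map R E \<mm> A g (a \<otimes>\<^bsub>ghost_ring E A\<^esub> b) =
        witt_map R E \<mm> A g a \<otimes>\<^bsub>ghost_ring E A'\<^esub> witt_map R E \<mm> A g b"
      unfolding witt_map_apply[OF a] witt_map_apply[OF b] witt_map_apply[OF sub(6)[OF a b]]
      unfolding ghost_ring_simps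
      by (rule restrict_ext) (simp add: gD witt_vectorsD(2)[OF a] witt_vectorsD(2)[OF b])
  next
    show "witt_map R E \<mm> A g \<one>\<^bsub>ghost_ring E A\<^esub> = \<one>\<^bsub>ghost_ring E A'\<^esub>"
      unfolding witt_map_apply[OF sub(3)] unfolding ghost_ring_simps by (rule restrict_ext) (simp add: gD)
  qed
  moreover have "witt_map R E \<mm> A g (psi (witt_ring R E \<mm> A) k a) = psi (witt_ring R E \<mm> A') k (witt_map R E \<mm> A g a)"
    if k: "k \<in> NE E" and a: "a \<in> carrier (witt_ring R E \<mm> A)" for k a
  proof -
    have a': "a \<in> witt_vectors R E \<mm> A" using a by simp
    show ?thesis
      unfolding witt_ring_simps witt_map_apply[OF a'] witt_map_apply[OF WD(4)[OF k a']]
      unfolding ghost_ring_simps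
      by (rule restrict_ext) (simp add: add_in_NE k)
  qed
  moreover have "witt_map R E \<mm> A g \<in> extensional (carrier (witt_ring R E \<mm> A))"
    by (simp add: witt_map_def)
  ultimately show ?thesis by (simp add: Hom_psi_def Hom_alg_def)
qed

lemma witt_map_id: "witt_map R E \<mm> A (\<lambda>x\<in>carrier A. x) = (\<lambda>a\<in>carrier (witt_ring R E \<mm> A). a)"
  unfolding witt_map_def witt_ring_simps
proof (rule restrict_ext)
  fix a assume a: "a \<in> witt_vectors R E \<mm> A"
  show "(\<lambda>k\<in>NE E. (\<lambda>x\<in>carrier A. x) (a k)) = a"
    using witt_vectorsD(1)[OF a] by (intro PiE_ext[of _ "NE E" "\<lambda>_. carrier A"]) (auto simp: PiE_iff)
qed

lemma witt_map_compose:
  assumes A: "algebra R A" and A': "algebra R A'" and smax: "\<And>\<alpha>. \<alpha> \<in> E \<Longrightarrow> supramaximal R (\<mm> \<alpha>)"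
    and g: "g \<in> alg_hom R A A'"
  shows "witt_map R E \<mm> A (compose (carrier A) g' g)
          = compose (carrier (witt_ring R E \<mm> A)) (witt_map R E \<mm> A' g') (witt_map R E \<mm> A g)"
  unfolding compose_def witt_ring_simps
  unfolding witt_map_def[of R E \<mm> A "\<lambda>x\<in>carrier A. g' (g x)"]
proof (rule restrict_ext)
  fix a assume a: "a \<in> witt_vectors R E \<mm> A"
  \<comment> \<open>\<open>witt_map\<close> is undefined outside the Witt vectors, so the outer map
    can be evaluated only after the inner image is known to lie there.\<close>
  have img: "(\<lambda>k\<in>NE E. g (a k)) \<in> witt_vectors R E \<mm> A'"
    using A A' smax g a by (rule witt_map_image)
  show "(\<lambda>k\<in>NE E. (\<lambda>x\<in>carrier A. g' (g x)) (a k)) = witt_map R E \<mm> A' g' (witt_map R E \<mm> A g a)"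
    unfolding witt_map_apply[OF a] witt_map_apply[OF img]
    by (rule restrict_ext) (simp add: witt_vectorsD(2)[OF a])
qed

section \<open>The counit and the hom-set bijection\<close>

lemma witt_counit_alg_hom:
  assumes A: "algebra R A" and smax: "\<And>\<alpha>. \<alpha> \<in> E \<Longrightarrow> supramaximal R (\<mm> \<alpha>)"
  shows "witt_counit R E \<mm> A \<in> alg_hom R (witt_ring R E \<mm> A) A"
proof -
  have W: "is_sub_psi_ring R E (witt_vectors R E \<mm> A) (ghost_ring E A)"
    using A smax by (rule witt_vectors_sub_psi_ring)
  note WD = is_sub_psi_ringD[OF W] and sub = subringE[OF is_sub_psi_ringD(2)[OF W]]
  show ?thesis
  proof (rule alg_homI; simp only: witt_ring_simps)
    fix a assume a: "a \<in> witt_vectors R E \<mm> A"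
    show "witt_counit R E \<mm> A a \<in> carrier A"
      unfolding witt_counit_apply[OF a] by (rule witt_vectorsD(2)[OF a]) simp
    show "witt_counit R E \<mm> A (r \<odot>\<^bsub>ghost_ring E A\<^esub> a) = r \<odot>\<^bsub>A\<^esub> witt_counit R E \<mm> A a" if "r \<in> carrier R" for r
      unfolding witt_counit_apply[OF a] witt_counit_apply[OF WD(3)[OF that a]] by (simp add: ghost_ring_simps)
    fix b assume b: "b \<in> witt_vectors R E \<mm> A"
    show "witt_counit R E \<mm> A (a \<oplus>\<^bsub>ghost_ring E A\<^esub> b) = witt_counit R E \<mm> A a \<oplus>\<^bsub>A\<^esub> witt_counit R E \<mm> A b"
      unfolding witt_counit_apply[OF a] witt_counit_apply[OF b] witt_counit_apply[OF sub(7)[OF a b]]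
      by (simp add: ghost_ring_simps)
    show "witt_counit R E \<mm> A (a \<otimes>\<^bsub>ghost_ring E A\<^esub> b) = witt_counit R E \<mm> A a \<otimes>\<^bsub>A\<^esub> witt_counit R E \<mm> A b"
      unfolding witt_counit_apply[OF a] witt_counit_apply[OF b] witt_counit_apply[OF sub(6)[OF a b]]
      by (simp add: ghost_ring_simps)
  next
    show "witt_counit R E \<mm> A \<one>\<^bsub>ghost_ring E A\<^esub> = \<one>\<^bsub>A\<^esub>"
      unfolding witt_counit_apply[OF sub(3)] by (simp add: ghost_ring_simps)
  qed
qed

text \<open>The inverse is forced by equivariance. The \<open>k\<close>-th component of
  \<open>h b\<close> is the component of index 0 of \<open>psi k (h b) = h (psi k b)\<close>, that
  is, the counit of \<open>h (psi k b)\<close>. So \<open>h\<close> is recovered from its composite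
  with the counit.\<close>

lemma witt_adjunction_bij:
  assumes A: "algebra R A" and B: "is_lambda_ring R E \<mm> B" and smax: "\<And>\<alpha>. \<alpha> \<in> E \<Longrightarrow> supramaximal R (\<mm> \<alpha>)"
  shows "bij_betw (\<lambda>h. compose (carrier B) (witt_counit R E \<mm> A) h)
          (Hom_psi R E B (witt_ring R E \<mm> A)) (Hom_alg R (underlying_algebra B) A)"
proof (rule bij_betwI)
  let ?\<Psi> = "\<lambda>g. \<lambda>b\<in>carrier B. \<lambda>k\<in>NE E. g (psi B k b)"
  let ?\<epsilon> = "witt_counit R E \<mm> A"
  have Bpsi: "is_psi_ring R E B" using B by (simp add: is_lambda_ring_def)
  note psi = is_psi_ringD[OF Bpsi]
  interpret B: algebra R B by (rule psi(1))
  have \<epsilon>: "?\<epsilon> \<in> alg_hom R (witt_ring R E \<mm> A) A" using A smax by (rule witt_counit_alg_hom)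
  note \<epsilon>D = alg_homD[OF \<epsilon>]
  show "(\<lambda>h. compose (carrier B) ?\<epsilon> h) \<in> Hom_psi R E B (witt_ring R E \<mm> A) \<rightarrow> Hom_alg R (underlying_algebra B) A"
  proof
    fix h assume h: "h \<in> Hom_psi R E B (witt_ring R E \<mm> A)"
    note hD = alg_homD[OF Hom_psiD(1)[OF h]]
    have "compose (carrier B) ?\<epsilon> h \<in> alg_hom R B A"
      by (rule alg_homI) (simp_all add: compose_eq hD \<epsilon>D del: witt_ring_simps)
    then show "compose (carrier B) ?\<epsilon> h \<in> Hom_alg R (underlying_algebra B) A"
      by (simp add: Hom_alg_def)
  qed
  show "?\<Psi> \<in> Hom_alg R (underlying_algebra B) A \<rightarrow> Hom_psi R E B (witt_ring R E \<mm> A)"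
  proof
    fix g assume "g \<in> Hom_alg R (underlying_algebra B) A"
    then have g: "g \<in> alg_hom R B A" by (simp add: Hom_alg_def)
    note t = transpose_in_witt_vectors[OF A B smax g]
    note tD = alg_homD[OF t(1)]
    have "?\<Psi> g \<in> alg_hom R B (witt_ring R E \<mm> A)"
      by (rule alg_homI) (simp_all add: t(3) tD(2-5))
    then show "?\<Psi> g \<in> Hom_psi R E B (witt_ring R E \<mm> A)"
      by (simp add: Hom_psi_def Hom_alg_def t(2) psi(3))
  qed
  show "?\<Psi> (compose (carrier B) ?\<epsilon> h) = h" if h: "h \<in> Hom_psi R E B (witt_ring R E \<mm> A)" for h
  proof (rule extensionalityI[of _ "carrier B"])
    fix b assume b: "b \<in> carrier B"
    have hW: "h x \<in> witt_vectors R E \<mm> A" if "x \<in> carrier B" for x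
      using alg_homD(1)[OF Hom_psiD(1)[OF h] that] by simp
    have "(\<lambda>k\<in>NE E. compose (carrier B) ?\<epsilon> h (psi B k b)) = h b"
    proof (rule PiE_ext[of _ "NE E" "\<lambda>_. carrier A"])
      have *: "compose (carrier B) ?\<epsilon> h (psi B k b) = h b k" if k: "k \<in> NE E" for k
        using hW[OF psi(3)[OF k b]] Hom_psiD(3)[OF h k b] k b psi(3)[OF k b]
        by (simp add: compose_eq witt_counit_apply) (simp add: ghost_ring_simps)
      then show "(\<lambda>k\<in>NE E. compose (carrier B) ?\<epsilon> h (psi B k b)) k = h b k" if "k \<in> NE E" for k
        using that by simp
      show "(\<lambda>k\<in>NE E. compose (carrier B) ?\<epsilon> h (psi B k b)) \<in> NE E \<rightarrow>\<^sub>E carrier A"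
        using * witt_vectorsD(2)[OF hW[OF b]] by simp
    qed (rule witt_vectorsD(1)[OF hW[OF b]])
    then show "?\<Psi> (compose (carrier B) ?\<epsilon> h) b = h b" using b by simp
  qed (use Hom_psiD(2)[OF h] in auto)
  show "compose (carrier B) ?\<epsilon> (?\<Psi> g) = g" if "g \<in> Hom_alg R (underlying_algebra B) A" for g
  proof (rule extensionalityI[of _ "carrier B"])
    have g: "g \<in> alg_hom R B A" using that by (simp add: Hom_alg_def)
    show "g \<in> extensional (carrier B)" using that by (simp add: Hom_alg_def)
    fix b assume b: "b \<in> carrier B"
    have "(\<lambda>k\<in>NE E. g (psi B k b)) \<in> witt_vectors R E \<mm> A"
      using A B smax g b by (rule transpose_in_witt_vectors(3))
    \<comment> \<open>The component of index 0 is \<open>g (psi B 0 b)\<close>, and index 0 acts as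
      the identity.\<close>
    then show "compose (carrier B) ?\<epsilon> (?\<Psi> g) b = g b"
      using b psi(8) by (simp add: compose_eq witt_counit_apply)
  qed simp
qed

theorem proposition1p9:
  fixes R :: "'r ring" and E :: "'e set" and \<mm> :: "'e \<Rightarrow> 'r set"
  assumes "cring R"
    and "\<forall>\<alpha> \<in> E. supramaximal R (\<mm> \<alpha>)"
    and "pairwise_coprime_ideals R E \<mm>"
  shows
    \<comment> \<open>(a)\<close>
    "(\<forall>A :: ('r, 'a) module. E_flat_algebra R E \<mm> A \<longrightarrow>
        is_sub_psi_ring R E (witt_vectors R E \<mm> A) (ghost_ring E A))
   \<and> \<comment> \<open>(b)\<close>
     (\<forall>A :: ('r, 'a) module. E_flat_algebra R E \<mm> A \<longrightarrow>
        E_flat_lambda_ring R E \<mm> (witt_ring R E \<mm> A))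
   \<and> \<comment> \<open>(c), functoriality\<close>
     (\<forall>(A :: ('r, 'a) module) (A' :: ('r, 'b) module). \<forall>g \<in> Hom_alg R A A'.
        E_flat_algebra R E \<mm> A \<longrightarrow> E_flat_algebra R E \<mm> A' \<longrightarrow>
        witt_map R E \<mm> A g \<in> Hom_psi R E (witt_ring R E \<mm> A) (witt_ring R E \<mm> A'))
   \<and> (\<forall>A :: ('r, 'a) module. E_flat_algebra R E \<mm> A \<longrightarrow>
        witt_map R E \<mm> A (\<lambda>x\<in>carrier A. x) = (\<lambda>a\<in>carrier (witt_ring R E \<mm> A). a))
   \<and> (\<forall>(A :: ('r, 'a) module) (A' :: ('r, 'b) module) (A'' :: ('r, 'c) module).
      \<forall>g \<in> Hom_alg R A A'. \<forall>g' \<in> Hom_alg R A' A''.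
        E_flat_algebra R E \<mm> A \<longrightarrow> E_flat_algebra R E \<mm> A' \<longrightarrow> E_flat_algebra R E \<mm> A'' \<longrightarrow>
        witt_map R E \<mm> A (compose (carrier A) g' g)
          = compose (carrier (witt_ring R E \<mm> A)) (witt_map R E \<mm> A' g') (witt_map R E \<mm> A g))
   \<and> \<comment> \<open>(c), the hom-set bijection given by the counit\<close>
     (\<forall>A :: ('r, 'a) module. E_flat_algebra R E \<mm> A \<longrightarrow>
        witt_counit R E \<mm> A \<in> Hom_alg R (underlying_algebra (witt_ring R E \<mm> A)) A)
   \<and> (\<forall>(B :: ('r, 'd, 'e) psi_ring) (A :: ('r, 'a) module).
        E_flat_lambda_ring R E \<mm> B \<longrightarrow> E_flat_algebra R E \<mm> A \<longrightarrow>
        bij_betw (\<lambda>h. compose (carrier B) (witt_counit R E \<mm> A) h)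
          (Hom_psi R E B (witt_ring R E \<mm> A))
          (Hom_alg R (underlying_algebra B) A))
   \<and> \<comment> \<open>(c), naturality in the algebra\<close>
     (\<forall>(B :: ('r, 'd, 'e) psi_ring) (A :: ('r, 'a) module) (A' :: ('r, 'b) module).
      \<forall>g \<in> Hom_alg R A A'. \<forall>h \<in> Hom_psi R E B (witt_ring R E \<mm> A).
        E_flat_lambda_ring R E \<mm> B \<longrightarrow> E_flat_algebra R E \<mm> A \<longrightarrow> E_flat_algebra R E \<mm> A' \<longrightarrow>
        compose (carrier B) (witt_counit R E \<mm> A') (compose (carrier B) (witt_map R E \<mm> A g) h)
          = compose (carrier B) g (compose (carrier B) (witt_counit R E \<mm> A) h))
   \<and> \<comment> \<open>(c), naturality in the \<open>\<Lambda>\<close>-ring\<close>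
     (\<forall>(B :: ('r, 'd, 'e) psi_ring) (B' :: ('r, 'f, 'e) psi_ring) (A :: ('r, 'a) module).
      \<forall>f \<in> Hom_psi R E B' B. \<forall>h \<in> Hom_psi R E B (witt_ring R E \<mm> A).
        E_flat_lambda_ring R E \<mm> B \<longrightarrow> E_flat_lambda_ring R E \<mm> B' \<longrightarrow> E_flat_algebra R E \<mm> A \<longrightarrow>
        compose (carrier B') (witt_counit R E \<mm> A) (compose (carrier B') h f)
          = compose (carrier B') (compose (carrier B) (witt_counit R E \<mm> A) h) f)"
proof (intro conjI allI ballI impI)
  have smax: "supramaximal R (\<mm> \<alpha>)" if "\<alpha> \<in> E" for \<alpha> using assms(2) that by blast
  note defs = E_flat_algebra_def E_flat_lambda_ring_def
  {
    fix A :: "('r, 'a) module" assume A: "E_flat_algebra R E \<mm> A"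
    then have alg: "algebra R A" by (simp add: defs)
    show "is_sub_psi_ring R E (witt_vectors R E \<mm> A) (ghost_ring E A)"
      using alg smax by (rule witt_vectors_sub_psi_ring)
    show "E_flat_lambda_ring R E \<mm> (witt_ring R E \<mm> A)"
      using A smax by (rule witt_ring_lambda_ring)
    show "witt_map R E \<mm> A (\<lambda>x\<in>carrier A. x) = (\<lambda>a\<in>carrier (witt_ring R E \<mm> A). a)"
      by (rule witt_map_id)
    have "witt_counit R E \<mm> A \<in> alg_hom R (witt_ring R E \<mm> A) A"
      using alg smax by (rule witt_counit_alg_hom)
    then show "witt_counit R E \<mm> A \<in> Hom_alg R (underlying_algebra (witt_ring R E \<mm> A)) A"
      by (simp add: Hom_alg_def witt_counit_def)
  next
    fix A :: "('r, 'a) module" and A' :: "('r, 'b) module" and g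
    assume g: "g \<in> Hom_alg R A A'" and "E_flat_algebra R E \<mm> A" "E_flat_algebra R E \<mm> A'"
    then have "algebra R A" "algebra R A'" by (simp_all add: defs)
    then show "witt_map R E \<mm> A g \<in> Hom_psi R E (witt_ring R E \<mm> A) (witt_ring R E \<mm> A')"
      using smax g by (rule witt_map_Hom_psi)
  next
    fix A :: "('r, 'a) module" and A' :: "('r, 'b) module" and A'' :: "('r, 'c) module" and g g'
    assume g: "g \<in> Hom_alg R A A'" and "E_flat_algebra R E \<mm> A" "E_flat_algebra R E \<mm> A'"
    then have "algebra R A" "algebra R A'" by (simp_all add: defs)
    then show "witt_map R E \<mm> A (compose (carrier A) g' g)
          = compose (carrier (witt_ring R E \<mm> A)) (witt_map R E \<mm> A' g') (witt_map R E \<mm> A g)"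
      using smax Hom_algD(1)[OF g] by (rule witt_map_compose)
  next
    fix B :: "('r, 'd, 'e) psi_ring" and A :: "('r, 'a) module"
    assume "E_flat_lambda_ring R E \<mm> B" "E_flat_algebra R E \<mm> A"
    then have "algebra R A" "is_lambda_ring R E \<mm> B" by (simp_all add: defs)
    then show "bij_betw (\<lambda>h. compose (carrier B) (witt_counit R E \<mm> A) h)
          (Hom_psi R E B (witt_ring R E \<mm> A)) (Hom_alg R (underlying_algebra B) A)"
      using smax by (rule witt_adjunction_bij)
  next
    fix B :: "('r, 'd, 'e) psi_ring" and A :: "('r, 'a) module" and A' :: "('r, 'b) module" and g h
    assume g: "g \<in> Hom_alg R A A'" and h: "h \<in> Hom_psi R E B (witt_ring R E \<mm> A)"
      and "E_flat_algebra R E \<mm> A" "E_flat_algebra R E \<mm> A'"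
    then have alg: "algebra R A" "algebra R A'" by (simp_all add: defs)
    show "compose (carrier B) (witt_counit R E \<mm> A') (compose (carrier B) (witt_map R E \<mm> A g) h)
          = compose (carrier B) g (compose (carrier B) (witt_counit R E \<mm> A) h)"
      unfolding compose_def
    proof (rule restrict_ext)
      fix b assume b: "b \<in> carrier B"
      have hb: "h b \<in> witt_vectors R E \<mm> A" using alg_homD(1)[OF Hom_psiD(1)[OF h] b] by simp
      \<comment> \<open>Both sides apply \<open>g\<close> to the component of index 0. This
        membership is what allows the counit, which is restricted to Witt vectors, to be evaluated
        on the left.\<close>
      have img: "(\<lambda>k\<in>NE E. g (h b k)) \<in> witt_vectors R E \<mm> A'"
        using alg smax Hom_algD(1)[OF g] hb by (rule witt_map_image)
      have "witt_map R E \<mm> A g (h b) 0 = g (h b 0)" by (simp add: witt_map_apply[OF hb])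
      then show "witt_counit R E \<mm> A' ((\<lambda>x\<in>carrier B. witt_map R E \<mm> A g (h x)) b)
          = g ((\<lambda>x\<in>carrier B. witt_counit R E \<mm> A (h x)) b)"
        using b witt_counit_apply[OF hb] witt_counit_apply[OF img, folded witt_map_apply[OF hb]] by simp
    qed
  next
    fix B :: "('r, 'd, 'e) psi_ring" and B' :: "('r, 'f, 'e) psi_ring" and A :: "('r, 'a) module" and f h
    assume f: "f \<in> Hom_psi R E B' B"
    show "compose (carrier B') (witt_counit R E \<mm> A) (compose (carrier B') h f)
          = compose (carrier B') (compose (carrier B) (witt_counit R E \<mm> A) h) f"
      unfolding compose_def by (rule restrict_ext) (simp add: alg_homD(1)[OF Hom_psiD(1)[OF f]])
  }
qed

end
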